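(* Let $\mathbf{U}=\bigvee_{p\in\mathbb{P}}\mathbf{Ab}(p)*\mathbf{Ab}(p-1)$. Given a finitely generated subgroup $H$ of the free group $F_n$ of finite rank $n$ (given by a finite generating set of reduced words), it is decidable whether or not $H$ is $\mathbf{U}$-dense, i.e. dense in the pro-$\mathbf{U}$ topology on $F_n$.
   Context: A pseudovariety is a class of finite groups closed under taking subgroups, homomorphic images and finitary direct products; $\bigvee$ denotes join (smallest pseudovariety containing all the given ones). $\mathbb{P}$ is the set of all primes. $\mathbf{Ab}(n)$ is the pseudovariety of finite abelian groups of exponent dividing $n$. For pseudovarieties $\mathbf{V},\mathbf{W}$, $\mathbf{V}*\mathbf{W}$ is the pseudovariety of all finite groups $G$ having a normal subgroup $N\in\mathbf{V}$ with $G/N\in\mathbf{W}$. For a pseudovariety $\mathbf{V}$, the pro-$\mathbf{V}$ topology on a group $G$ is the coarsest topology making all homomorphisms from $G$ to (discrete) groups in $\mathbf{V}$ continuous; equivalently, $G$ is a topological group in which the normal subgroups $K$ with $G/K\in\mathbf{V}$ form a basis of neighbourhoods of the identity. A subgroup $H\le G$ is dense in this topology if and only if $HN=G$ for every $N\unlhd G$ with $G/N\in\mathbf{V}$. *)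

theory Defs
  imports
    "HOL-Algebra.Product_Groups"
    "HOL-Algebra.Generated_Groups"
    "HOL-Analysis.Abstract_Topology"
    "HOL-Computational_Algebra.Primes"
    "HOL-Library.Nat_Bijection"
begin

section \<open>Pseudovarieties of finite groups\<close>

text \<open>
  Every finite group is isomorphic to one whose carrier is a set of natural numbers, so a class of
  finite groups closed under isomorphism is represented by its members of type
  \<^typ>\<open>nat monoid\<close>.
\<close>

definition finite_groups :: "nat monoid set" where
  "finite_groups = {G. group G \<and> finite (carrier G)}"

text \<open>
  Closure under homomorphic images includes closure under isomorphism, and the index set \<open>I\<close> of a
  finitary direct product may be empty, so that a pseudovariety contains the trivial groups.
\<close>

definition pseudovariety :: "nat monoid set \<Rightarrow> bool" where
  "pseudovariety V \<longleftrightarrow>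
     V \<subseteq> finite_groups \<and>
     (\<forall>G\<in>V. \<forall>H. subgroup H G \<longrightarrow> G\<lparr>carrier := H\<rparr> \<in> V) \<and>
     (\<forall>G\<in>V. \<forall>K\<in>finite_groups. (\<exists>f\<in>hom G K. f ` carrier G = carrier K) \<longrightarrow> K \<in> V) \<and>
     (\<forall>(I :: nat set) Gs. \<forall>K\<in>finite_groups.
        finite I \<and> (\<forall>i\<in>I. Gs i \<in> V) \<and> K \<cong> product_group I Gs \<longrightarrow> K \<in> V)"

text \<open>Membership, up to isomorphism, of a group with an arbitrary type of elements.\<close>

definition in_pv :: "('a, 'b) monoid_scheme \<Rightarrow> nat monoid set \<Rightarrow> bool" where
  "in_pv G V \<longleftrightarrow> (\<exists>K\<in>V. G \<cong> K)"

definition pv_join :: "nat monoid set set \<Rightarrow> nat monoid set" where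
  "pv_join \<V> = \<Inter>{W. pseudovariety W \<and> \<Union>\<V> \<subseteq> W}"

definition pv_prod :: "nat monoid set \<Rightarrow> nat monoid set \<Rightarrow> nat monoid set" where
  "pv_prod V W =
     {G \<in> finite_groups. \<exists>N. N \<lhd> G \<and> in_pv (G\<lparr>carrier := N\<rparr>) V \<and> in_pv (G Mod N) W}"

definition Ab :: "nat \<Rightarrow> nat monoid set" where
  "Ab n = {G \<in> finite_groups. comm_group G \<and> (\<forall>x\<in>carrier G. x [^]\<^bsub>G\<^esub> n = \<one>\<^bsub>G\<^esub>)}"

definition U_pv :: "nat monoid set" where
  "U_pv = pv_join {pv_prod (Ab p) (Ab (p - 1)) | p. prime p}"


section \<open>The pro-V topology\<close>

definition pro_topology :: "nat monoid set \<Rightarrow> ('a, 'b) monoid_scheme \<Rightarrow> 'a topology" where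
  "pro_topology V G =
     topology_generated_by
       {{x \<in> carrier G. f x \<in> S} | f K S. K \<in> V \<and> f \<in> hom G K \<and> S \<subseteq> carrier K}"

definition pro_dense :: "nat monoid set \<Rightarrow> ('a, 'b) monoid_scheme \<Rightarrow> 'a set \<Rightarrow> bool" where
  "pro_dense V G H \<longleftrightarrow> pro_topology V G closure_of H = carrier G"


section \<open>Free groups\<close>

text \<open>
  The letter \<open>(i, True)\<close> is the generator \<open>x\<^sub>i\<close> and \<open>(i, False)\<close> is its inverse; the generators of
  the free group of rank \<open>n\<close> are \<open>x\<^sub>0, \<dots>, x\<^sub>n\<^sub>-\<^sub>1\<close>.
\<close>

type_synonym letter = "nat \<times> bool"
type_synonym word = "letter list"

definition inv_letter :: "letter \<Rightarrow> letter" where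
  "inv_letter x = (fst x, \<not> snd x)"

definition reduced :: "word \<Rightarrow> bool" where
  "reduced w \<longleftrightarrow> successively (\<lambda>x y. y \<noteq> inv_letter x) w"

definition cons_reduce :: "letter \<Rightarrow> word \<Rightarrow> word" where
  "cons_reduce x w = (if w \<noteq> [] \<and> hd w = inv_letter x then tl w else x # w)"

definition reduce :: "word \<Rightarrow> word" where
  "reduce w = foldr cons_reduce w []"

definition free_group :: "nat \<Rightarrow> word monoid" where
  "free_group n =
     \<lparr>carrier = {w. reduced w \<and> fst ` set w \<subseteq> {..<n}}, monoid.mult = \<lambda>u v. reduce (u @ v), one = []\<rparr>"

lemma inv_letter_inv_letter [simp]: "inv_letter (inv_letter x) = x"
  by (simp add: inv_letter_def)

lemma fst_inv_letter [simp]: "fst (inv_letter x) = fst x"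
  by (simp add: inv_letter_def)

lemma reduced_Nil [simp]: "reduced []"
  by (simp add: reduced_def)

lemma reduced_Cons: "reduced (x # w) \<longleftrightarrow> (w \<noteq> [] \<longrightarrow> hd w \<noteq> inv_letter x) \<and> reduced w"
  by (cases w) (auto simp: reduced_def)

lemma reduced_cons_reduce: "reduced w \<Longrightarrow> reduced (cons_reduce x w)"
  by (cases w) (auto simp: cons_reduce_def reduced_Cons)

lemma reduced_foldr: "reduced w \<Longrightarrow> reduced (foldr cons_reduce u w)"
  by (induction u) (auto intro: reduced_cons_reduce)

lemma reduced_reduce: "reduced (reduce w)"
  by (simp add: reduce_def reduced_foldr)

lemma reduce_reduced: "reduced w \<Longrightarrow> reduce w = w"
  by (induction w) (auto simp: reduce_def reduced_Cons cons_reduce_def)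

lemma cons_reduce_inv: "reduced w \<Longrightarrow> cons_reduce (inv_letter x) (cons_reduce x w) = w"
  by (cases w; cases "tl w") (auto simp: cons_reduce_def reduced_Cons)

lemma foldr_cons_reduce:
  assumes "reduced w"
  shows "foldr cons_reduce (cons_reduce x u) w = cons_reduce x (foldr cons_reduce u w)"
proof (cases "u \<noteq> [] \<and> hd u = inv_letter x")
  case True
  then obtain v where v: "u = inv_letter x # v" by (cases u) auto
  then show ?thesis
    using cons_reduce_inv[OF reduced_foldr[OF assms], of "inv_letter x"]
    by (simp add: cons_reduce_def[of x "_ # _"])
next
  case False
  then show ?thesis by (auto simp: cons_reduce_def[of x u])
qed

lemma foldr_reduce: "reduced w \<Longrightarrow> foldr cons_reduce (reduce u) w = foldr cons_reduce u w"
  by (induction u) (auto simp: reduce_def foldr_cons_reduce)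

lemma reduce_append: "reduce (u @ v) = foldr cons_reduce u (reduce v)"
  by (simp add: reduce_def)

lemma fst_set_reduce: "fst ` set (reduce w) \<subseteq> fst ` set w"
proof (induction w)
  case (Cons x w)
  have "set (cons_reduce x u) \<subseteq> insert x (set u)" for u
    by (cases u) (auto simp: cons_reduce_def)
  then have "fst ` set (reduce (x # w)) \<subseteq> insert (fst x) (fst ` set (reduce w))"
    by (fastforce simp: reduce_def)
  also have "\<dots> \<subseteq> fst ` set (x # w)" using Cons by auto
  finally show ?case .
qed (simp add: reduce_def)

lemma reduce_inverse: "reduce (map inv_letter (rev w) @ w) = []"
proof (induction w)
  case (Cons x w)
  then show ?case
    using reduced_reduce[of w]
    by (simp add: reduce_def cons_reduce_inv)
qed (simp add: reduce_def)

lemma group_free_group: "group (free_group n)"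
proof (rule groupI)
  fix x y assume "x \<in> carrier (free_group n)" "y \<in> carrier (free_group n)"
  then show "x \<otimes>\<^bsub>free_group n\<^esub> y \<in> carrier (free_group n)"
    using fst_set_reduce[of "x @ y"] by (force simp: free_group_def reduced_reduce)
next
  fix x y z assume "z \<in> carrier (free_group n)"
  then show "x \<otimes>\<^bsub>free_group n\<^esub> y \<otimes>\<^bsub>free_group n\<^esub> z = x \<otimes>\<^bsub>free_group n\<^esub> (y \<otimes>\<^bsub>free_group n\<^esub> z)"
    using reduced_reduce[of "y @ z"]
    by (simp add: free_group_def reduce_append reduce_reduced foldr_reduce)
       (metis foldr_append foldr_reduce reduce_append reduce_reduced reduced_foldr)
next
  fix x assume x: "x \<in> carrier (free_group n)"
  have "reduce (map inv_letter (rev x)) \<in> carrier (free_group n)"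
    using x fst_set_reduce[of "map inv_letter (rev x)"]
    by (force simp: free_group_def reduced_reduce)
  moreover have "reduce (reduce (map inv_letter (rev x)) @ x) = []"
    by (metis foldr_reduce reduce_append reduce_inverse reduced_reduce)
  ultimately show "\<exists>y\<in>carrier (free_group n). y \<otimes>\<^bsub>free_group n\<^esub> x = \<one>\<^bsub>free_group n\<^esub>"
    by (auto simp: free_group_def)
qed (auto simp: free_group_def reduce_reduced)


section \<open>Decidability\<close>

text \<open>
  \<open>recursive k f\<close>: the \<open>k\<close>-ary function computed by \<open>f\<close> on lists of length \<open>k\<close> is a total recursive
  function in the sense of Kleene (minimisation is applied to regular functions only). The values
  of \<open>f\<close> on lists of any other length are irrelevant.
\<close>

inductive recursive :: "nat \<Rightarrow> (nat list \<Rightarrow> nat) \<Rightarrow> bool" where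
  zero: "recursive k (\<lambda>xs. 0)"
| succ: "recursive 1 (\<lambda>xs. Suc (hd xs))"
| proj: "i < k \<Longrightarrow> recursive k (\<lambda>xs. xs ! i)"
| comp: "recursive (length gs) f \<Longrightarrow> (\<forall>g\<in>set gs. recursive k g) \<Longrightarrow>
    recursive k (\<lambda>xs. f (map (\<lambda>g. g xs) gs))"
| prim_rec: "recursive k f \<Longrightarrow> recursive (Suc (Suc k)) g \<Longrightarrow>
    recursive (Suc k) (\<lambda>xs. rec_nat (f (tl xs)) (\<lambda>m r. g (m # r # tl xs)) (hd xs))"
| minim: "recursive (Suc k) f \<Longrightarrow> (\<forall>xs. length xs = k \<longrightarrow> (\<exists>m. f (m # xs) = 0)) \<Longrightarrow>
    recursive k (\<lambda>xs. LEAST m. f (m # xs) = 0)"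

text \<open>
  \<open>decidable code D P\<close>: there is an algorithm which, given an instance from \<open>D\<close> (as its code
  number), decides whether the instance has property \<open>P\<close>.
\<close>

definition decidable :: "('a \<Rightarrow> nat) \<Rightarrow> 'a set \<Rightarrow> ('a \<Rightarrow> bool) \<Rightarrow> bool" where
  "decidable code D P \<longleftrightarrow>
     (\<exists>f. recursive 1 f \<and> (\<forall>x\<in>D. f [code x] = (if P x then 1 else 0)))"

definition letter_code :: "letter \<Rightarrow> nat" where
  "letter_code x = prod_encode (fst x, of_bool (snd x))"

definition word_code :: "word \<Rightarrow> nat" where
  "word_code w = list_encode (map letter_code w)"

definition instance_code :: "nat \<times> word list \<Rightarrow> nat" where
  "instance_code = (\<lambda>(n, ws). prod_encode (n, list_encode (map word_code ws)))"

lemma inj_letter_code: "inj letter_code"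
  by (rule injI) (auto simp: letter_code_def prod_eq_iff of_bool_def split: if_splits)

lemma inj_word_code: "inj word_code"
  by (rule injI) (simp add: word_code_def list_encode_eq inj_map_eq_map[OF inj_letter_code])

lemma inj_instance_code: "inj instance_code"
  by (rule injI) (auto simp: instance_code_def list_encode_eq inj_map_eq_map[OF inj_word_code])

end

theory Submission
  imports
    "HOL-Algebra.Zassenhaus"
    "HOL-Number_Theory.Residue_Primitive_Roots"
    "HOL-Computational_Algebra.Computational_Algebra"
    "HOL-Library.Poly_Mapping"
    Defs
begin

text \<open>
  Write \<open>F\<close> for the free group on \<open>x\<^sub>0, \<dots>, x\<^sub>n\<^sub>-\<^sub>1\<close>, and \<open>H\<close> for the subgroup generated by the given words. A
  homomorphism from \<open>F\<close> to the affine group of the field \<open>\<F>\<^sub>p\<close> is an action of \<open>F\<close> on the affine line, where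
  \<open>x\<^sub>i\<close> acts by \<open>t \<mapsto> a\<^sub>i t + d\<^sub>i\<close> with a unit \<open>a\<^sub>i\<close>. As the affine group of \<open>\<F>\<^sub>p\<close> lies in \<open>U\<close>, the subgroup
  \<open>H\<close> is not dense if, for some such action, \<open>H\<close> fixes zero and \<open>F\<close> does not. The converse holds as well
  (\<open>dense_iff_not_obstructed\<close>). All groups in \<open>U\<close> are metabelian and satisfy, for every prime \<open>p\<close>, a law which
  makes the group act through an abelian group of exponent \<open>p - 1\<close> on every \<open>\<F>\<^sub>p\<close>-quotient of its derived subgroup
  (\<open>affine_laws\<close>). Such an action can be diagonalised over \<open>\<F>\<^sub>p\<close>. If the image of \<open>H\<close> in such a finite group is
  proper, an eigenvector in the dual of a suitable quotient of the derived subgroup is the translation part of the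
  desired action (\<open>ex_affine_action\<close>).

  For a single prime the existence of an action is a finite question. The problem is to bound the primes.
  The image of zero under a word \<open>w\<close> is \<open>\<Sum>\<^sub>i d\<^sub>i \<partial>w/\<partial>x\<^sub>i\<close>, where the Fox derivatives \<open>\<partial>w/\<partial>x\<^sub>i\<close> are
  Laurent polynomials in the slopes \<open>a\<close> with integer coefficients. Hence an action as above exists for \<open>p\<close> if and
  only if the rows of Fox derivatives of the given words, evaluated at some point with nonzero coordinates in
  \<open>\<F>\<^sub>p\<close>, span less than \<open>\<F>\<^sub>p\<^sup>n\<close>. Suppose that over the ring of Laurent polynomials with integer coefficients
  some combination of these rows is \<open>k\<^sub>i\<close> times the \<open>i\<close>-th unit vector, where \<open>0 < k\<^sub>i \<le> N\<close>, for each \<open>i < n\<close>.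
  Then the rows span \<open>\<F>\<^sub>p\<^sup>n\<close> at every point if \<open>p > N\<close> (\<open>certificate_sound\<close>), and only the primes up to \<open>N\<close>
  remain to be checked.

  Such a certificate exists unless some prime admits an action (\<open>ex_certificate\<close>). Without one, the rows
  generate a proper submodule over the Laurent polynomials with rational coefficients. It is contained in a maximal
  submodule, whose quotient is a field, and in this field there are slopes and translation parts, not
  all zero, for which the given words fix zero. The ring generated by these finitely many elements has a homomorphism
  to a number field (\<open>ex_algebraic_point\<close>). By Euclid's argument infinitely many primes have a factor
  of degree one in the number field; reduction modulo one that divides no denominator gives an action over a
  prime field (\<open>ex_reduction\<close>). It matters that this field is \<open>\<F>\<^sub>p\<close>, and not an extension, because only then
  the slopes have order dividing \<open>p - 1\<close>.

  The decision procedure therefore searches through all pairs of a number and a list of combinations for either a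
  prime with an action or a certificate. The search terminates, and it yields a number beyond which
  no prime admits an action if none up to it does. Since recursive functions are given by Kleene's schemata with a
  search operator for total predicates, the procedure is assembled from functions computable on coded data.
\<close>

section \<open>Recursive functions on natural numbers\<close>

text \<open>
  Kleene's schemata also fix the values of a function on lists of a wrong length. These values are of no
  interest, and ignoring them allows functions to be written with list indices.
\<close>

definition rec_ext :: "nat \<Rightarrow> (nat list \<Rightarrow> nat) \<Rightarrow> bool" where
  "rec_ext k f \<longleftrightarrow> (\<exists>g. recursive k g \<and> (\<forall>xs. length xs = k \<longrightarrow> g xs = f xs))"

lemma rec_ext_cong:
  assumes "rec_ext k f" "\<And>xs. length xs = k \<Longrightarrow> f xs = g xs"
  shows "rec_ext k g"
  using assms by (auto simp: rec_ext_def)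

lemma rec_ext_zero: "rec_ext k (\<lambda>xs. 0)"
  unfolding rec_ext_def using recursive.zero by blast

lemma rec_ext_nth: "i < k \<Longrightarrow> rec_ext k (\<lambda>xs. xs ! i)"
  unfolding rec_ext_def using recursive.proj by blast

lemma rec_ext_comp1:
  assumes "rec_ext 1 f" "rec_ext k g"
  shows "rec_ext k (\<lambda>xs. f [g xs])"
proof -
  obtain f' g' where *: "recursive 1 f'" "recursive k g'"
    "\<And>xs. length xs = 1 \<Longrightarrow> f' xs = f xs" "\<And>xs. length xs = k \<Longrightarrow> g' xs = g xs"
    using assms unfolding rec_ext_def by blast
  have "recursive k (\<lambda>xs. f' (map (\<lambda>g. g xs) [g']))"
    by (rule recursive.comp) (use * in auto)
  then show ?thesis unfolding rec_ext_def using * by force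
qed

lemma rec_ext_comp2:
  assumes "rec_ext 2 f" "rec_ext k g" "rec_ext k h"
  shows "rec_ext k (\<lambda>xs. f [g xs, h xs])"
proof -
  obtain f' g' h' where *: "recursive 2 f'" "recursive k g'" "recursive k h'"
    "\<And>xs. length xs = 2 \<Longrightarrow> f' xs = f xs" "\<And>xs. length xs = k \<Longrightarrow> g' xs = g xs"
    "\<And>xs. length xs = k \<Longrightarrow> h' xs = h xs"
    using assms unfolding rec_ext_def by blast
  have "recursive k (\<lambda>xs. f' (map (\<lambda>g. g xs) [g', h']))"
    by (rule recursive.comp) (use * in \<open>auto simp: numeral_2_eq_2\<close>)
  then show ?thesis unfolding rec_ext_def using * by force
qed

lemma rec_ext_Suc:
  assumes "rec_ext k f" shows "rec_ext k (\<lambda>xs. Suc (f xs))"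
proof -
  have "rec_ext 1 (\<lambda>xs. Suc (hd xs))" unfolding rec_ext_def using recursive.succ by blast
  from rec_ext_comp1[OF this assms] show ?thesis by simp
qed

lemma rec_ext_const: "rec_ext k (\<lambda>xs. c)"
  by (induction c) (auto intro: rec_ext_zero rec_ext_Suc)

lemma rec_ext_prim_rec:
  assumes "rec_ext k f" "rec_ext (Suc (Suc k)) g"
  shows "rec_ext (Suc k) (\<lambda>xs. rec_nat (f (tl xs)) (\<lambda>m r. g (m # r # tl xs)) (hd xs))"
proof -
  obtain f' g' where *: "recursive k f'" "recursive (Suc (Suc k)) g'"
    "\<And>xs. length xs = k \<Longrightarrow> f' xs = f xs" "\<And>xs. length xs = Suc (Suc k) \<Longrightarrow> g' xs = g xs"
    using assms unfolding rec_ext_def by blast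
  have "rec_nat (f' (tl xs)) (\<lambda>m r. g' (m # r # tl xs)) n =
        rec_nat (f (tl xs)) (\<lambda>m r. g (m # r # tl xs)) n" if "length xs = Suc k" for xs n
    using that * by (induction n) auto
  then show ?thesis unfolding rec_ext_def
    using recursive.prim_rec[OF *(1,2)] by (intro exI conjI) auto
qed

lemma rec_ext_Least:
  assumes "rec_ext (Suc k) f" "\<And>xs. length xs = k \<Longrightarrow> \<exists>m. f (m # xs) = 0"
  shows "rec_ext k (\<lambda>xs. LEAST m. f (m # xs) = 0)"
proof -
  obtain f' where *: "recursive (Suc k) f'" "\<And>xs. length xs = Suc k \<Longrightarrow> f' xs = f xs"
    using assms unfolding rec_ext_def by blast
  have "recursive k (\<lambda>xs. LEAST m. f' (m # xs) = 0)"
    by (rule recursive.minim) (use * assms(2) in auto)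
  then show ?thesis unfolding rec_ext_def using * by (intro exI conjI) auto
qed

text \<open>With one parameter next to the recursion argument, the scheme covers all of the arithmetic below.\<close>

lemma rec_ext_prim_rec1:
  assumes "rec_ext 1 f" "rec_ext 3 g"
  shows "rec_ext 2 (\<lambda>xs. rec_nat (f [xs ! 1]) (\<lambda>m r. g [m, r, xs ! 1]) (xs ! 0))"
proof -
  have 2: "rec_ext (Suc 1) (\<lambda>xs. rec_nat (f (tl xs)) (\<lambda>m r. g (m # r # tl xs)) (hd xs))"
    by (rule rec_ext_prim_rec) (use assms in \<open>auto simp: numeral_3_eq_3\<close>)
  show ?thesis
    by (rule rec_ext_cong[OF 2[unfolded Suc_1 One_nat_def, folded numeral_2_eq_2]])
       (auto simp: length_Suc_conv numeral_2_eq_2)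
qed

lemma rec_ext_add:
  assumes "rec_ext k f" "rec_ext k g" shows "rec_ext k (\<lambda>xs. f xs + g xs)"
proof -
  have *: "rec_nat b (\<lambda>m r. Suc r) a = a + b" for a b :: nat by (induction a) auto
  have "rec_ext 2 (\<lambda>xs. rec_nat ((\<lambda>xs. xs ! 0) [xs ! 1]) (\<lambda>m r. (\<lambda>xs. Suc (xs ! 1)) [m, r, xs ! 1]) (xs ! 0))"
    by (intro rec_ext_prim_rec1 rec_ext_Suc rec_ext_nth) auto
  from rec_ext_comp2[OF this assms] show ?thesis by (simp add: *)
qed

lemma rec_ext_pred:
  assumes "rec_ext k f" shows "rec_ext k (\<lambda>xs. f xs - 1)"
proof -
  have *: "rec_nat 0 (\<lambda>m r. m) a = a - 1" for a :: nat by (cases a) auto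
  have "rec_ext 2 (\<lambda>xs. rec_nat ((\<lambda>xs. 0) [xs ! 1]) (\<lambda>m r. (\<lambda>xs. xs ! 0) [m, r, xs ! 1]) (xs ! 0))"
    by (intro rec_ext_prim_rec1 rec_ext_zero rec_ext_nth) auto
  from rec_ext_comp2[OF this assms assms] show ?thesis by (simp add: *)
qed

lemma rec_ext_diff:
  assumes "rec_ext k f" "rec_ext k g" shows "rec_ext k (\<lambda>xs. f xs - g xs)"
proof -
  have *: "rec_nat b (\<lambda>m r. r - 1) a = b - a" for a b :: nat by (induction a) auto
  have "rec_ext 2 (\<lambda>xs. rec_nat ((\<lambda>xs. xs ! 0) [xs ! 1]) (\<lambda>m r. (\<lambda>xs. (xs ! 1) - 1) [m, r, xs ! 1]) (xs ! 0))"
    by (intro rec_ext_prim_rec1 rec_ext_pred rec_ext_nth) auto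
  from rec_ext_comp2[OF this assms(2,1)] show ?thesis by (simp add: *[simplified])
qed

lemma rec_ext_triangle:
  assumes "rec_ext k f" shows "rec_ext k (\<lambda>xs. triangle (f xs))"
proof -
  have *: "rec_nat 0 (\<lambda>m r. r + Suc m) a = triangle a" for a :: nat by (induction a) auto
  have "rec_ext 2 (\<lambda>xs. rec_nat ((\<lambda>xs. 0) [xs ! 1]) (\<lambda>m r. (\<lambda>xs. (xs ! 1) + Suc (xs ! 0)) [m, r, xs ! 1]) (xs ! 0))"
    by (intro rec_ext_prim_rec1 rec_ext_zero rec_ext_nth rec_ext_add rec_ext_Suc) auto
  from rec_ext_comp2[OF this assms assms] show ?thesis by (simp add: *[simplified])
qed

lemma rec_ext_prod_encode:
  assumes "rec_ext k f" "rec_ext k g" shows "rec_ext k (\<lambda>xs. prod_encode (f xs, g xs))"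
  unfolding prod_encode_def by (simp, intro rec_ext_add rec_ext_triangle assms)

text \<open>
  The pair with code \<open>z\<close> lies on the diagonal whose index is the least \<open>w\<close> with
  \<open>z < triangle (Suc w)\<close>, and \<open>triangle w\<close> is the first code on that diagonal.
\<close>

lemma Least_triangle: "(LEAST w. Suc (prod_encode (a, b)) - triangle (Suc w) = 0) = a + b"
proof (rule Least_equality)
  fix w assume "Suc (prod_encode (a, b)) - triangle (Suc w) = 0"
  then have *: "triangle (a + b) + a < triangle (Suc w)" by (simp add: prod_encode_def)
  have "mono triangle" by (rule mono_iff_le_Suc[THEN iffD2]) simp
  then have "triangle (Suc w) \<le> triangle (a + b)" if "Suc w \<le> a + b"
    using that by (rule monoD)
  then show "a + b \<le> w" using * by (cases "Suc w \<le> a + b") auto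
qed (simp add: prod_encode_def)

lemma rec_ext_fst_snd:
  shows rec_ext_fst: "rec_ext k f \<Longrightarrow> rec_ext k (\<lambda>xs. fst (prod_decode (f xs)))"
    and rec_ext_snd: "rec_ext k f \<Longrightarrow> rec_ext k (\<lambda>xs. snd (prod_decode (f xs)))"
proof -
  have ex: "\<exists>w. Suc z - triangle (Suc w) = 0" for z
  proof
    show "Suc z - triangle (Suc z) = 0" by simp
  qed
  define diag where "diag z = (LEAST w. Suc z - triangle (Suc w) = 0)" for z
  have diag: "diag (prod_encode (a, b)) = a + b" for a b
    unfolding diag_def by (rule Least_triangle)
  have 1: "fst (prod_decode z) = z - triangle (diag z)"
    and 2: "snd (prod_decode z) = diag z - (z - triangle (diag z))" for z
  proof -
    obtain a b where z: "z = prod_encode (a, b)" by (metis prod_decode_inverse surj_pair)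
    show "fst (prod_decode z) = z - triangle (diag z)" "snd (prod_decode z) = diag z - (z - triangle (diag z))"
      unfolding z diag prod_encode_inverse by (simp_all add: prod_encode_def)
  qed
  have "rec_ext 1 (\<lambda>xs. LEAST w. (\<lambda>xs. Suc (xs ! 1) - triangle (Suc (xs ! 0))) (w # xs) = 0)"
    by (rule rec_ext_Least, intro rec_ext_diff rec_ext_Suc rec_ext_triangle rec_ext_nth) (use ex in auto)
  then have *: "rec_ext 1 (\<lambda>xs. diag (xs ! 0))" by (simp add: diag_def)
  show "rec_ext k (\<lambda>xs. fst (prod_decode (f xs)))" "rec_ext k (\<lambda>xs. snd (prod_decode (f xs)))" if "rec_ext k f"
    using rec_ext_comp1[OF * that] that unfolding 1 2
    by (auto intro!: rec_ext_diff rec_ext_triangle)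
qed

section \<open>Computable functions between coded types\<close>

text \<open>
  Every number is required to be a code. Search through a type is then search through all
  numbers, and a predicate on a type gives a total predicate on numbers.
\<close>

class coded =
  fixes code :: "'a \<Rightarrow> nat"
  assumes bij_code: "bij code"

lemma code_eq_iff [simp]: "code x = code y \<longleftrightarrow> x = y" for x y :: "'a::coded"
  using bij_code by (auto simp: bij_def inj_def)

lemma code_surj: obtains x :: "'a::coded" where "code x = n"
  using bij_code by (metis bij_pointE)

instantiation nat :: coded begin
definition code_nat :: "nat \<Rightarrow> nat" where [simp]: "code_nat n = n"
instance by standard (auto simp: bij_def inj_def surj_def)
end

instantiation prod :: (coded, coded) coded begin
definition code_prod :: "'a \<times> 'b \<Rightarrow> nat" where "code_prod z = prod_encode (code (fst z), code (snd z))"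
instance
proof
  show "bij (code :: 'a \<times> 'b \<Rightarrow> nat)"
  proof (rule bijI)
    show "surj (code :: 'a \<times> 'b \<Rightarrow> nat)" unfolding surj_def
    proof
      fix n
      obtain x :: 'a and y :: 'b where "code x = fst (prod_decode n)" "code y = snd (prod_decode n)"
        by (metis code_surj)
      then show "\<exists>z::'a \<times> 'b. n = code z"
        by (intro exI[of _ "(x, y)"]) (simp add: code_prod_def)
    qed
  qed (auto intro!: injI simp: code_prod_def prod_eq_iff)
qed
end

instantiation list :: (coded) coded begin
definition code_list :: "'a list \<Rightarrow> nat" where "code_list xs = list_encode (map code xs)"
instance
proof
  have "inj (map (code :: 'a \<Rightarrow> nat))" using bij_code[where 'a='a] by (simp add: bij_is_inj)
  moreover have "surj (map (code :: 'a \<Rightarrow> nat))" using lists_image[of "code :: 'a \<Rightarrow> nat" UNIV] bij_is_surj[OF bij_code[where 'a='a]] by simp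
  ultimately have "bij (list_encode \<circ> map (code :: 'a \<Rightarrow> nat))"
    by (intro bij_comp bij_list_encode bijI)
  then show "bij (code :: 'a list \<Rightarrow> nat)" by (simp add: comp_def code_list_def[abs_def])
qed
end

lemma code_Pair [simp]: "code (x, y) = prod_encode (code x, code y)"
  by (simp add: code_prod_def)

lemma code_Nil [simp]: "code [] = 0"
  and code_Cons [simp]: "code (x # xs) = Suc (prod_encode (code x, code xs))"
  by (simp_all add: code_list_def)

definition computable :: "('a::coded \<Rightarrow> 'b::coded) \<Rightarrow> bool" where
  "computable f \<longleftrightarrow> (\<exists>g. rec_ext 1 g \<and> (\<forall>x. g [code x] = code (f x)))"

lemma computableI: "rec_ext 1 g \<Longrightarrow> (\<And>x. g [code x] = code (f x)) \<Longrightarrow> computable f"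
  unfolding computable_def by blast

lemma computable_comp:
  assumes "computable f" "computable g" shows "computable (\<lambda>x. f (g x))"
proof -
  obtain f' g' where *: "rec_ext 1 f'" "rec_ext 1 g'" "\<And>x. f' [code x] = code (f x)"
    "\<And>x. g' [code x] = code (g x)" using assms unfolding computable_def by blast
  show ?thesis by (rule computableI[OF rec_ext_comp1[OF *(1,2)]]) (simp add: *)
qed

lemma computable_id: "computable (\<lambda>x. x)"
  by (rule computableI[OF rec_ext_nth[of 0]]) auto

lemma computable_const: "computable (\<lambda>x. c)"
  by (rule computableI[OF rec_ext_const[of 1 "code c"]]) auto

lemma computable_Pair:
  assumes "computable f" "computable g" shows "computable (\<lambda>x. (f x, g x))"
proof -
  obtain f' g' where *: "rec_ext 1 f'" "rec_ext 1 g'" "\<And>x. f' [code x] = code (f x)"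
    "\<And>x. g' [code x] = code (g x)" using assms unfolding computable_def by blast
  show ?thesis by (rule computableI[OF rec_ext_prod_encode[OF *(1,2)]]) (simp add: *)
qed

lemma computable_fst0: "computable (fst :: 'a::coded \<times> 'b::coded \<Rightarrow> 'a)"
  by (rule computableI[OF rec_ext_fst[OF rec_ext_nth[of 0]]]) (auto simp: code_prod_def)

lemma computable_snd0: "computable (snd :: 'a::coded \<times> 'b::coded \<Rightarrow> 'b)"
  by (rule computableI[OF rec_ext_snd[OF rec_ext_nth[of 0]]]) (auto simp: code_prod_def)

lemma computable_comp2:
  assumes "computable (\<lambda>(x, y). f x y)" "computable g" "computable h"
  shows "computable (\<lambda>x. f (g x) (h x))"
  using computable_comp[OF assms(1) computable_Pair[OF assms(2,3)]] by simp

lemma computable_comp3: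
  assumes "computable (\<lambda>(x, y, z). f x y z)" "computable g" "computable h" "computable k"
  shows "computable (\<lambda>x. f (g x) (h x) (k x))"
  using computable_comp[OF assms(1) computable_Pair[OF assms(2) computable_Pair[OF assms(3,4)]]] by simp

lemmas computable_fst = computable_comp[OF computable_fst0]
lemmas computable_snd = computable_comp[OF computable_snd0]

lemma computable_Suc:
  assumes "computable f" shows "computable (\<lambda>x. Suc (f x))"
proof -
  have "computable Suc" by (rule computableI[OF rec_ext_Suc[OF rec_ext_nth[of 0]]]) auto
  from computable_comp[OF this assms] show ?thesis .
qed

text \<open>
  Values of the parameter and of the intermediate results may have any coded types, since the recursion can run on
  their codes.
\<close>

lemma computable_rec_nat:
  assumes "computable f" "computable (\<lambda>(m, r, x). g m r x)" "computable n"
  shows "computable (\<lambda>x. rec_nat (f x) (\<lambda>m r. g m r x) (n x))"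
proof -
  obtain f' g' n' where *: "rec_ext 1 f'" "rec_ext 1 g'" "rec_ext 1 n'" "\<And>x. f' [code x] = code (f x)"
    "\<And>m r x. g' [prod_encode (m, prod_encode (code r, code x))] = code (g m r x)"
    "\<And>x. n' [code x] = n x"
    using assms unfolding computable_def by force
  have **: "rec_nat (code (f x)) (\<lambda>m r. g' [prod_encode (m, prod_encode (r, code x))]) k =
     code (rec_nat (f x) (\<lambda>m r. g m r x) k)" for x k
    by (induction k) (auto simp: *)
  have "rec_ext 3 (\<lambda>xs. g' [prod_encode (xs ! 0, prod_encode (xs ! 1, xs ! 2))])"
    by (rule rec_ext_comp1[OF *(2)], intro rec_ext_prod_encode rec_ext_nth) auto
  from rec_ext_comp2[OF rec_ext_prim_rec1[OF *(1) this] *(3) rec_ext_nth[of 0 1]] show ?thesis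
    by (rule computableI) (simp_all add: * **)
qed

text \<open>
  Unbounded search. That the search terminates on every number, as the minimisation operator
  demands, is a condition on the elements of the type only because every number is a code.
\<close>

lemma computable_Least:
  assumes "computable (\<lambda>(m :: nat, x). q m x :: nat)" "\<And>x. \<exists>m. q m x = 0"
  shows "computable (\<lambda>x. LEAST m. q m x = 0)"
proof -
  obtain q' where *: "rec_ext 1 q'" "\<And>m x. q' [prod_encode (m, code x)] = q m x"
    using assms(1) unfolding computable_def by force
  have "rec_ext (Suc 1) (\<lambda>xs. q' [prod_encode (xs ! 0, xs ! 1)])"
    by (rule rec_ext_comp1[OF *(1)], intro rec_ext_prod_encode rec_ext_nth) auto
  moreover have "\<exists>m. q' [prod_encode ((m # xs) ! 0, (m # xs) ! 1)] = 0" if len: "length xs = 1" for xs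
  proof -
    obtain n where n: "xs = [n]" using len by (cases xs) auto
    obtain x :: 'a where "code x = n" by (rule code_surj)
    then show ?thesis using assms(2)[of x] n by (auto simp: * )
  qed
  ultimately have "rec_ext 1 (\<lambda>xs. LEAST m. q' [prod_encode ((m # xs) ! 0, (m # xs) ! 1)] = 0)"
    by (rule rec_ext_Least)
  then show ?thesis by (rule computableI) (simp add: *)
qed

lemma computable_add:
  fixes f g :: "'a::coded \<Rightarrow> nat"
  assumes "computable f" "computable g" shows "computable (\<lambda>x. f x + g x)"
proof -
  have *: "rec_nat (f x) (\<lambda>m r. Suc r) k = f x + k" for x k by (induction k) auto
  have "computable (\<lambda>x. rec_nat (f x) (\<lambda>m r. Suc r) (g x))"
    by (rule computable_rec_nat) (use assms in \<open>auto simp: case_prod_beta' intro!: computable_Suc computable_fst computable_snd computable_id\<close>)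
  then show ?thesis by (simp add: *)
qed

lemma computable_mult:
  fixes f g :: "'a::coded \<Rightarrow> nat"
  assumes "computable f" "computable g" shows "computable (\<lambda>x. f x * g x)"
proof -
  have *: "rec_nat 0 (\<lambda>m r. r + f x) k = f x * k" for x k by (induction k) auto
  have "computable (\<lambda>x. rec_nat 0 (\<lambda>m r. r + f x) (g x))"
    by (rule computable_rec_nat) (use assms in \<open>auto simp: case_prod_beta' intro!: computable_const computable_add computable_fst computable_snd computable_id computable_comp[of f]\<close>)
  then show ?thesis by (simp add: *)
qed

lemma computable_diff:
  fixes f g :: "'a::coded \<Rightarrow> nat"
  assumes "computable f" "computable g" shows "computable (\<lambda>x. f x - g x)"
proof -
  have *: "rec_nat 0 (\<lambda>m r. m) k = k - 1" for k :: nat by (cases k) auto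
  have 1: "computable (\<lambda>k. rec_nat 0 (\<lambda>m r. m) k)"
    by (rule computable_rec_nat) (auto simp: case_prod_beta' intro!: computable_const computable_fst computable_id)
  have **: "rec_nat (f x) (\<lambda>m r. rec_nat 0 (\<lambda>m r. m) r) k = f x - k" for x k
    by (induction k) (auto simp: *[simplified])
  have "computable (\<lambda>x. rec_nat (f x) (\<lambda>m r. rec_nat 0 (\<lambda>m r. m) r) (g x))"
    by (rule computable_rec_nat) (use assms in \<open>auto simp: case_prod_beta' intro!: computable_comp[OF 1] computable_fst computable_snd computable_id\<close>)
  then show ?thesis by (simp add: **)
qed

lemma computable_if_zero:
  fixes f :: "'a::coded \<Rightarrow> nat"
  assumes "computable f" "computable g" "computable h"
  shows "computable (\<lambda>x. if f x = 0 then g x else h x)"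
proof -
  have *: "rec_nat (g x) (\<lambda>m r. h x) k = (if k = 0 then g x else h x)" for x k by (cases k) auto
  have "computable (\<lambda>x. rec_nat (g x) (\<lambda>m r. h x) (f x))"
    by (rule computable_rec_nat) (use assms in \<open>auto simp: case_prod_beta' intro!: computable_comp[of h] computable_snd computable_id\<close>)
  then show ?thesis by (simp add: *)
qed

definition decides :: "('a::coded \<Rightarrow> bool) \<Rightarrow> bool" where
  "decides P \<longleftrightarrow> computable (\<lambda>x. of_bool (P x) :: nat)"

lemma decides_comp: "decides P \<Longrightarrow> computable f \<Longrightarrow> decides (\<lambda>x. P (f x))"
  unfolding decides_def by (rule computable_comp)

lemma computable_if:
  assumes "decides P" "computable g" "computable h"
  shows "computable (\<lambda>x. if P x then g x else h x)"
  using computable_if_zero[OF assms(1)[unfolded decides_def] assms(3,2)]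
  by (rule back_subst[of computable]) (auto simp: fun_eq_iff)

lemma decides_not: "decides P \<Longrightarrow> decides (\<lambda>x. \<not> P x)"
  unfolding decides_def of_bool_def
  by (rule back_subst[of computable, OF computable_if[of P "\<lambda>x. 0" "\<lambda>x. 1"]])
     (auto simp: fun_eq_iff decides_def of_bool_def computable_const)

lemma decides_conj: "decides P \<Longrightarrow> decides Q \<Longrightarrow> decides (\<lambda>x. P x \<and> Q x)"
  using computable_if[of P "\<lambda>x. of_bool (Q x) :: nat" "\<lambda>x. 0"] unfolding decides_def
  by (rule back_subst[of computable]) (auto simp: fun_eq_iff computable_const)

lemma decides_disj: "decides P \<Longrightarrow> decides Q \<Longrightarrow> decides (\<lambda>x. P x \<or> Q x)"
  using decides_not[OF decides_conj[OF decides_not[of P] decides_not[of Q]]] by simp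

lemma decides_imp: "decides P \<Longrightarrow> decides Q \<Longrightarrow> decides (\<lambda>x. P x \<longrightarrow> Q x)"
  unfolding imp_conv_disj by (intro decides_disj decides_not)

lemma decides_const: "decides (\<lambda>x. c)"
  unfolding decides_def by (rule computable_const)

lemma decides_le:
  fixes f g :: "'a::coded \<Rightarrow> nat"
  assumes "computable f" "computable g" shows "decides (\<lambda>x. f x \<le> g x)"
  using computable_if_zero[OF computable_diff[OF assms] computable_const[of 1] computable_const[of 0]]
  unfolding decides_def by (rule back_subst[of computable]) (auto simp: fun_eq_iff)

lemma computable_code: "computable code"
  by (rule computableI[OF rec_ext_nth[of 0]]) auto

text \<open>
  Codes are injective, and equality of numbers is a conjunction of two comparisons.
\<close>

lemma decides_eq:
  assumes "computable f" "computable g" shows "decides (\<lambda>x. f x = g x)"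
proof -
  have "decides (\<lambda>x. code (f x) \<le> code (g x) \<and> code (g x) \<le> code (f x))"
    by (intro decides_conj decides_le computable_comp[OF computable_code] assms)
  then show ?thesis by (simp flip: order_eq_iff)
qed

lemma decides_less:
  fixes f g :: "'a::coded \<Rightarrow> nat"
  assumes "computable f" "computable g" shows "decides (\<lambda>x. f x < g x)"
  using decides_not[OF decides_le[OF assms(2,1)]] by (simp add: not_le)

lemma computable_Cons:
  assumes "computable f" "computable g" shows "computable (\<lambda>x. f x # g x)"
proof -
  obtain f' g' where *: "rec_ext 1 f'" "rec_ext 1 g'" "\<And>x. f' [code x] = code (f x)"
    "\<And>x. g' [code x] = code (g x)" using assms unfolding computable_def by blast
  show ?thesis by (rule computableI[OF rec_ext_Suc[OF rec_ext_prod_encode[OF *(1,2)]]]) (simp add: *)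
qed

lemma prod_decode_0: "prod_decode 0 = (0, 0)"
  using prod_encode_inverse[of "(0, 0)"] by (simp add: prod_encode_def)

lemma computable_tl0: "computable (tl :: 'a::coded list \<Rightarrow> 'a list)"
proof (rule computableI[OF rec_ext_snd[OF rec_ext_pred[OF rec_ext_nth[of 0]]]])
  show "snd (prod_decode ([code xs] ! 0 - 1)) = code (tl xs)" for xs :: "'a list"
    by (cases xs) (auto simp: prod_decode_0)
qed simp

text \<open>On the empty list \<^term>\<open>hd\<close> has an unknown value, but it is a constant.\<close>

lemma computable_hd0: "computable (hd :: 'a::coded list \<Rightarrow> 'a)"
proof -
  obtain d :: 'a where d: "code d = 0" by (rule code_surj)
  define h where "h xs = (if xs = [] then d else hd xs)" for xs
  have "computable h"
  proof (rule computableI[OF rec_ext_fst[OF rec_ext_pred[OF rec_ext_nth[of 0]]]])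
    show "fst (prod_decode ([code xs] ! 0 - 1)) = code (h xs)" for xs
      by (cases xs) (auto simp: h_def d prod_decode_0)
  qed simp
  then have "computable (\<lambda>xs. if xs = [] then hd [] else h xs)"
    by (intro computable_if decides_eq computable_id computable_const)
  moreover have "(\<lambda>xs. if xs = [] then hd [] else h xs) = hd"
    by (auto simp: h_def)
  ultimately show ?thesis by simp
qed

lemmas computable_tl = computable_comp[OF computable_tl0]
lemmas computable_hd = computable_comp[OF computable_hd0]

lemma length_le_code: "length xs \<le> code xs"
  by (induction xs) (auto intro: order_trans[OF _ le_prod_encode_2])

text \<open>
  There is no recursion on lists to start from. A loop over numbers consumes the list from the left, and the code
  of the list, which bounds its length, is a sufficient number of rounds.
\<close>

lemma computable_fold:
  assumes "computable (\<lambda>(y, s, x). g y s x)" "computable s" "computable l"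
  shows "computable (\<lambda>x. fold (\<lambda>y s. g y s x) (l x) (s x))"
proof -
  define step where "step = (\<lambda>(ys, s) x. if ys = [] then (ys, s) else (tl ys, g (hd ys) s x))"
  have run: "rec_nat (ys, s) (\<lambda>m r. step r x) k = (drop k ys, fold (\<lambda>y s. g y s x) (take k ys) s)"
    for ys s x k
  proof (induction k)
    case (Suc k)
    then show ?case
      by (cases "k < length ys")
         (auto simp: step_def tl_drop hd_drop_conv_nth take_Suc_conv_app_nth drop_Suc)
  qed simp
  have "computable (\<lambda>x. rec_nat (l x, s x) (\<lambda>m r. step r x) (code (l x)))"
    unfolding step_def
    by (rule computable_rec_nat)
       (auto simp: case_prod_beta' intro!: computable_Pair assms computable_if decides_eq
         computable_fst computable_snd computable_id computable_const computable_tl computable_hd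
         computable_comp[OF computable_code] computable_comp3[OF assms(1)])
  then have "computable (\<lambda>x. snd (rec_nat (l x, s x) (\<lambda>m r. step r x) (code (l x))))"
    by (rule computable_snd)
  then show ?thesis by (simp add: run take_all[OF length_le_code])
qed

lemma computable_rev: assumes "computable l" shows "computable (\<lambda>x. rev (l x))"
proof -
  have *: "fold (\<lambda>y s. y # s) ys zs = rev ys @ zs" for ys zs :: "'b list"
    by (induction ys arbitrary: zs) auto
  have "computable (\<lambda>x. fold (\<lambda>y s. y # s) (l x) [])"
    by (rule computable_fold)
       (auto simp: case_prod_beta' intro!: computable_Cons computable_fst computable_snd computable_id computable_const assms)
  then show ?thesis by (simp add: *)
qed

lemma computable_foldr:
  assumes "computable (\<lambda>(y, s, x). g y s x)" "computable s" "computable l"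
  shows "computable (\<lambda>x. foldr (\<lambda>y s. g y s x) (l x) (s x))"
  unfolding foldr_conv_fold by (intro computable_fold computable_rev assms)

lemmas computable_basic = computable_id computable_const computable_Pair computable_fst computable_snd
  computable_if computable_Suc computable_add computable_mult computable_diff
  computable_Cons computable_tl computable_hd
  decides_eq decides_le decides_less decides_not decides_conj decides_disj decides_imp decides_const

lemma decides_comp2:
  assumes "decides (\<lambda>(x, y). P x y)" "computable g" "computable h"
  shows "decides (\<lambda>x. P (g x) (h x))"
  using decides_comp[OF assms(1) computable_Pair[OF assms(2,3)]] by simp

lemma computable_append:
  assumes "computable f" "computable g" shows "computable (\<lambda>x. f x @ g x)"
proof -
  have "computable (\<lambda>x. foldr (\<lambda>y s. y # s) (f x) (g x))"
    by (rule computable_foldr) (auto simp: case_prod_beta' intro!: computable_basic assms)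
  moreover have "foldr (\<lambda>y s. y # s) ys zs = ys @ zs" for ys zs :: "'b list"
    by (induction ys) auto
  ultimately show ?thesis by simp
qed

lemma computable_map:
  assumes "computable (\<lambda>(y, x). g y x)" "computable l"
  shows "computable (\<lambda>x. map (\<lambda>y. g y x) (l x))"
proof -
  have "computable (\<lambda>x. foldr (\<lambda>y s. g y x # s) (l x) [])"
    by (rule computable_foldr)
       (auto simp: case_prod_beta' intro!: computable_basic assms computable_comp2[OF assms(1)])
  moreover have "foldr (\<lambda>y s. g y x # s) ys [] = map (\<lambda>y. g y x) ys" for ys x
    by (induction ys) auto
  ultimately show ?thesis by simp
qed

lemma computable_filter:
  assumes "decides (\<lambda>(y, x). P y x)" "computable l"
  shows "computable (\<lambda>x. filter (\<lambda>y. P y x) (l x))"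
proof -
  have "computable (\<lambda>x. foldr (\<lambda>y s. if P y x then y # s else s) (l x) [])"
    by (rule computable_foldr)
       (auto simp: case_prod_beta' intro!: computable_basic assms decides_comp2[OF assms(1)])
  moreover have "foldr (\<lambda>y s. if P y x then y # s else s) ys [] = filter (\<lambda>y. P y x) ys" for ys x
    by (induction ys) auto
  ultimately show ?thesis by simp
qed

lemma computable_concat: assumes "computable l" shows "computable (\<lambda>x. concat (l x))"
proof -
  have "computable (\<lambda>x. foldr (\<lambda>y s. y @ s) (l x) [])"
    by (rule computable_foldr) (auto simp: case_prod_beta' intro!: computable_basic computable_append assms)
  moreover have "foldr (\<lambda>y s. y @ s) ys [] = concat ys" for ys :: "'b list list"
    by (induction ys) auto
  ultimately show ?thesis by simp
qed

lemma computable_length: assumes "computable l" shows "computable (\<lambda>x. length (l x))"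
proof -
  have "computable (\<lambda>x. foldr (\<lambda>y s. Suc s) (l x) 0)"
    by (rule computable_foldr) (auto simp: case_prod_beta' intro!: computable_basic assms)
  moreover have "foldr (\<lambda>y s. Suc s) ys 0 = length ys" for ys :: "'b list"
    by (induction ys) auto
  ultimately show ?thesis by simp
qed

lemma decides_Ball_list:
  assumes "decides (\<lambda>(y, x). P y x)" "computable l"
  shows "decides (\<lambda>x. \<forall>y\<in>set (l x). P y x)"
proof -
  have "decides (\<lambda>x. filter (\<lambda>y. \<not> P y x) (l x) = [])"
    by (intro computable_basic computable_filter)
       (use assms decides_not[OF assms(1)] in \<open>simp_all add: case_prod_beta'\<close>)
  then show ?thesis by (simp add: filter_empty_conv)
qed

lemma decides_Bex_list:
  assumes "decides (\<lambda>(y, x). P y x)" "computable l"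
  shows "decides (\<lambda>x. \<exists>y\<in>set (l x). P y x)"
  using decides_not[OF decides_Ball_list[of "\<lambda>y x. \<not> P y x" l]] assms decides_not[OF assms(1)]
  by (simp add: case_prod_beta')

lemma computable_upt: assumes "computable n" shows "computable (\<lambda>x. [0..<n x])"
proof -
  have "computable (\<lambda>x. rec_nat [] (\<lambda>m r. r @ [m]) (n x))"
    by (rule computable_rec_nat) (auto simp: case_prod_beta' intro!: computable_basic computable_append assms)
  moreover have "rec_nat [] (\<lambda>m r. r @ [m]) k = [0..<k]" for k by (induction k) auto
  ultimately show ?thesis by simp
qed

lemma decides_All_less:
  assumes "decides (\<lambda>(k, x). P k x)" "computable n"
  shows "decides (\<lambda>x. \<forall>k::nat<n x. P k x)"
  using decides_Ball_list[OF assms(1) computable_upt[OF assms(2)]] by (simp add: Ball_def)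

lemma decides_Ex_less:
  assumes "decides (\<lambda>(k, x). P k x)" "computable n"
  shows "decides (\<lambda>x. \<exists>k::nat<n x. P k x)"
  using decides_Bex_list[OF assms(1) computable_upt[OF assms(2)]] by (simp add: Bex_def)

lemma computable_mod:
  fixes f g :: "'a::coded \<Rightarrow> nat"
  assumes "computable f" "computable g" shows "computable (\<lambda>x. f x mod g x)"
proof -
  have "computable (\<lambda>x. rec_nat 0 (\<lambda>m r. if Suc r = g x then 0 else Suc r) (f x))"
    by (rule computable_rec_nat) (auto simp: case_prod_beta' intro!: computable_basic assms computable_comp[of g])
  moreover have "rec_nat 0 (\<lambda>m r. if Suc r = d then 0 else Suc r) k = k mod d" for k d :: nat
    by (induction k) (auto simp: mod_Suc)
  ultimately show ?thesis by simp
qed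

lemma computable_n_lists:
  assumes "computable n" "computable l" shows "computable (\<lambda>x. List.n_lists (n x) (l x))"
proof -
  have "computable (\<lambda>x. rec_nat [[]] (\<lambda>m r. concat (map (\<lambda>ys. map (\<lambda>y. y # ys) (l x)) r)) (n x))"
    by (rule computable_rec_nat)
       (auto simp: case_prod_beta' intro!: computable_basic computable_concat computable_map computable_comp[of l] assms)
  moreover have "rec_nat [[]] (\<lambda>m r. concat (map (\<lambda>ys. map (\<lambda>y. y # ys) xs) r)) k = List.n_lists k xs"
    for k and xs :: "'b list" by (induction k) auto
  ultimately show ?thesis by simp
qed

text \<open>
  Values outside the list must be known, as the value of \<open>xs ! i\<close> there cannot be computed.
\<close>

definition entry :: "nat list \<Rightarrow> nat \<Rightarrow> nat" where
  "entry xs i = (if i < length xs then xs ! i else 0)"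

lemma computable_entry:
  assumes "computable l" "computable i" shows "computable (\<lambda>x. entry (l x) (i x))"
proof -
  have "computable (\<lambda>x. if i x < length (l x) then hd (rec_nat (l x) (\<lambda>m r. tl r) (i x)) else 0)"
    by (auto simp: case_prod_beta' intro!: computable_basic computable_length computable_rec_nat assms)
  moreover have "rec_nat xs (\<lambda>m r. tl r) k = drop k xs" for k and xs :: "nat list"
    by (induction k) (auto simp: drop_Suc tl_drop)
  ultimately show ?thesis unfolding entry_def
    by (simp add: hd_drop_conv_nth cong: if_cong)
qed

section \<open>Affine actions of groups with affine laws\<close>

text \<open>
  Orthogonality of the powers of a primitive root, in the form needed to split off eigenvectors of an operator whose
  order divides \<open>p - 1\<close>.
\<close>

lemma primitive_root_sums:
  fixes p :: nat
  assumes p: "prime p"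
  obtains s :: int where "[s ^ (p - 1) = 1] (mod int p)"
    "\<And>j. 0 < j \<Longrightarrow> j < p - 1 \<Longrightarrow> [(\<Sum>i<p - 1. s ^ (i * j)) = 0] (mod int p)"
proof -
  obtain s where s: "residue_primroot p s"
    using prime_primitive_root_exists[of p] p prime_gt_1_nat[OF p] by auto
  have ord: "ord p s = p - 1" using s p by (auto simp: residue_primroot_def totient_prime)
  have s1: "[int s ^ (p - 1) = 1] (mod int p)"
    using ord ord_divides[of s "p - 1" p] by (metis cong_int_iff dvd_refl of_nat_1 of_nat_power)
  have "[(\<Sum>i<p - 1. int s ^ (i * j)) = 0] (mod int p)" if j: "0 < j" "j < p - 1" for j
  proof -
    have "(int s ^ j - 1) * (\<Sum>i<p - 1. (int s ^ j) ^ i) = (int s ^ j) ^ (p - 1) - 1"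
      by (rule power_diff_1_eq[symmetric])
    moreover have "[(int s ^ (p - 1)) ^ j = 1 ^ j] (mod int p)" by (intro cong_pow s1)
    ultimately have "int p dvd (int s ^ j - 1) * (\<Sum>i<p - 1. (int s ^ j) ^ i)"
      by (simp add: cong_iff_dvd_diff mult.commute flip: power_mult)
    moreover have "\<not> int p dvd int s ^ j - 1"
    proof
      assume "int p dvd int s ^ j - 1"
      then have "[s ^ j = 1] (mod p)"
        by (metis cong_iff_dvd_diff cong_int_iff of_nat_1 of_nat_power)
      then show False using ord_divides[of s j p] ord j by (auto dest: dvd_imp_le)
    qed
    ultimately have "int p dvd (\<Sum>i<p - 1. (int s ^ j) ^ i)" using p
      by (metis prime_dvd_mult_iff prime_nat_int_transfer)
    then show ?thesis by (simp add: cong_0_iff mult.commute flip: power_mult)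
  qed
  with s1 show ?thesis by (rule that)
qed

text \<open>
  In an extension of an elementary abelian \<open>p\<close>-group by an abelian group of exponent \<open>p - 1\<close>, commutators and
  \<open>(p - 1)\<close>-st powers lie in the normal subgroup, so all these elements commute. The second law is a
  version of this for groups which involve several primes: raising commutators to a power prime to \<open>p\<close> disposes of
  the other primes. One exponent has to serve all commutators, so that the law passes to homomorphic images.
\<close>

definition commutator :: "('a, 'b) monoid_scheme \<Rightarrow> 'a \<Rightarrow> 'a \<Rightarrow> 'a" where
  "commutator G u v = u \<otimes>\<^bsub>G\<^esub> v \<otimes>\<^bsub>G\<^esub> inv\<^bsub>G\<^esub> u \<otimes>\<^bsub>G\<^esub> inv\<^bsub>G\<^esub> v"

definition affine_laws :: "('a, 'b) monoid_scheme \<Rightarrow> bool" where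
  "affine_laws G \<longleftrightarrow>
     (\<forall>u\<in>carrier G. \<forall>v\<in>carrier G. \<forall>s\<in>carrier G. \<forall>t\<in>carrier G.
        commutator G u v \<otimes>\<^bsub>G\<^esub> commutator G s t = commutator G s t \<otimes>\<^bsub>G\<^esub> commutator G u v) \<and>
     (\<forall>p::nat. prime p \<longrightarrow> (\<exists>e::nat. \<not> p dvd e \<and>
        (\<forall>g\<in>carrier G. \<forall>u\<in>carrier G. \<forall>v\<in>carrier G.
           g [^]\<^bsub>G\<^esub> (p - 1) \<otimes>\<^bsub>G\<^esub> commutator G u v [^]\<^bsub>G\<^esub> e =
           commutator G u v [^]\<^bsub>G\<^esub> e \<otimes>\<^bsub>G\<^esub> g [^]\<^bsub>G\<^esub> (p - 1))))"

lemma (in group) commutator_closed [simp]: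
  "u \<in> carrier G \<Longrightarrow> v \<in> carrier G \<Longrightarrow> commutator G u v \<in> carrier G"
  by (simp add: commutator_def)

lemma (in group_hom) hom_commutator:
  "u \<in> carrier G \<Longrightarrow> v \<in> carrier G \<Longrightarrow> h (commutator G u v) = commutator H (h u) (h v)"
  by (simp add: commutator_def)

context group begin

lemma mult_inv_cancel: "x \<in> carrier G \<Longrightarrow> y \<in> carrier G \<Longrightarrow> x \<otimes> (inv x \<otimes> y) = y"
  and inv_mult_cancel: "x \<in> carrier G \<Longrightarrow> y \<in> carrier G \<Longrightarrow> inv x \<otimes> (x \<otimes> y) = y"
  by (simp_all flip: m_assoc)

text \<open>Rewriting with these equations brings every product of elements and inverses into reduced form.\<close>

lemmas group_normalize = m_assoc inv_mult_group mult_inv_cancel inv_mult_cancel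

text \<open>
  A nontrivial finite abelian group has a nonzero homomorphism onto a cyclic group of prime order:
  divide by a maximal proper subgroup. Here the abelian group is the quotient \<open>D / C\<close>, and the
  map \<open>\<kappa>\<close>, which separates the cosets of \<open>C\<close>, makes it finite. The homomorphism takes integer
  values, to be read modulo \<open>p\<close>.
\<close>

lemma ex_hom_mod_prime:
  assumes D: "subgroup D G" and C: "subgroup C G" "C \<subseteq> D" "C \<noteq> D"
    and comm: "\<And>u v. u \<in> D \<Longrightarrow> v \<in> D \<Longrightarrow> u \<otimes> v \<otimes> inv u \<otimes> inv v \<in> C"
    and fin: "finite (\<kappa> ` D)" and sep: "\<And>u v. u \<in> D \<Longrightarrow> v \<in> D \<Longrightarrow> \<kappa> u = \<kappa> v \<Longrightarrow> inv u \<otimes> v \<in> C"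
  obtains p :: nat and f :: "'a \<Rightarrow> int" where "prime p"
    "\<And>u v. u \<in> D \<Longrightarrow> v \<in> D \<Longrightarrow> [f (u \<otimes> v) = f u + f v] (mod int p)"
    "\<And>c. c \<in> C \<Longrightarrow> [f c = 0] (mod int p)"
    "\<exists>u\<in>D. \<not> int p dvd f u"
proof -
  \<comment> \<open>A maximal subgroup exists because the subgroups between \<open>C\<close> and \<open>D\<close> have images of bounded size under \<open>\<kappa>\<close>.\<close>
  define S where "S = {M. subgroup M G \<and> C \<subseteq> M \<and> M \<subseteq> D \<and> M \<noteq> D}"
  have "C \<in> S" using assms by (auto simp: S_def)
  moreover have bound: "card (\<kappa> ` M) < Suc (card (\<kappa> ` D))" if "M \<in> S" for M
    using that fin by (auto simp: S_def less_Suc_eq_le intro!: card_mono)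
  ultimately obtain M where MS: "M \<in> S" and max: "\<And>M'. M' \<in> S \<Longrightarrow> card (\<kappa> ` M') \<le> card (\<kappa> ` M)"
    using ex_has_greatest_nat[of "\<lambda>M. M \<in> S" C "\<lambda>M. card (\<kappa> ` M)" "Suc (card (\<kappa> ` D))"]
    by (metis less_imp_le_nat)
  have M: "subgroup M G" "C \<subseteq> M" "M \<subseteq> D" "M \<noteq> D" using MS by (auto simp: S_def)
  have Dc: "D \<subseteq> carrier G" using D subgroup.subset by blast
  note [simp] = subgroup.m_closed[OF D] subgroup.m_inv_closed[OF D] subgroup.m_closed[OF M(1)]
    subgroup.m_inv_closed[OF M(1)] subgroup.one_closed[OF M(1)] subgroup.one_closed[OF D]
  have [simp]: "u \<in> D \<Longrightarrow> u \<in> carrier G" "u \<in> M \<Longrightarrow> u \<in> D" for u using Dc M by auto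
  have pow_D [simp]: "u [^] (k::int) \<in> D" if "u \<in> D" for u k
    using that subgroup_int_pow_closed[OF D] by blast
  have pow_M: "u [^] (k::int) \<in> M" if "u \<in> M" for u k
    using that subgroup_int_pow_closed[OF M(1)] by blast
  have conj: "d \<otimes> m \<otimes> inv d \<in> M" if "d \<in> D" "m \<in> M" for d m
  proof -
    have "d \<otimes> m \<otimes> inv d \<otimes> inv m \<in> M" using comm[of d m] that \<open>C \<subseteq> M\<close> by auto
    then have "(d \<otimes> m \<otimes> inv d \<otimes> inv m) \<otimes> m \<in> M" using that(2) by (rule subgroup.m_closed[OF M(1)])
    then show ?thesis using that by (simp add: group_normalize)
  qed
  have span: "\<exists>m\<in>M. \<exists>k::int. u = m \<otimes> y [^] k" if "y \<in> D" "y \<notin> M" "u \<in> D" for y u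
  proof -
    define M' where "M' = {m \<otimes> y [^] k |m (k::int). m \<in> M}"
    have M'D: "M' \<subseteq> D" using that by (auto simp: M'_def)
    have "m \<otimes> y [^] (0::int) \<in> M'" if "m \<in> M" for m
      using that unfolding M'_def by blast
    then have MM': "M \<subseteq> M'" by fastforce
    have "\<one> \<otimes> y [^] (1::int) \<in> M'" unfolding M'_def by (auto intro!: exI[of _ \<one>] exI[of _ 1])
    then have y: "y \<in> M'" using that by simp
    have "subgroup M' G"
    proof (rule subgroupI)
      show "M' \<subseteq> carrier G" using M'D Dc by blast
      show "M' \<noteq> {}" using y by blast
    next
      fix a assume "a \<in> M'"
      then obtain m k where a: "a = m \<otimes> y [^] (k::int)" "m \<in> M" by (auto simp: M'_def)
      have "inv a = (y [^] (-k) \<otimes> inv m \<otimes> inv (y [^] (-k))) \<otimes> y [^] (-k)"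
        using a that by (simp add: group_normalize int_pow_neg)
      moreover have "y [^] (-k) \<otimes> inv m \<otimes> inv (y [^] (-k)) \<in> M" using a that by (intro conj) auto
      ultimately show "inv a \<in> M'" unfolding M'_def by blast
    next
      fix a b assume "a \<in> M'" "b \<in> M'"
      then obtain m k m' k' where a: "a = m \<otimes> y [^] (k::int)" "m \<in> M" "b = m' \<otimes> y [^] (k'::int)" "m' \<in> M"
        by (auto simp: M'_def)
      have "a \<otimes> b = (m \<otimes> (y [^] k \<otimes> m' \<otimes> inv (y [^] k))) \<otimes> y [^] (k + k')"
        using a that by (simp add: group_normalize int_pow_mult)
      moreover have "m \<otimes> (y [^] k \<otimes> m' \<otimes> inv (y [^] k)) \<in> M" using a that
        by (intro subgroup.m_closed[OF M(1)] conj) auto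
      ultimately show "a \<otimes> b \<in> M'" unfolding M'_def by blast
    qed
    have "M' = D"
    proof (rule ccontr)
      assume "M' \<noteq> D"
      then have "M' \<in> S" using \<open>subgroup M' G\<close> M'D MM' M by (auto simp: S_def)
      then have "card (\<kappa> ` M') \<le> card (\<kappa> ` M)" by (rule max)
      moreover have "finite (\<kappa> ` M')" using fin M'D by (meson finite_subset image_mono)
      ultimately have "\<kappa> ` M = \<kappa> ` M'" using MM' by (meson card_seteq image_mono)
      then obtain m where m: "m \<in> M" "\<kappa> m = \<kappa> y" using y by (metis imageE imageI)
      then have "inv m \<otimes> y \<in> M" using sep[of m y] that \<open>C \<subseteq> M\<close> by auto
      with m(1) have "m \<otimes> (inv m \<otimes> y) \<in> M" by (rule subgroup.m_closed[OF M(1)])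
      then show False using m that by (simp add: group_normalize)
    qed
    then show ?thesis using that(3) by (auto simp: M'_def)
  qed
  obtain x where x: "x \<in> D" "x \<notin> M" using M by blast
  define k0 where "k0 = (LEAST k::nat. k > 0 \<and> x [^] k \<in> M)"
  have "\<exists>k::nat. k > 0 \<and> x [^] k \<in> M"
  proof -
    have pow: "x [^] (k::nat) \<in> D" for k using pow_D[OF x(1), of "int k"] by (simp add: int_pow_int)
    then have "finite (range (\<lambda>k::nat. \<kappa> (x [^] k)))" by (intro finite_subset[OF _ fin]) auto
    then have "\<not> inj (\<lambda>k::nat. \<kappa> (x [^] k))" by (meson finite_imageD infinite_UNIV_nat)
    then obtain i j :: nat where ij: "i < j" "\<kappa> (x [^] i) = \<kappa> (x [^] j)"
      by (metis (mono_tags, lifting) inj_onI linorder_neqE_nat)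
    have "inv (x [^] i) \<otimes> x [^] j \<in> C" using ij pow by (intro sep)
    moreover have "inv (x [^] i) \<otimes> x [^] j = x [^] (j - i)"
      using ij x nat_pow_mult[of x i "j - i"] by (metis \<open>\<And>u. u \<in> D \<Longrightarrow> u \<in> carrier G\<close> inv_mult_cancel le_add_diff_inverse less_imp_le nat_pow_closed)
    ultimately show ?thesis using M ij by (intro exI[of _ "j - i"]) auto
  qed
  then have k0: "k0 > 0" "x [^] k0 \<in> M" unfolding k0_def by (metis (mono_tags, lifting) LeastI)+
  have k0_min: "k0 \<le> k" if "k > 0" "x [^] k \<in> M" for k unfolding k0_def using that by (simp add: Least_le)
  have k0_dvd: "int k0 dvd k" if "x [^] k \<in> M" for k :: int
  proof -
    have "x [^] (k mod int k0) = x [^] k \<otimes> inv ((x [^] int k0) [^] (k div int k0))"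
      using x by (simp add: int_pow_pow minus_mult_div_eq_mod flip: int_pow_diff)
    also have "\<dots> \<in> M" using that k0 pow_M by (simp add: int_pow_int)
    finally have "x [^] nat (k mod int k0) \<in> M" using k0 by (simp flip: int_pow_int)
    moreover have "nat (k mod int k0) < k0" using k0 by (simp add: nat_less_iff)
    ultimately have "nat (k mod int k0) = 0" using k0_min by (meson linorder_not_less neq0_conv)
    moreover have "k mod int k0 \<ge> 0" using k0 by simp
    ultimately show ?thesis by (simp add: dvd_eq_mod_eq_0)
  qed
  have "prime k0"
  proof (rule prime_natI)
    show "k0 \<ge> 2"
    proof (rule ccontr)
      assume "\<not> k0 \<ge> 2"
      then have "k0 = 1" using k0 by auto
      then show False using k0 x by simp
    qed
    fix r s assume rs: "k0 dvd r * s"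
    show "k0 dvd r \<or> k0 dvd s"
    proof (cases "x [^] r \<in> M")
      case True
      then show ?thesis using k0_dvd[of "int r"] by (simp add: int_pow_int)
    next
      case False
      then obtain m j where m: "m \<in> M" "x = m \<otimes> (x [^] r) [^] (j::int)"
        using span[of "x [^] r" x] pow_D[OF x(1), of "int r"] x by (auto simp: int_pow_int)
      then have xm: "x = m \<otimes> x [^] (int r * j)" using x by (metis \<open>\<And>u. u \<in> D \<Longrightarrow> u \<in> carrier G\<close> int_pow_int int_pow_pow)
      then have "x [^] (1 - int r * j) = m" using x m(1)
        by (metis (no_types) \<open>\<And>u. u \<in> D \<Longrightarrow> u \<in> carrier G\<close> \<open>\<And>u. u \<in> M \<Longrightarrow> u \<in> D\<close> int_pow_1 int_pow_closed int_pow_diff inv_solve_right)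
      then have "int k0 dvd 1 - int r * j" using m k0_dvd by simp
      then have "int k0 dvd int s * (1 - int r * j) + int (r * s) * j" using rs
        by (metis dvd_add dvd_mult dvd_mult2 of_nat_dvd_iff)
      also have "int s * (1 - int r * j) + int (r * s) * j = int s" by (simp add: algebra_simps)
      finally show ?thesis by simp
    qed
  qed
  define f where "f u = (SOME k::int. u \<otimes> inv (x [^] k) \<in> M)" for u
  have f: "u \<otimes> inv (x [^] f u) \<in> M" if u: "u \<in> D" for u
  proof -
    obtain m k where "m \<in> M" "u = m \<otimes> x [^] (k::int)" using span[OF x u] by blast
    then have "u \<otimes> inv (x [^] k) \<in> M" using x by (simp add: group_normalize)
    then show ?thesis unfolding f_def by (rule someI)
  qed
  have f_uniq: "[f u = k] (mod int k0)" if "u \<in> D" "u \<otimes> inv (x [^] k) \<in> M" for u k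
  proof -
    have "inv (u \<otimes> inv (x [^] f u)) \<otimes> (u \<otimes> inv (x [^] k)) \<in> M" using that f by simp
    then have "x [^] (f u - k) \<in> M" using that x by (simp add: group_normalize int_pow_diff)
    then show ?thesis using k0_dvd by (simp add: cong_iff_dvd_diff)
  qed
  show ?thesis
  proof (rule that[of k0 f])
    show "prime k0" by fact
  next
    fix u v assume uv: "u \<in> D" "v \<in> D"
    have "(u \<otimes> inv (x [^] f u)) \<otimes> (x [^] f u \<otimes> (v \<otimes> inv (x [^] f v)) \<otimes> inv (x [^] f u)) \<in> M"
      using uv x f conj by simp
    then have "(u \<otimes> v) \<otimes> inv (x [^] (f u + f v)) \<in> M" using uv x
      by (simp add: group_normalize int_pow_mult)
    then show "[f (u \<otimes> v) = f u + f v] (mod int k0)" using uv by (intro f_uniq) auto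
  next
    fix c assume "c \<in> C"
    then show "[f c = 0] (mod int k0)" using M by (intro f_uniq) auto
  next
    have "[f x = 1] (mod int k0)" using x by (intro f_uniq) auto
    then have "\<not> int k0 dvd f x" using \<open>prime k0\<close>
      by (metis cong_dvd_iff int_dvd_int_iff not_prime_unit of_nat_1)
    then show "\<exists>u\<in>D. \<not> int k0 dvd f u" using x by blast
  qed
qed

text \<open>
  Averaging over the powers of \<open>g\<close> with the powers of a primitive root \<open>r\<close> as weights projects a
  homomorphism onto an eigenspace of conjugation by \<open>g\<close>; since the \<open>(p - 1)\<close>-st power of \<open>g\<close> acts
  trivially, the projections add up to a nonzero multiple of the given homomorphism, so one of them
  is nonzero. As the group acts through a commutative group, the operators can be diagonalised one
  after another.
\<close>

lemma ex_common_eigenhom: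
  fixes f :: "'a \<Rightarrow> int" and p n :: nat
  assumes p: "prime p" and D: "subgroup D G" and CD: "C \<subseteq> D"
    and D_conj: "\<And>g y. g \<in> carrier G \<Longrightarrow> y \<in> D \<Longrightarrow> g \<otimes> y \<otimes> inv g \<in> D"
    and C_conj: "\<And>g y. g \<in> carrier G \<Longrightarrow> y \<in> C \<Longrightarrow> g \<otimes> y \<otimes> inv g \<in> C"
    and comm_D: "\<And>g h. g \<in> carrier G \<Longrightarrow> h \<in> carrier G \<Longrightarrow> g \<otimes> h \<otimes> inv g \<otimes> inv h \<in> D"
    and comm_C: "\<And>u v. u \<in> D \<Longrightarrow> v \<in> D \<Longrightarrow> u \<otimes> v \<otimes> inv u \<otimes> inv v \<in> C"
    and x: "\<And>i. i < n \<Longrightarrow> x i \<in> carrier G"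
    and pow: "\<And>g y f. g \<in> carrier G \<Longrightarrow> y \<in> D \<Longrightarrow>
      (\<And>u v. u \<in> D \<Longrightarrow> v \<in> D \<Longrightarrow> [f (u \<otimes> v) = f u + f v] (mod int p)) \<Longrightarrow>
      (\<And>c. c \<in> C \<Longrightarrow> [f c = 0] (mod int p)) \<Longrightarrow>
      [f (g [^] (p - 1) \<otimes> y \<otimes> inv (g [^] (p - 1))) = f y] (mod int p)"
    and f: "\<And>u v. u \<in> D \<Longrightarrow> v \<in> D \<Longrightarrow> [f (u \<otimes> v) = f u + f v] (mod int p)"
      "\<And>c. c \<in> C \<Longrightarrow> [f c = 0] (mod int p)" "\<exists>u\<in>D. \<not> int p dvd f u"
  shows "\<exists>f. (\<forall>u\<in>D. \<forall>v\<in>D. [f (u \<otimes> v) = f u + f v] (mod int p)) \<and>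
      (\<forall>c\<in>C. [f c = 0] (mod int p)) \<and> (\<exists>u\<in>D. \<not> int p dvd f u) \<and>
      (\<forall>i<n. \<exists>a. \<forall>y\<in>D. [f (x i \<otimes> y \<otimes> inv (x i)) = a * f y] (mod int p))"
  using x
proof (induction n)
  case 0
  show ?case using f by (intro exI[of _ f]) auto
next
  case (Suc n)
  note [simp] = subgroup.m_closed[OF D] subgroup.m_inv_closed[OF D] subgroup.one_closed[OF D]
  have [simp]: "u \<in> D \<Longrightarrow> u \<in> carrier G" for u using subgroup.subset[OF D] by auto
  define m where "m = int p"
  obtain f where f: "\<And>u v. u \<in> D \<Longrightarrow> v \<in> D \<Longrightarrow> [f (u \<otimes> v) = f u + f v] (mod m)"
    "\<And>c. c \<in> C \<Longrightarrow> [f c = 0] (mod m)" "\<exists>u\<in>D. \<not> m dvd f u"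
    and eig: "\<And>i. i < n \<Longrightarrow> \<exists>a. \<forall>y\<in>D. [f (x i \<otimes> y \<otimes> inv (x i)) = a * f y] (mod m)"
    using Suc.IH Suc.prems unfolding m_def by (metis less_SucI)
  define g where "g = x n"
  have g: "g \<in> carrier G" using Suc.prems by (simp add: g_def)
  define cj where "cj j y = g [^] (j::nat) \<otimes> y \<otimes> inv (g [^] j)" for j y
  have cjD: "cj j y \<in> D" if "y \<in> D" for j y unfolding cj_def using that g by (intro D_conj) auto
  have cjC: "cj j y \<in> C" if "y \<in> C" for j y unfolding cj_def using that g by (intro C_conj) auto
  have cj_mult: "cj j (u \<otimes> v) = cj j u \<otimes> cj j v" if "u \<in> D" "v \<in> D" for j u v
    unfolding cj_def using that g by (simp add: group_normalize)
  have cj_Suc: "cj j (g \<otimes> y \<otimes> inv g) = cj (Suc j) y" if "y \<in> D" for j y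
    unfolding cj_def using that g by (simp add: group_normalize)
  \<comment> \<open>Conjugation by \<open>D\<close> is invisible to \<open>f\<close>, so the conjugations by the generators commute as operators on
    \<open>f\<close>, and the projections below keep the eigenvectors found before.\<close>
  have f_conj: "[f (u \<otimes> y \<otimes> inv u) = f y] (mod m)" if "u \<in> D" "y \<in> D" for u y
  proof -
    have "[f ((u \<otimes> y \<otimes> inv u \<otimes> inv y) \<otimes> y) = f (u \<otimes> y \<otimes> inv u \<otimes> inv y) + f y] (mod m)"
      using that by (intro f) auto
    also have "[f (u \<otimes> y \<otimes> inv u \<otimes> inv y) + f y = 0 + f y] (mod m)"
      using that comm_C f(2) by (intro cong_add) auto
    finally show ?thesis using that by (simp add: group_normalize)
  qed
  have cj_x: "[f (cj j (h \<otimes> y \<otimes> inv h)) = f (h \<otimes> cj j y \<otimes> inv h)] (mod m)"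
    if "h \<in> carrier G" "y \<in> D" for j h y
  proof -
    define c where "c = g [^] j \<otimes> h \<otimes> inv (g [^] j) \<otimes> inv h"
    have "cj j (h \<otimes> y \<otimes> inv h) = c \<otimes> (h \<otimes> cj j y \<otimes> inv h) \<otimes> inv c"
      unfolding cj_def c_def using that g by (simp add: group_normalize)
    moreover have "c \<in> D" unfolding c_def using that g by (intro comm_D) auto
    ultimately show ?thesis using f_conj that cjD D_conj by simp
  qed
  obtain s where s1: "[s ^ (p - 1) = 1] (mod m)"
    and geo: "\<And>j. 0 < j \<Longrightarrow> j < p - 1 \<Longrightarrow> [(\<Sum>i<p - 1. s ^ (i * j)) = 0] (mod m)"
    using primitive_root_sums[OF p] unfolding m_def by blast
  define q where "q = p - 2"
  have q: "p = Suc (Suc q)" using prime_ge_2_nat[OF p] by (simp add: q_def)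
  define r where "r = s ^ q"
  have rs: "[r * s = 1] (mod m)" using s1 by (simp add: r_def q mult.commute)
  \<comment> \<open>The projection of \<open>f\<close> onto the eigenspace of conjugation by \<open>g\<close> for the eigenvalue \<open>r ^ i\<close>.\<close>
  define h where "h i y = (\<Sum>j<p - 1. s ^ (i * j) * f (cj j y))" for i y
  have h_hom: "[h i (u \<otimes> v) = h i u + h i v] (mod m)" if "u \<in> D" "v \<in> D" for i u v
  proof -
    have "[h i (u \<otimes> v) = (\<Sum>j<p - 1. s ^ (i * j) * (f (cj j u) + f (cj j v)))] (mod m)"
      unfolding h_def using that by (intro cong_sum cong_scalar_left) (simp add: cj_mult f cjD)
    then show ?thesis by (simp add: h_def sum.distrib algebra_simps)
  qed
  have h_C: "[h i c = 0] (mod m)" if "c \<in> C" for i c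
  proof -
    have "[h i c = (\<Sum>j<p - 1. s ^ (i * j) * 0)] (mod m)"
      unfolding h_def using that by (intro cong_sum cong_scalar_left) (simp add: f cjC)
    then show ?thesis by simp
  qed
  have h_eig: "\<exists>a. \<forall>y\<in>D. [h i (x l \<otimes> y \<otimes> inv (x l)) = a * h i y] (mod m)" if l: "l < n" for i l
  proof -
    obtain a where a: "\<And>y. y \<in> D \<Longrightarrow> [f (x l \<otimes> y \<otimes> inv (x l)) = a * f y] (mod m)" using eig[OF l] by blast
    have "[h i (x l \<otimes> y \<otimes> inv (x l)) = a * h i y] (mod m)" if "y \<in> D" for y
    proof -
      have "[h i (x l \<otimes> y \<otimes> inv (x l)) = (\<Sum>j<p - 1. s ^ (i * j) * (a * f (cj j y)))] (mod m)"
        unfolding h_def using that \<open>l < n\<close> Suc.prems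
        by (intro cong_sum cong_scalar_left cong_trans[OF cj_x a]) (auto simp: cjD)
      then show ?thesis by (simp add: h_def sum_distrib_left algebra_simps)
    qed
    then show ?thesis by blast
  qed
  have h_eig_g: "[h i (g \<otimes> y \<otimes> inv g) = r ^ i * h i y] (mod m)" if "y \<in> D" for i y
  proof -
    define T where "T j = s ^ (i * j) * r ^ i * f (cj j y)" for j
    have shift: "[s ^ (i * j) * f (cj (Suc j) y) = T (Suc j)] (mod m)" for j
    proof -
      have "T (Suc j) = (r * s) ^ i * (s ^ (i * j) * f (cj (Suc j) y))"
        by (simp add: T_def power_add power_mult_distrib algebra_simps)
      also have "[\<dots> = 1 ^ i * (s ^ (i * j) * f (cj (Suc j) y))] (mod m)"
        by (intro cong_mult cong_pow rs cong_refl)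
      finally show ?thesis by (simp add: cong_sym)
    qed
    have "[h i (g \<otimes> y \<otimes> inv g) = (\<Sum>j<p - 1. T (Suc j))] (mod m)"
      unfolding h_def using that shift by (intro cong_sum) (simp add: cj_Suc)
    also have "(\<Sum>j<p - 1. T (Suc j)) = (\<Sum>j<p - 1. T j) + (T (p - 1) - T 0)"
      using sum.lessThan_Suc_shift[of T "p - 1"] by simp
    also have "[T (p - 1) = T 0] (mod m)"
    proof -
      have "[f (cj (p - 1) y) = f y] (mod m)" unfolding cj_def m_def
        using that g f by (intro pow) (auto simp: m_def)
      moreover have "cj 0 y = y" using that g by (simp add: cj_def)
      ultimately have "[(s ^ (p - 1)) ^ i * r ^ i * f (cj (p - 1) y) = 1 ^ i * r ^ i * f (cj 0 y)] (mod m)"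
        by (intro cong_mult cong_pow s1) auto
      then show ?thesis by (simp add: T_def power_mult mult.commute flip: power_mult)
    qed
    then have "[(\<Sum>j<p - 1. T j) + (T (p - 1) - T 0) = (\<Sum>j<p - 1. T j) + 0] (mod m)"
      by (intro cong_add) (auto simp: cong_iff_dvd_diff)
    also have "(\<Sum>j<p - 1. T j) + 0 = r ^ i * h i y"
      by (simp add: T_def h_def sum_distrib_left algebra_simps)
    finally show ?thesis .
  qed
  have "\<exists>i. \<exists>u\<in>D. \<not> m dvd h i u"
  proof (rule ccontr)
    assume "\<not> ?thesis"
    then have dvd: "m dvd h i u" if "u \<in> D" for i u using that by blast
    obtain y where y: "y \<in> D" "\<not> m dvd f y" using f by blast
    have "m dvd (\<Sum>i<p - 1. h i y)" using dvd y by (intro dvd_sum) auto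
    also have "(\<Sum>i<p - 1. h i y) = (\<Sum>j<p - 1. (\<Sum>i<p - 1. s ^ (i * j)) * f (cj j y))"
      unfolding h_def by (subst sum.swap) (simp add: sum_distrib_right)
    also have "\<dots> = (\<Sum>i<p - 1. s ^ (i * 0)) * f (cj 0 y) + (\<Sum>j\<in>{..<p - 1} - {0}. (\<Sum>i<p - 1. s ^ (i * j)) * f (cj j y))"
      using q by (intro sum.remove) auto
    finally have "[(\<Sum>i<p - 1. s ^ (i * 0)) * f (cj 0 y) + (\<Sum>j\<in>{..<p - 1} - {0}. (\<Sum>i<p - 1. s ^ (i * j)) * f (cj j y)) = 0] (mod m)"
      by (simp add: cong_0_iff)
    moreover have "[(\<Sum>j\<in>{..<p - 1} - {0}. (\<Sum>i<p - 1. s ^ (i * j)) * f (cj j y)) =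
        (\<Sum>j\<in>{..<p - 1} - {0}. 0 * f (cj j y))] (mod m)"
      by (intro cong_sum cong_scalar_right geo) auto
    ultimately have "[(\<Sum>i<p - 1. s ^ (i * 0)) * f (cj 0 y) = 0] (mod m)"
      by (simp add: cong_0_iff cong_iff_dvd_diff dvd_add_left_iff)
    moreover have "cj 0 y = y" using y g by (simp add: cj_def)
    ultimately have "m dvd int (p - 1) * f y" by (simp add: cong_0_iff)
    moreover have "\<not> m dvd int (p - 1)" unfolding m_def int_dvd_int_iff using q by (auto dest: dvd_imp_le)
    moreover have "prime m" using p by (simp add: m_def)
    ultimately show False using y by (metis prime_dvd_mult_iff)
  qed
  then obtain i where i: "\<exists>u\<in>D. \<not> m dvd h i u" by blast
  have "\<exists>a. \<forall>y\<in>D. [h i (x l \<otimes> y \<otimes> inv (x l)) = a * h i y] (mod m)" if "l < Suc n" for l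
    using that h_eig[of l i] h_eig_g[of _ i] unfolding g_def less_Suc_eq by blast
  then show ?case using h_hom h_C i unfolding m_def by blast
qed

text \<open>
  The key to the nondense case. If the image of \<open>B\<close> in a finite group satisfying the laws is a proper
  subgroup, then some action of \<open>G\<close> on the affine line over a prime field has \<open>B\<close>, but not \<open>G\<close>,
  in the stabiliser of zero; here \<open>\<delta> g\<close> is the image of zero under \<open>g\<close> and \<open>a i\<close> the slope of \<open>x i\<close>.
  If \<open>B\<close> together with the derived subgroup \<open>D\<close> does not generate \<open>G\<close>, translations suffice.
  Otherwise the intersection of \<open>B\<close> and \<open>D\<close> is normal in \<open>G\<close>, a homomorphism on \<open>D\<close> that vanishes on it
  and is an eigenvector for conjugation extends to \<open>G\<close> by the value zero on \<open>B\<close>, and this extension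
  is the required \<open>\<delta>\<close>.
\<close>

lemma ex_affine_action:
  fixes n :: nat
  assumes K: "group K" "finite (carrier K)" "affine_laws K" and \<phi>: "\<phi> \<in> hom G K"
    and B: "subgroup B G" "B \<noteq> carrier G"
    and ker: "\<And>g. g \<in> carrier G \<Longrightarrow> \<phi> g = \<one>\<^bsub>K\<^esub> \<Longrightarrow> g \<in> B"
    and x: "\<And>i. i < n \<Longrightarrow> x i \<in> carrier G"
  obtains p :: nat and \<delta> :: "'a \<Rightarrow> int" and a b d :: "nat \<Rightarrow> int" where "prime p"
    "\<And>i. i < n \<Longrightarrow> [a i * b i = 1] (mod int p)"
    "\<And>i h. i < n \<Longrightarrow> h \<in> carrier G \<Longrightarrow> [\<delta> (x i \<otimes> h) = a i * \<delta> h + d i] (mod int p)"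
    "\<And>h. h \<in> B \<Longrightarrow> [\<delta> h = 0] (mod int p)" "\<exists>g\<in>carrier G. \<not> int p dvd \<delta> g"
proof -
  interpret \<phi>: group_hom G K \<phi> using K \<phi> by (simp add: group_hom_def group_hom_axioms_def group_axioms)
  define D where "D = derived G (carrier G)"
  have D: "subgroup D G" "D \<lhd> G" unfolding D_def
    using derived_is_subgroup derived_self_is_normal by auto
  define DB where "DB = D <#> B"
  have DB: "subgroup DB G" unfolding DB_def by (rule mult_norm_subgroup[OF D(2) B(1)])
  note [simp] = subgroup.m_closed[OF D(1)] subgroup.m_inv_closed[OF D(1)] subgroup.one_closed[OF D(1)]
    subgroup.m_closed[OF B(1)] subgroup.m_inv_closed[OF B(1)] subgroup.one_closed[OF B(1)]
  have [simp]: "u \<in> D \<Longrightarrow> u \<in> carrier G" "u \<in> B \<Longrightarrow> u \<in> carrier G" for u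
    using subgroup.subset[OF D(1)] subgroup.subset[OF B(1)] by auto
  have DBI: "u \<otimes> v \<in> DB" if "u \<in> D" "v \<in> B" for u v using that by (auto simp: DB_def set_mult_def)
  have DB_D: "D \<subseteq> DB" using DBI[of _ \<one>] by auto
  have DB_B: "B \<subseteq> DB" using DBI[of \<one>] by auto
  have comm_D: "g \<otimes> h \<otimes> inv g \<otimes> inv h \<in> D" if "g \<in> carrier G" "h \<in> carrier G" for g h
    unfolding D_def derived_def using that by (intro generate.incl) auto
  have D_conj: "g \<otimes> y \<otimes> inv g \<in> D" if "g \<in> carrier G" "y \<in> D" for g y
    using normal.inv_op_closed2[OF D(2)] that by blast
  have sep: "inv u \<otimes> v \<in> B" if "u \<in> carrier G" "v \<in> carrier G" "\<phi> u = \<phi> v" for u v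
    using that by (intro ker) auto
  have fin: "finite (\<phi> ` S)" if "S \<subseteq> carrier G" for S
    using that K(2) by (meson finite_subset image_subset_iff \<phi>.hom_closed subsetD)
  show ?thesis
  proof (cases "DB = carrier G")
    case False
    obtain p f where p: "prime p"
      and f: "\<And>u v. u \<in> carrier G \<Longrightarrow> v \<in> carrier G \<Longrightarrow> [f (u \<otimes> v) = f u + f v] (mod int p)"
        "\<And>c. c \<in> DB \<Longrightarrow> [f c = 0] (mod int p)" "\<exists>u\<in>carrier G. \<not> int p dvd f u"
    proof (rule ex_hom_mod_prime[OF subgroup_self DB subgroup.subset[OF DB] False])
      show "u \<otimes> v \<otimes> inv u \<otimes> inv v \<in> DB" if "u \<in> carrier G" "v \<in> carrier G" for u v
        using comm_D[OF that] DB_D by blast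
      show "finite (\<phi> ` carrier G)" by (rule fin) simp
      show "inv u \<otimes> v \<in> DB" if "u \<in> carrier G" "v \<in> carrier G" "\<phi> u = \<phi> v" for u v
        using sep[OF that] DB_B by blast
    qed blast
    show ?thesis
    proof (rule that[of p "\<lambda>_. 1" "\<lambda>_. 1" f "\<lambda>i. f (x i)"])
      show "[f (x i \<otimes> h) = 1 * f h + f (x i)] (mod int p)" if "i < n" "h \<in> carrier G" for i h
        using f(1)[OF x[OF that(1)] that(2)] by (simp add: add.commute)
      show "[f h = 0] (mod int p)" if "h \<in> B" for h using f(2) that DB_B by blast
    qed (use p f in auto)
  next
    case True
    define C where "C = D \<inter> B"
    have C: "subgroup C G" unfolding C_def by (rule subgroups_Inter_pair[OF D(1) B(1)])
    have split: "\<exists>y\<in>D. inv y \<otimes> g \<in> B" if g: "g \<in> carrier G" for g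
    proof -
      have "g \<in> D <#> B" using True g by (simp add: DB_def)
      then obtain y b where "y \<in> D" "b \<in> B" "g = y \<otimes> b" by (auto simp: set_mult_def)
      then show ?thesis by (intro bexI[of _ y]) (simp_all add: group_normalize)
    qed
    have "C \<noteq> D"
    proof
      assume "C = D"
      then have "D \<subseteq> B" by (auto simp: C_def)
      then have "DB \<subseteq> B" by (auto simp: DB_def set_mult_def)
      then show False using True B subgroup.subset[OF B(1)] by blast
    qed
    \<comment> \<open>The first law says that generators of the derived subgroup commute in \<open>K\<close>; taking centralisers twice
      extends this to the whole derived subgroup.\<close>
    have comm_C: "u \<otimes> v \<otimes> inv u \<otimes> inv v \<in> C" if uv: "u \<in> D" "v \<in> D" for u v
    proof -
      define Z where "Z S = {v \<in> carrier G. \<forall>u\<in>S. \<phi> u \<otimes>\<^bsub>K\<^esub> \<phi> v = \<phi> v \<otimes>\<^bsub>K\<^esub> \<phi> u}" for S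
      have Z: "subgroup (Z S) G" if S: "S \<subseteq> carrier G" for S
      proof (rule subgroupI)
        show "Z S \<subseteq> carrier G" by (auto simp: Z_def)
        have "\<one> \<in> Z S" using S by (auto simp: Z_def)
        then show "Z S \<noteq> {}" by blast
      next
        fix a assume a: "a \<in> Z S"
        have "\<phi> u \<otimes>\<^bsub>K\<^esub> inv\<^bsub>K\<^esub> \<phi> a = inv\<^bsub>K\<^esub> \<phi> a \<otimes>\<^bsub>K\<^esub> \<phi> u" if "u \<in> S" for u
        proof -
          have c: "\<phi> u \<in> carrier K" "\<phi> a \<in> carrier K" using that S a by (auto simp: Z_def)
          have e: "\<phi> u \<otimes>\<^bsub>K\<^esub> \<phi> a = \<phi> a \<otimes>\<^bsub>K\<^esub> \<phi> u" using that a by (auto simp: Z_def)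
          have "inv\<^bsub>K\<^esub> \<phi> a \<otimes>\<^bsub>K\<^esub> (\<phi> u \<otimes>\<^bsub>K\<^esub> \<phi> a) \<otimes>\<^bsub>K\<^esub> inv\<^bsub>K\<^esub> \<phi> a = inv\<^bsub>K\<^esub> \<phi> a \<otimes>\<^bsub>K\<^esub> (\<phi> a \<otimes>\<^bsub>K\<^esub> \<phi> u) \<otimes>\<^bsub>K\<^esub> inv\<^bsub>K\<^esub> \<phi> a"
            by (simp add: e)
          then show ?thesis using c by (simp add: \<phi>.H.group_normalize)
        qed
        then show "inv a \<in> Z S" using a by (auto simp: Z_def)
      next
        fix a b assume ab: "a \<in> Z S" "b \<in> Z S"
        have "\<phi> u \<otimes>\<^bsub>K\<^esub> (\<phi> a \<otimes>\<^bsub>K\<^esub> \<phi> b) = (\<phi> a \<otimes>\<^bsub>K\<^esub> \<phi> b) \<otimes>\<^bsub>K\<^esub> \<phi> u" if "u \<in> S" for u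
        proof -
          have c: "\<phi> u \<in> carrier K" "\<phi> a \<in> carrier K" "\<phi> b \<in> carrier K" using that S ab by (auto simp: Z_def)
          have e: "\<phi> u \<otimes>\<^bsub>K\<^esub> \<phi> a = \<phi> a \<otimes>\<^bsub>K\<^esub> \<phi> u" "\<phi> u \<otimes>\<^bsub>K\<^esub> \<phi> b = \<phi> b \<otimes>\<^bsub>K\<^esub> \<phi> u" using that ab by (auto simp: Z_def)
          show ?thesis using c e by (metis \<phi>.H.m_assoc)
        qed
        then show "a \<otimes> b \<in> Z S" using ab by (auto simp: Z_def)
      qed
      define S where "S = derived_set G (carrier G)"
      have S: "S \<subseteq> carrier G" unfolding S_def by (rule derived_set_in_carrier) simp
      have gen: "D \<subseteq> Z T" if "T \<subseteq> carrier G" "S \<subseteq> Z T" for T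
        unfolding D_def derived_def using generate_subgroup_incl[OF that(2)[unfolded S_def] Z[OF that(1)]] .
      have "S \<subseteq> Z S"
      proof
        fix c assume c: "c \<in> S"
        have "\<phi> c' \<otimes>\<^bsub>K\<^esub> \<phi> c = \<phi> c \<otimes>\<^bsub>K\<^esub> \<phi> c'" if "c' \<in> S" for c'
        proof -
          have "\<exists>u\<in>carrier G. \<exists>v\<in>carrier G. s = commutator G u v" if "s \<in> S" for s
            using that by (auto simp: S_def commutator_def)
          then obtain u v s t where "c' = commutator G u v" "c = commutator G s t"
            "u \<in> carrier G" "v \<in> carrier G" "s \<in> carrier G" "t \<in> carrier G"
            using \<open>c \<in> S\<close> \<open>c' \<in> S\<close> by metis
          then show ?thesis using K(3) by (simp add: \<phi>.hom_commutator affine_laws_def)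
        qed
        then show "c \<in> Z S" using c S by (auto simp: Z_def)
      qed
      then have "D \<subseteq> Z S" using S gen by blast
      then have "S \<subseteq> Z D" using S by (fastforce simp: Z_def)
      then have "D \<subseteq> Z D" by (intro gen) auto
      then have e: "\<phi> u \<otimes>\<^bsub>K\<^esub> \<phi> v = \<phi> v \<otimes>\<^bsub>K\<^esub> \<phi> u" using uv by (auto simp: Z_def)
      have "\<phi> (u \<otimes> v \<otimes> inv u \<otimes> inv v) = \<phi> v \<otimes>\<^bsub>K\<^esub> \<phi> u \<otimes>\<^bsub>K\<^esub> inv\<^bsub>K\<^esub> \<phi> u \<otimes>\<^bsub>K\<^esub> inv\<^bsub>K\<^esub> \<phi> v"
        using uv by (simp add: e)
      also have "\<dots> = \<one>\<^bsub>K\<^esub>" using uv by (simp add: \<phi>.H.group_normalize)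
      finally have "u \<otimes> v \<otimes> inv u \<otimes> inv v \<in> B" using uv by (intro ker) auto
      then show ?thesis using uv by (simp add: C_def)
    qed
    \<comment> \<open>\<open>B\<close> normalises \<open>C\<close>, and so does \<open>D\<close>, which is commutative modulo \<open>C\<close>; together they make up \<open>G\<close>.\<close>
    have C_conj: "g \<otimes> y \<otimes> inv g \<in> C" if g: "g \<in> carrier G" and yC: "y \<in> C" for g y
    proof -
      obtain u where u: "u \<in> D" "inv u \<otimes> g \<in> B" using split[OF g] by blast
      define s where "s = inv u \<otimes> g"
      define c where "c = s \<otimes> y \<otimes> inv s"
      have s: "s \<in> B" "g = u \<otimes> s" using u g by (simp_all add: s_def group_normalize)
      have y: "y \<in> D" "y \<in> B" using yC by (simp_all add: C_def)
      have "c \<in> B" unfolding c_def using s(1) y by simp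
      moreover have "c \<in> D" unfolding c_def using s(1) y by (intro D_conj) simp_all
      ultimately have c: "c \<in> C" by (simp add: C_def)
      have "(u \<otimes> c \<otimes> inv u \<otimes> inv c) \<otimes> c \<in> C" using comm_C[OF u(1) \<open>c \<in> D\<close>] c by (rule subgroup.m_closed[OF C])
      also have "(u \<otimes> c \<otimes> inv u \<otimes> inv c) \<otimes> c = u \<otimes> c \<otimes> inv u" using u \<open>c \<in> D\<close> by (simp add: group_normalize)
      also have "\<dots> = g \<otimes> y \<otimes> inv g" unfolding c_def s(2) using u(1) s(1) y by (simp add: group_normalize)
      finally show ?thesis .
    qed
    obtain p f0 where p: "prime p"
      and f0: "\<And>u v. u \<in> D \<Longrightarrow> v \<in> D \<Longrightarrow> [f0 (u \<otimes> v) = f0 u + f0 v] (mod int p)"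
        "\<And>c. c \<in> C \<Longrightarrow> [f0 c = 0] (mod int p)" "\<exists>u\<in>D. \<not> int p dvd f0 u"
    proof (rule ex_hom_mod_prime[OF D(1) C _ \<open>C \<noteq> D\<close>])
      show "u \<otimes> v \<otimes> inv u \<otimes> inv v \<in> C" if "u \<in> D" "v \<in> D" for u v
        by (rule comm_C[OF that])
      show "C \<subseteq> D" by (simp add: C_def)
      show "finite (\<phi> ` D)" by (rule fin) auto
      show "inv u \<otimes> v \<in> C" if "u \<in> D" "v \<in> D" "\<phi> u = \<phi> v" for u v
        using sep[of u v] that by (simp add: C_def)
    qed blast
    obtain e where e: "\<not> p dvd e" "\<And>g u v. g \<in> carrier K \<Longrightarrow> u \<in> carrier K \<Longrightarrow> v \<in> carrier K \<Longrightarrow>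
           g [^]\<^bsub>K\<^esub> (p - 1) \<otimes>\<^bsub>K\<^esub> commutator K u v [^]\<^bsub>K\<^esub> e =
           commutator K u v [^]\<^bsub>K\<^esub> e \<otimes>\<^bsub>K\<^esub> g [^]\<^bsub>K\<^esub> (p - 1)"
      using K(3) p unfolding affine_laws_def by metis
    \<comment> \<open>The second law holds for powers of commutators. The exponent is prime to \<open>p\<close> and can be cancelled in
      the values of \<open>f\<close>, and commutators generate \<open>D\<close>.\<close>
    have pow: "[f (g [^] (p - 1) \<otimes> y \<otimes> inv (g [^] (p - 1))) = f y] (mod int p)"
      if g: "g \<in> carrier G" and y: "y \<in> D"
        and f: "\<And>u v. u \<in> D \<Longrightarrow> v \<in> D \<Longrightarrow> [f (u \<otimes> v) = f u + f v] (mod int p)"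
          "\<And>c. c \<in> C \<Longrightarrow> [f c = 0] (mod int p)" for g y and f :: "'a \<Rightarrow> int"
    proof -
      define h where "h = g [^] (p - 1)"
      have h: "h \<in> carrier G" using g by (simp add: h_def)
      define Z where "Z = {y \<in> D. [f (h \<otimes> y \<otimes> inv h) = f y] (mod int p)}"
      have f1: "[f \<one> = 0] (mod int p)" using f(2) subgroup.one_closed[OF C] by blast
      have f_inv: "[f (inv u) = - f u] (mod int p)" if "u \<in> D" for u
      proof -
        have "[f (inv u \<otimes> u) = f (inv u) + f u] (mod int p)" using that by (intro f) auto
        then have "[f (inv u) + f u = 0] (mod int p)" using that f1 by (simp add: cong_def)
        then show ?thesis by (simp add: cong_iff_dvd_diff)
      qed
      have f_pow: "[f (u [^] (k::nat)) = int k * f u] (mod int p)" if "u \<in> D" for u k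
      proof (induction k)
        case (Suc k)
        have "u [^] k \<in> D" using that subgroup_int_pow_closed[OF D(1), of u "int k"] by (simp add: int_pow_int)
        then have "[f (u [^] Suc k) = f (u [^] k) + f u] (mod int p)" using that f by simp
        also have "[f (u [^] k) + f u = int k * f u + f u] (mod int p)" using Suc by (intro cong_add) auto
        finally show ?case by (simp add: algebra_simps)
      qed (use f1 in simp)
      have "subgroup Z G"
      proof (rule subgroupI)
        show "Z \<subseteq> carrier G" by (auto simp: Z_def)
        have "\<one> \<in> Z" using h by (auto simp: Z_def)
        then show "Z \<noteq> {}" by blast
      next
        fix u assume u: "u \<in> Z"
        then have uD: "u \<in> D" by (simp add: Z_def)
        have "h \<otimes> inv u \<otimes> inv h = inv (h \<otimes> u \<otimes> inv h)" using uD h by (simp add: group_normalize)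
        then have "[f (h \<otimes> inv u \<otimes> inv h) = - f (h \<otimes> u \<otimes> inv h)] (mod int p)"
          using f_inv[OF D_conj[OF h uD]] by simp
        also have "[- f (h \<otimes> u \<otimes> inv h) = - f u] (mod int p)"
          using u by (simp add: Z_def cong_minus_minus_iff)
        also have "[- f u = f (inv u)] (mod int p)" using f_inv[OF uD] by (rule cong_sym)
        finally show "inv u \<in> Z" using uD by (simp add: Z_def)
      next
        fix u v assume uv: "u \<in> Z" "v \<in> Z"
        then have D': "u \<in> D" "v \<in> D" by (simp_all add: Z_def)
        have "h \<otimes> (u \<otimes> v) \<otimes> inv h = (h \<otimes> u \<otimes> inv h) \<otimes> (h \<otimes> v \<otimes> inv h)" using D' h by (simp add: group_normalize)
        then have "[f (h \<otimes> (u \<otimes> v) \<otimes> inv h) = f (h \<otimes> u \<otimes> inv h) + f (h \<otimes> v \<otimes> inv h)] (mod int p)"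
          using f D' h D_conj by simp
        also have "[f (h \<otimes> u \<otimes> inv h) + f (h \<otimes> v \<otimes> inv h) = f u + f v] (mod int p)"
          using uv by (intro cong_add) (auto simp: Z_def)
        also have "[f u + f v = f (u \<otimes> v)] (mod int p)" using f D' by (intro cong_sym[OF f(1)])
        finally show "u \<otimes> v \<in> Z" using D' by (simp add: Z_def)
      qed
      moreover have "derived_set G (carrier G) \<subseteq> Z"
      proof
        fix c assume "c \<in> derived_set G (carrier G)"
        then obtain u v where uv: "u \<in> carrier G" "v \<in> carrier G" "c = commutator G u v"
          by (auto simp: commutator_def)
        then have cD: "c \<in> D" using comm_D by (simp add: commutator_def)
        have ceD: "c [^] e \<in> D" using cD subgroup_int_pow_closed[OF D(1), of c "int e"] by (simp add: int_pow_int)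
        define t where "t = (h \<otimes> c [^] e \<otimes> inv h) \<otimes> inv (c [^] e)"
        have "t \<in> C"
        proof -
          have c: "\<phi> h \<otimes>\<^bsub>K\<^esub> \<phi> (c [^] e) = \<phi> (c [^] e) \<otimes>\<^bsub>K\<^esub> \<phi> h"
            using uv g e(2)[of "\<phi> g" "\<phi> u" "\<phi> v"] by (simp add: h_def \<phi>.hom_nat_pow \<phi>.hom_commutator)
          have "\<phi> t = \<one>\<^bsub>K\<^esub>" unfolding t_def using ceD h by (simp add: c \<phi>.H.group_normalize)
          moreover have "t \<in> D" unfolding t_def using ceD h D_conj by simp
          ultimately show ?thesis using ker by (simp add: C_def)
        qed
        have "t \<otimes> c [^] e = (h \<otimes> c \<otimes> inv h) [^] e"
        proof -
          have "(h \<otimes> c \<otimes> inv h) [^] k = h \<otimes> c [^] k \<otimes> inv h" for k :: nat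
            by (induction k) (use cD h in \<open>auto simp: group_normalize\<close>)
          then show ?thesis unfolding t_def using ceD h cD by (simp add: group_normalize)
        qed
        then have "[f (t \<otimes> c [^] e) = int e * f (h \<otimes> c \<otimes> inv h)] (mod int p)"
          using f_pow[OF D_conj[OF h cD]] by simp
        moreover have "[f (t \<otimes> c [^] e) = f t + f (c [^] e)] (mod int p)"
          using \<open>t \<in> C\<close> ceD by (intro f) (auto simp: C_def)
        moreover have "[f t + f (c [^] e) = 0 + int e * f c] (mod int p)"
          using \<open>t \<in> C\<close> cD by (intro cong_add f f_pow)
        ultimately have "[int e * f (h \<otimes> c \<otimes> inv h) = int e * f c] (mod int p)"
          by (simp add: cong_def)
        moreover have "coprime (int e) (int p)" using e(1) p
          by (metis coprime_commute coprime_int_iff prime_imp_coprime)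
        ultimately have "[f (h \<otimes> c \<otimes> inv h) = f c] (mod int p)" by (simp add: cong_mult_lcancel)
        then show "c \<in> Z" using cD by (simp add: Z_def)
      qed
      ultimately have "D \<subseteq> Z" unfolding D_def derived_def by (intro generate_subgroup_incl)
      then show ?thesis using y by (auto simp: Z_def h_def)
    qed
    have "C \<subseteq> D" by (simp add: C_def)
    have "\<exists>f. (\<forall>u\<in>D. \<forall>v\<in>D. [f (u \<otimes> v) = f u + f v] (mod int p)) \<and>
        (\<forall>c\<in>C. [f c = 0] (mod int p)) \<and> (\<exists>u\<in>D. \<not> int p dvd f u) \<and>
        (\<forall>i<n. \<exists>a. \<forall>y\<in>D. [f (x i \<otimes> y \<otimes> inv (x i)) = a * f y] (mod int p))"
      by (rule ex_common_eigenhom[OF p D(1) \<open>C \<subseteq> D\<close>]) (fact D_conj C_conj comm_D comm_C x pow f0)+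
    then obtain f where f': "\<forall>u\<in>D. \<forall>v\<in>D. [f (u \<otimes> v) = f u + f v] (mod int p)"
        "\<forall>c\<in>C. [f c = 0] (mod int p)" and f3: "\<exists>u\<in>D. \<not> int p dvd f u"
      and eig: "\<forall>i<n. \<exists>a. \<forall>y\<in>D. [f (x i \<otimes> y \<otimes> inv (x i)) = a * f y] (mod int p)"
      by (elim exE conjE) (rule that)
    note f = f'[rule_format] f3
    obtain a where a': "\<forall>i<n. \<forall>y\<in>D. [f (x i \<otimes> y \<otimes> inv (x i)) = a i * f y] (mod int p)"
      using choice[of "\<lambda>i a. i < n \<longrightarrow> (\<forall>y\<in>D. [f (x i \<otimes> y \<otimes> inv (x i)) = a * f y] (mod int p))"] eig by auto
    note a = a'[rule_format]
    have "\<exists>b. [a i * b = 1] (mod int p)" if i: "i < n" for i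
    proof -
      have "\<not> int p dvd a i"
      proof
        assume dvd: "int p dvd a i"
        obtain y where y: "y \<in> D" "\<not> int p dvd f y" using f by blast
        have "inv (x i) \<otimes> y \<otimes> x i \<in> D" using D_conj[of "inv (x i)" y] x[OF i] y by simp
        from a[OF i this] have "[f y = a i * f (inv (x i) \<otimes> y \<otimes> x i)] (mod int p)"
          using x[OF i] y by (simp add: group_normalize)
        then show False using dvd y by (metis cong_dvd_iff dvd_mult2)
      qed
      then have "coprime (a i) (int p)" using p
        by (metis coprime_commute prime_imp_coprime prime_nat_int_transfer)
      then show ?thesis by (rule cong_solve_coprime_int)
    qed
    then obtain b where b: "\<And>i. i < n \<Longrightarrow> [a i * b i = 1] (mod int p)" by metis
    \<comment> \<open>Each \<open>g\<close> is a product of some \<open>y\<close> in \<open>D\<close> and an element of \<open>B\<close>; \<open>f\<close> does not depend on the choice of \<open>y\<close>.\<close>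
    define \<delta> where "\<delta> g = f (SOME y. y \<in> D \<and> inv y \<otimes> g \<in> B)" for g
    have \<delta>: "[\<delta> g = f y] (mod int p)" if g: "g \<in> carrier G" and y: "y \<in> D" "inv y \<otimes> g \<in> B" for g y
    proof -
      define z where "z = (SOME y. y \<in> D \<and> inv y \<otimes> g \<in> B)"
      have z: "z \<in> D" "inv z \<otimes> g \<in> B"
        using someI_ex[OF split[OF g, unfolded Bex_def]] unfolding z_def by auto
      define c where "c = inv y \<otimes> z"
      have "(inv y \<otimes> g) \<otimes> inv (inv z \<otimes> g) \<in> B" by (rule subgroup.m_closed[OF B(1) y(2) subgroup.m_inv_closed[OF B(1) z(2)]])
      then have "c \<in> C" using y z g by (simp add: c_def C_def group_normalize)
      moreover have "z = y \<otimes> c" using y z by (simp add: c_def group_normalize)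
      moreover have "c \<in> D" using y z by (simp add: c_def)
      ultimately have "[f z = f y + f c] (mod int p)" using f(1) y(1) by simp
      also have "[f y + f c = f y + 0] (mod int p)" using f(2) \<open>c \<in> C\<close> by (intro cong_add) auto
      finally have "[f z = f y] (mod int p)" by simp
      then show ?thesis unfolding \<delta>_def z_def[symmetric] .
    qed
    show ?thesis
    proof (rule that[of p a b \<delta> "\<lambda>i. \<delta> (x i)", OF p])
      show "[a i * b i = 1] (mod int p)" if "i < n" for i by (rule b[OF that])
      show "[\<delta> h = 0] (mod int p)" if "h \<in> B" for h
        using \<delta>[of h \<one>] f(2)[OF subgroup.one_closed[OF C]] that by (metis \<open>\<And>u. u \<in> B \<Longrightarrow> u \<in> carrier G\<close> cong_trans inv_one l_one subgroup.one_closed[OF D(1)])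
      obtain y where y: "y \<in> D" "\<not> int p dvd f y" using f by blast
      then have "[\<delta> y = f y] (mod int p)" by (intro \<delta>) auto
      then show "\<exists>g\<in>carrier G. \<not> int p dvd \<delta> g" using y by (metis cong_dvd_iff \<open>\<And>u. u \<in> D \<Longrightarrow> u \<in> carrier G\<close>)
      show "[\<delta> (x i \<otimes> h) = a i * \<delta> h + \<delta> (x i)] (mod int p)" if i: "i < n" and h: "h \<in> carrier G" for i h
      proof -
        obtain u where u: "u \<in> D" "inv u \<otimes> x i \<in> B" using split x[OF i] by blast
        obtain v where v: "v \<in> D" "inv v \<otimes> h \<in> B" using split h by blast
        define s where "s = inv u \<otimes> x i"
        have s: "s \<in> B" "x i = u \<otimes> s" using u x[OF i] by (simp_all add: s_def group_normalize)
        define w where "w = s \<otimes> v \<otimes> inv s"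
        have w: "w \<in> D" unfolding w_def using s v by (intro D_conj) auto
        have "inv (u \<otimes> w) \<otimes> (x i \<otimes> h) = s \<otimes> (inv v \<otimes> h)"
          unfolding w_def s(2) using u(1) s(1) v(1) h by (simp add: group_normalize)
        then have "inv (u \<otimes> w) \<otimes> (x i \<otimes> h) \<in> B" using s v by simp
        then have "[\<delta> (x i \<otimes> h) = f (u \<otimes> w)] (mod int p)" using u w x[OF i] h by (intro \<delta>) auto
        also have "[f (u \<otimes> w) = f u + f w] (mod int p)" using u w by (intro f)
        also have "[f u + f w = \<delta> (x i) + a i * \<delta> h] (mod int p)"
        proof (rule cong_add)
          show "[f u = \<delta> (x i)] (mod int p)" using u x[OF i] by (intro cong_sym[OF \<delta>])
          have "x i \<otimes> v \<otimes> inv (x i) = (u \<otimes> w \<otimes> inv u \<otimes> inv w) \<otimes> w"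
            unfolding w_def s(2) using u(1) s(1) v(1) by (simp add: group_normalize)
          then have "[f (x i \<otimes> v \<otimes> inv (x i)) = f (u \<otimes> w \<otimes> inv u \<otimes> inv w) + f w] (mod int p)"
            using f(1)[of "u \<otimes> w \<otimes> inv u \<otimes> inv w" w] u w by simp
          also have "[f (u \<otimes> w \<otimes> inv u \<otimes> inv w) + f w = 0 + f w] (mod int p)"
            using comm_C[OF u(1) w] f by (intro cong_add) auto
          finally have "[f w = f (x i \<otimes> v \<otimes> inv (x i))] (mod int p)" by (simp add: cong_sym)
          also have "[f (x i \<otimes> v \<otimes> inv (x i)) = a i * f v] (mod int p)" using a[OF i v(1)] .
          also have "[a i * f v = a i * \<delta> h] (mod int p)"
            using v h by (intro cong_scalar_left cong_sym[OF \<delta>])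
          finally show "[f w = a i * \<delta> h] (mod int p)" .
        qed
        finally show ?thesis by (simp add: add.commute)
      qed
    qed
  qed
qed

end

section \<open>The laws define a pseudovariety\<close>

lemma affine_laws_hom_image:
  assumes "group G" "group K" "f \<in> hom G K" "f ` carrier G = carrier K" "affine_laws G"
  shows "affine_laws K"
proof -
  interpret f: group_hom G K f using assms by (simp add: group_hom_def group_hom_axioms_def)
  have L1: "f (commutator G u v) \<otimes>\<^bsub>K\<^esub> f (commutator G s t) = f (commutator G s t) \<otimes>\<^bsub>K\<^esub> f (commutator G u v)"
    if "u \<in> carrier G" "v \<in> carrier G" "s \<in> carrier G" "t \<in> carrier G" for u v s t
    using that assms(5) unfolding affine_laws_def by (simp flip: f.hom_mult)
  have L2: "\<exists>e::nat. \<not> p dvd e \<and> (\<forall>g\<in>carrier G. \<forall>u\<in>carrier G. \<forall>v\<in>carrier G.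
      f (g [^]\<^bsub>G\<^esub> (p - 1)) \<otimes>\<^bsub>K\<^esub> f (commutator G u v [^]\<^bsub>G\<^esub> e) = f (commutator G u v [^]\<^bsub>G\<^esub> e) \<otimes>\<^bsub>K\<^esub> f (g [^]\<^bsub>G\<^esub> (p - 1)))"
    if "prime p" for p :: nat
  proof -
    obtain e where "\<not> p dvd e" "\<forall>g\<in>carrier G. \<forall>u\<in>carrier G. \<forall>v\<in>carrier G.
      g [^]\<^bsub>G\<^esub> (p - 1) \<otimes>\<^bsub>G\<^esub> commutator G u v [^]\<^bsub>G\<^esub> e = commutator G u v [^]\<^bsub>G\<^esub> e \<otimes>\<^bsub>G\<^esub> g [^]\<^bsub>G\<^esub> (p - 1)"
      using assms(5) \<open>prime p\<close> unfolding affine_laws_def by blast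
    then show ?thesis by (intro exI[of _ e]) (simp flip: f.hom_mult)
  qed
  show ?thesis unfolding affine_laws_def assms(4)[symmetric] ball_simps(9)
    using L1 L2 by (simp add: f.hom_commutator f.hom_nat_pow)
qed

lemma affine_laws_subgroup:
  fixes G (structure)
  assumes "group G" "subgroup H G" "affine_laws G"
  shows "affine_laws (G\<lparr>carrier := H\<rparr>)"
proof -
  interpret group G by fact
  have H: "u \<in> carrier G" if "u \<in> H" for u using that assms(2) subgroup.subset by blast
  have [simp]: "commutator (G\<lparr>carrier := H\<rparr>) u v = commutator G u v" if "u \<in> H" "v \<in> H" for u v
    unfolding commutator_def using that assms(2) by simp
  have [simp]: "u [^]\<^bsub>G\<lparr>carrier := H\<rparr>\<^esub> (k::nat) = u [^] k" for u k
    using nat_pow_consistent by simp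
  show ?thesis using assms(3) H unfolding affine_laws_def by simp metis
qed

text \<open>
  The exponents of the factors for a prime \<open>p\<close> may differ; their product serves all of them and is still prime
  to \<open>p\<close>. This is where \<open>I\<close> has to be finite.
\<close>

lemma affine_laws_product:
  assumes "finite I" "\<And>i. i \<in> I \<Longrightarrow> group (Gs i)" "\<And>i. i \<in> I \<Longrightarrow> affine_laws (Gs i)"
  shows "affine_laws (product_group I Gs)"
proof -
  let ?P = "product_group I Gs"
  have P: "group ?P" using assms by simp
  have hom: "(\<lambda>x. x i) \<in> hom ?P (Gs i)" if "i \<in> I" for i using that by (auto simp: hom_def)
  have gh: "group_hom ?P (Gs i) (\<lambda>x. x i)" if "i \<in> I" for i
    using P hom[OF that] assms(2)[OF that] by (simp add: group_hom_def group_hom_axioms_def)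
  interpret P: group ?P by (rule P)
  have eqI: "x = y" if "x \<in> carrier ?P" "y \<in> carrier ?P" "\<And>i. i \<in> I \<Longrightarrow> x i = y i" for x y
    using that by (auto intro: PiE_ext)
  have closed: "x i \<in> carrier (Gs i)" if "x \<in> carrier ?P" "i \<in> I" for x i using that by auto
  note pr = group_hom.hom_mult[OF gh] group_hom.hom_commutator[OF gh] group_hom.hom_nat_pow[OF gh]
  show ?thesis unfolding affine_laws_def
  proof (intro conjI ballI allI impI)
    fix u v s t assume *: "u \<in> carrier ?P" "v \<in> carrier ?P" "s \<in> carrier ?P" "t \<in> carrier ?P"
    show "commutator ?P u v \<otimes>\<^bsub>?P\<^esub> commutator ?P s t = commutator ?P s t \<otimes>\<^bsub>?P\<^esub> commutator ?P u v"
    proof (rule eqI)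
      fix i assume i: "i \<in> I"
      show "(commutator ?P u v \<otimes>\<^bsub>?P\<^esub> commutator ?P s t) i = (commutator ?P s t \<otimes>\<^bsub>?P\<^esub> commutator ?P u v) i"
        using assms(3)[OF i] closed[OF _ i] * i unfolding affine_laws_def
        by (simp del: mult_product_group carrier_product_group add: pr)
    qed (use * in \<open>simp_all del: mult_product_group carrier_product_group\<close>)
  next
    fix p :: nat assume p: "prime p"
    have "\<forall>i\<in>I. \<exists>e::nat. \<not> p dvd e \<and> (\<forall>g\<in>carrier (Gs i). \<forall>u\<in>carrier (Gs i). \<forall>v\<in>carrier (Gs i).
           g [^]\<^bsub>Gs i\<^esub> (p - 1) \<otimes>\<^bsub>Gs i\<^esub> commutator (Gs i) u v [^]\<^bsub>Gs i\<^esub> e =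
           commutator (Gs i) u v [^]\<^bsub>Gs i\<^esub> e \<otimes>\<^bsub>Gs i\<^esub> g [^]\<^bsub>Gs i\<^esub> (p - 1))"
      using assms(3) p unfolding affine_laws_def by blast
    then obtain e :: "_ \<Rightarrow> nat" where e: "\<And>i. i \<in> I \<Longrightarrow> \<not> p dvd e i"
      and comm: "\<And>i g u v. i \<in> I \<Longrightarrow> g \<in> carrier (Gs i) \<Longrightarrow> u \<in> carrier (Gs i) \<Longrightarrow> v \<in> carrier (Gs i) \<Longrightarrow>
           g [^]\<^bsub>Gs i\<^esub> (p - 1) \<otimes>\<^bsub>Gs i\<^esub> commutator (Gs i) u v [^]\<^bsub>Gs i\<^esub> e i =
           commutator (Gs i) u v [^]\<^bsub>Gs i\<^esub> e i \<otimes>\<^bsub>Gs i\<^esub> g [^]\<^bsub>Gs i\<^esub> (p - 1)"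
      by (subst (asm) bchoice_iff) blast
    define E where "E = prod e I"
    have "\<not> p dvd E" using e p assms(1) by (simp add: E_def prime_dvd_prod_iff)
    moreover have "g [^]\<^bsub>?P\<^esub> (p - 1) \<otimes>\<^bsub>?P\<^esub> commutator ?P u v [^]\<^bsub>?P\<^esub> E =
        commutator ?P u v [^]\<^bsub>?P\<^esub> E \<otimes>\<^bsub>?P\<^esub> g [^]\<^bsub>?P\<^esub> (p - 1)"
      if *: "g \<in> carrier ?P" "u \<in> carrier ?P" "v \<in> carrier ?P" for g u v
    proof (rule eqI)
      fix i assume i: "i \<in> I"
      interpret Gi: group "Gs i" using assms(2) i by blast
      define h where "h = g i [^]\<^bsub>Gs i\<^esub> (p - 1)"
      define c where "c = commutator (Gs i) (u i) (v i) [^]\<^bsub>Gs i\<^esub> e i"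
      have hc: "h \<in> carrier (Gs i)" "c \<in> carrier (Gs i)" using closed[OF _ i] * by (simp_all add: h_def c_def)
      have "h \<otimes>\<^bsub>Gs i\<^esub> c = c \<otimes>\<^bsub>Gs i\<^esub> h" unfolding h_def c_def using comm i closed[OF _ i] * by blast
      then have hcp: "c [^]\<^bsub>Gs i\<^esub> k \<otimes>\<^bsub>Gs i\<^esub> h = h \<otimes>\<^bsub>Gs i\<^esub> c [^]\<^bsub>Gs i\<^esub> k" for k :: nat
        using hc by (intro Gi.group_commutes_pow) simp_all
      obtain k where k: "E = e i * k" using assms(1) i dvd_prodI[of I i e] unfolding E_def by blast
      have "(commutator ?P u v [^]\<^bsub>?P\<^esub> E) i = c [^]\<^bsub>Gs i\<^esub> k"
        using * i closed[OF _ i] unfolding c_def k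
        by (simp del: mult_product_group carrier_product_group add: pr Gi.nat_pow_pow)
      moreover have "(g [^]\<^bsub>?P\<^esub> (p - 1)) i = h"
        using * i unfolding h_def by (simp del: mult_product_group carrier_product_group add: pr)
      ultimately show "(g [^]\<^bsub>?P\<^esub> (p - 1) \<otimes>\<^bsub>?P\<^esub> commutator ?P u v [^]\<^bsub>?P\<^esub> E) i =
          (commutator ?P u v [^]\<^bsub>?P\<^esub> E \<otimes>\<^bsub>?P\<^esub> g [^]\<^bsub>?P\<^esub> (p - 1)) i"
        using * i hcp by (simp del: mult_product_group carrier_product_group add: pr)
    qed (use * in \<open>simp_all del: mult_product_group carrier_product_group\<close>)
    ultimately show "\<exists>e. \<not> p dvd e \<and> (\<forall>g\<in>carrier ?P. \<forall>u\<in>carrier ?P. \<forall>v\<in>carrier ?P.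
        g [^]\<^bsub>?P\<^esub> (p - 1) \<otimes>\<^bsub>?P\<^esub> commutator ?P u v [^]\<^bsub>?P\<^esub> e =
        commutator ?P u v [^]\<^bsub>?P\<^esub> e \<otimes>\<^bsub>?P\<^esub> g [^]\<^bsub>?P\<^esub> (p - 1))" by blast
  qed
qed

lemma pseudovariety_affine_laws: "pseudovariety {G \<in> finite_groups. affine_laws G}"
  unfolding pseudovariety_def
proof (intro conjI ballI allI impI)
  fix G :: "nat monoid" and H assume "G \<in> {G \<in> finite_groups. affine_laws G}" "subgroup H G"
  then show "G\<lparr>carrier := H\<rparr> \<in> {G \<in> finite_groups. affine_laws G}"
    using affine_laws_subgroup[of G H] subgroup.subset[of H G]
    by (auto simp: finite_groups_def subgroup.subgroup_is_group finite_subset)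
next
  fix G K :: "nat monoid" assume "G \<in> {G \<in> finite_groups. affine_laws G}" "K \<in> finite_groups"
    "\<exists>f\<in>hom G K. f ` carrier G = carrier K"
  then show "K \<in> {G \<in> finite_groups. affine_laws G}"
    using affine_laws_hom_image[of G K] by (auto simp: finite_groups_def)
next
  fix I :: "nat set" and Gs and K :: "nat monoid"
  assume K: "K \<in> finite_groups"
    and *: "finite I \<and> (\<forall>i\<in>I. Gs i \<in> {G \<in> finite_groups. affine_laws G}) \<and> K \<cong> product_group I Gs"
  have P: "group (product_group I Gs)" "affine_laws (product_group I Gs)"
    using * by (auto intro!: affine_laws_product simp: finite_groups_def)
  have Kg: "group K" using K by (simp add: finite_groups_def)
  obtain f where "f \<in> iso (product_group I Gs) K"
    using * group.iso_sym[OF Kg] by (auto simp: is_iso_def)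
  then show "K \<in> {G \<in> finite_groups. affine_laws G}"
    using affine_laws_hom_image[OF P(1) Kg _ _ P(2), of f] K by (auto simp: iso_def bij_betw_def)
qed auto

lemma (in group) commutator_eq_one:
  assumes "u \<in> carrier G" "v \<in> carrier G" "u \<otimes> v = v \<otimes> u"
  shows "commutator G u v = \<one>"
proof -
  have "commutator G u v = (v \<otimes> u) \<otimes> inv u \<otimes> inv v" by (simp add: commutator_def assms(3))
  also have "\<dots> = \<one>" using assms(1,2) by (simp add: group_normalize)
  finally show ?thesis .
qed

lemma in_pv_Ab:
  assumes "group G" "in_pv G (Ab n)" "x \<in> carrier G"
  shows "x [^]\<^bsub>G\<^esub> n = \<one>\<^bsub>G\<^esub>" and "y \<in> carrier G \<Longrightarrow> x \<otimes>\<^bsub>G\<^esub> y = y \<otimes>\<^bsub>G\<^esub> x"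
proof -
  obtain K f where K: "K \<in> Ab n" "f \<in> iso G K" using assms by (auto simp: in_pv_def is_iso_def)
  then have "group K" by (auto simp: Ab_def finite_groups_def)
  then interpret f: group_hom G K f using K assms(1) by (simp add: group_hom_def group_hom_axioms_def iso_def)
  have inj: "inj_on f (carrier G)" using K by (simp add: iso_def bij_betw_def)
  interpret K: comm_group K using K by (simp add: Ab_def)
  show "x [^]\<^bsub>G\<^esub> n = \<one>\<^bsub>G\<^esub>"
    by (rule inj_onD[OF inj]) (use K assms(3) in \<open>simp_all add: f.hom_nat_pow Ab_def\<close>)
  show "x \<otimes>\<^bsub>G\<^esub> y = y \<otimes>\<^bsub>G\<^esub> x" if "y \<in> carrier G"
    using inj assms(3) that K.m_comm[of "f x" "f y"] by (auto intro: inj_onD)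
qed

text \<open>
  For the prime \<open>p\<close> itself the exponent is \<open>1\<close>, as commutators and \<open>(p - 1)\<close>-st powers lie in an abelian normal
  subgroup. For every other prime the exponent is \<open>p\<close>, which kills all commutators.
\<close>

lemma affine_laws_Ab_prod_Ab:
  assumes "prime p" "G \<in> pv_prod (Ab p) (Ab (p - 1))"
  shows "affine_laws G"
proof -
  obtain N where G: "group G" and N: "N \<lhd> G" "in_pv (G\<lparr>carrier := N\<rparr>) (Ab p)" "in_pv (G Mod N) (Ab (p - 1))"
    using assms by (auto simp: pv_prod_def finite_groups_def)
  interpret N: normal N G by (rule N(1))
  have NG: "group (G\<lparr>carrier := N\<rparr>)" by (rule N.subgroup_is_group[OF G])
  interpret q: group_hom G "G Mod N" "\<lambda>x. N #>\<^bsub>G\<^esub> x"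
    using N.r_coset_hom_Mod N.factorgroup_is_group by (simp add: group_hom_def group_hom_axioms_def N.is_group)
  have inN: "x \<in> N" if "x \<in> carrier G" "N #>\<^bsub>G\<^esub> x = \<one>\<^bsub>G Mod N\<^esub>" for x
    using that N.rcos_self[OF that(1) N.subgroup_axioms] by simp
  have comm: "x \<otimes>\<^bsub>G\<^esub> y = y \<otimes>\<^bsub>G\<^esub> x" if "x \<in> N" "y \<in> N" for x y
    using in_pv_Ab(2)[OF NG N(2), of x y] that by simp
  have expo: "x [^]\<^bsub>G\<^esub> p = \<one>\<^bsub>G\<^esub>" if "x \<in> N" for x
    using in_pv_Ab(1)[OF NG N(2), of x] that N.nat_pow_consistent[of x p N] by simp
  have cN: "commutator G u v \<in> N" if "u \<in> carrier G" "v \<in> carrier G" for u v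
  proof (rule inN)
    show "commutator G u v \<in> carrier G" using that by simp
    have c: "(N #>\<^bsub>G\<^esub> u) \<in> carrier (G Mod N)" "(N #>\<^bsub>G\<^esub> v) \<in> carrier (G Mod N)" using that by (simp_all del: mult_FactGroup)
    show "N #>\<^bsub>G\<^esub> commutator G u v = \<one>\<^bsub>G Mod N\<^esub>"
      unfolding q.hom_commutator[OF that]
      by (rule q.H.commutator_eq_one[OF c in_pv_Ab(2)[OF N.factorgroup_is_group N(3) c]])
  qed
  have pN: "g [^]\<^bsub>G\<^esub> (p - 1) \<in> N" if "g \<in> carrier G" for g
    using that in_pv_Ab(1)[OF N.factorgroup_is_group N(3) q.hom_closed[OF that]]
    by (intro inN) (simp_all del: one_FactGroup add: q.hom_nat_pow)
  have powN: "c [^]\<^bsub>G\<^esub> (k::nat) \<in> N" if "c \<in> N" for c k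
    by (induction k) (use that in auto)
  have "\<exists>e::nat. \<not> q dvd e \<and> (\<forall>g\<in>carrier G. \<forall>u\<in>carrier G. \<forall>v\<in>carrier G.
      g [^]\<^bsub>G\<^esub> (q - 1) \<otimes>\<^bsub>G\<^esub> commutator G u v [^]\<^bsub>G\<^esub> e = commutator G u v [^]\<^bsub>G\<^esub> e \<otimes>\<^bsub>G\<^esub> g [^]\<^bsub>G\<^esub> (q - 1))"
    if q: "prime q" for q :: nat
  proof (cases "q = p")
    case True
    have "\<not> q dvd 1" using q by (metis not_prime_unit)
    then show ?thesis unfolding True
      by (intro exI[of _ "1::nat"] conjI ballI comm pN powN cN)
  next
    case False
    then have "\<not> q dvd p" using q assms(1) by (metis primes_dvd_imp_eq)
    then show ?thesis using cN expo by (intro exI[of _ p]) simp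
  qed
  then show ?thesis unfolding affine_laws_def using comm cN by blast
qed

lemma affine_laws_U_pv: "G \<in> U_pv \<Longrightarrow> group G \<and> finite (carrier G) \<and> affine_laws G"
proof -
  have "U_pv \<subseteq> {G \<in> finite_groups. affine_laws G}"
    unfolding U_pv_def pv_join_def
    using pseudovariety_affine_laws affine_laws_Ab_prod_Ab by (intro Inter_lower) (auto simp: pv_prod_def)
  then show "G \<in> U_pv \<Longrightarrow> group G \<and> finite (carrier G) \<and> affine_laws G"
    by (auto simp: finite_groups_def)
qed

section \<open>Affine actions of words\<close>

text \<open>
  The letter \<open>x\<^sub>i\<close> acts on a commutative ring by \<open>t \<mapsto> a\<^sub>i t + d\<^sub>i\<close>, and its inverse by
  \<open>t \<mapsto> b\<^sub>i (t - d\<^sub>i)\<close>, which is the inverse map when \<open>b\<^sub>i\<close> is the inverse of \<open>a\<^sub>i\<close>.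
\<close>

fun act :: "(nat \<Rightarrow> 'r::comm_ring_1) \<Rightarrow> (nat \<Rightarrow> 'r) \<Rightarrow> (nat \<Rightarrow> 'r) \<Rightarrow> word \<Rightarrow> 'r \<Rightarrow> 'r" where
  "act a b d [] t = t"
| "act a b d (l # w) t =
     (if snd l then a (fst l) * act a b d w t + d (fst l) else b (fst l) * (act a b d w t - d (fst l)))"

text \<open>
  An affine action over the field with \<open>p\<close> elements which witnesses that \<open>ws\<close> does not generate a dense subgroup:
  all words fix zero, and some generator does not.
\<close>

definition fixed_point :: "nat \<Rightarrow> nat \<Rightarrow> word list \<Rightarrow> (nat \<Rightarrow> int) \<Rightarrow> (nat \<Rightarrow> int) \<Rightarrow> (nat \<Rightarrow> int) \<Rightarrow> bool" where
  "fixed_point p n ws a b d \<longleftrightarrow>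
     (\<forall>i<n. [a i * b i = 1] (mod int p)) \<and> (\<exists>i<n. \<not> int p dvd d i) \<and>
     (\<forall>w\<in>set ws. int p dvd act a b d w 0)"

definition obstructed :: "nat \<Rightarrow> nat \<Rightarrow> word list \<Rightarrow> bool" where
  "obstructed p n ws \<longleftrightarrow> prime p \<and> (\<exists>a b d. fixed_point p n ws a b d)"

lemma act_zero: "(\<And>i. i \<in> fst ` set w \<Longrightarrow> m dvd d i) \<Longrightarrow> m dvd act a b d w (0::int)"
  by (induction w) auto

lemma free_group_simps:
  "carrier (free_group n) = {w. reduced w \<and> fst ` set w \<subseteq> {..<n}}"
  "u \<otimes>\<^bsub>free_group n\<^esub> v = reduce (u @ v)" "\<one>\<^bsub>free_group n\<^esub> = []"
  by (simp_all add: free_group_def)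

lemma free_group_letter: "i < n \<Longrightarrow> [(i, s)] \<in> carrier (free_group n)"
  by (simp add: free_group_simps reduced_Cons)

lemma free_group_inv_letter:
  assumes "i < n" shows "inv\<^bsub>free_group n\<^esub> [(i, s)] = [(i, \<not> s)]"
proof -
  interpret group "free_group n" by (rule group_free_group)
  have "[(i, \<not> s)] \<otimes>\<^bsub>free_group n\<^esub> [(i, s)] = \<one>\<^bsub>free_group n\<^esub>"
    by (simp add: free_group_simps reduce_def cons_reduce_def inv_letter_def)
  then show ?thesis using inv_equality free_group_letter assms by blast
qed

text \<open>
  The universal property: a map defined letter by letter is a homomorphism as soon as the values
  of opposite letters are inverse to each other.
\<close>

lemma free_group_hom:
  assumes K: "group K" and closed: "\<And>l. fst l < n \<Longrightarrow> g l \<in> carrier K"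
    and inv: "\<And>l. fst l < n \<Longrightarrow> g (inv_letter l) \<otimes>\<^bsub>K\<^esub> g l = \<one>\<^bsub>K\<^esub>"
  shows "(\<lambda>w. foldr (\<lambda>l k. g l \<otimes>\<^bsub>K\<^esub> k) w \<one>\<^bsub>K\<^esub>) \<in> hom (free_group n) K"
proof -
  interpret K: group K by (rule K)
  define f where "f w k = foldr (\<lambda>l k. g l \<otimes>\<^bsub>K\<^esub> k) w k" for w k
  have f_closed: "f w k \<in> carrier K" if "fst ` set w \<subseteq> {..<n}" "k \<in> carrier K" for w k
    using that by (induction w) (auto simp: f_def closed)
  have f_mult: "f w k = f w \<one>\<^bsub>K\<^esub> \<otimes>\<^bsub>K\<^esub> k" if "fst ` set w \<subseteq> {..<n}" "k \<in> carrier K" for w k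
    using that
  proof (induction w)
    case (Cons l w)
    then show ?case using f_closed[of w "\<one>\<^bsub>K\<^esub>"] closed[of l] by (simp add: f_def K.m_assoc)
  qed (simp add: f_def)
  have f_cons: "f (cons_reduce l w) \<one>\<^bsub>K\<^esub> = g l \<otimes>\<^bsub>K\<^esub> f w \<one>\<^bsub>K\<^esub>" if "fst l < n" "fst ` set w \<subseteq> {..<n}" for l w
  proof (cases "w \<noteq> [] \<and> hd w = inv_letter l")
    case True
    then obtain v where v: "w = inv_letter l # v" by (cases w) auto
    have "g l \<otimes>\<^bsub>K\<^esub> g (inv_letter l) = \<one>\<^bsub>K\<^esub>" using inv[of "inv_letter l"] that by simp
    then have "f v \<one>\<^bsub>K\<^esub> = g l \<otimes>\<^bsub>K\<^esub> (g (inv_letter l) \<otimes>\<^bsub>K\<^esub> f v \<one>\<^bsub>K\<^esub>)"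
      using that v f_closed[of v "\<one>\<^bsub>K\<^esub>"] closed[of l] closed[of "inv_letter l"]
      by (simp flip: K.m_assoc)
    then show ?thesis using v by (simp add: cons_reduce_def f_def)
  qed (auto simp: cons_reduce_def f_def)
  have f_reduce: "f (reduce w) \<one>\<^bsub>K\<^esub> = f w \<one>\<^bsub>K\<^esub>" if "fst ` set w \<subseteq> {..<n}" for w
    using that
  proof (induction w)
    case (Cons l w)
    have "reduce (l # w) = cons_reduce l (reduce w)" by (simp add: reduce_def)
    moreover have "fst ` set (reduce w) \<subseteq> {..<n}" using Cons.prems fst_set_reduce[of w] by auto
    ultimately show ?case using Cons f_cons[of l "reduce w"] by (simp add: f_def)
  qed (simp add: reduce_def)
  have "f (u @ v) \<one>\<^bsub>K\<^esub> = f u \<one>\<^bsub>K\<^esub> \<otimes>\<^bsub>K\<^esub> f v \<one>\<^bsub>K\<^esub>"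
    if "fst ` set u \<subseteq> {..<n}" "fst ` set v \<subseteq> {..<n}" for u v
    using f_mult[OF that(1) f_closed[OF that(2)]] by (simp add: f_def)
  then show ?thesis
    unfolding f_def[symmetric] by (auto simp: hom_def free_group_simps f_reduce f_closed image_Un)
qed

section \<open>The affine group of a prime field\<close>

text \<open>
  The group of maps \<open>t \<mapsto> a t + d\<close> with \<open>a \<noteq> 0\<close>, encoded by numbers because the members of the
  pseudovariety are groups of numbers.
\<close>

definition affine_group :: "nat \<Rightarrow> nat monoid" where
  "affine_group p =
     \<lparr>carrier = prod_encode ` ({0<..<p} \<times> {..<p}),
      monoid.mult = \<lambda>u v. prod_encode (fst (prod_decode u) * fst (prod_decode v) mod p,
        (fst (prod_decode u) * snd (prod_decode v) + snd (prod_decode u)) mod p),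
      one = prod_encode (1, 0)\<rparr>"

definition unit_group :: "nat \<Rightarrow> nat monoid" where
  "unit_group p = \<lparr>carrier = {0<..<p}, monoid.mult = \<lambda>u v. u * v mod p, one = 1\<rparr>"

lemma mod_prime_pos:
  fixes a b p :: nat
  assumes "prime p" "0 < a" "a < p" "0 < b" "b < p" shows "0 < a * b mod p"
proof -
  have "\<not> p dvd a" "\<not> p dvd b" using assms by (auto dest: dvd_imp_le)
  then have "\<not> p dvd a * b" using assms by (simp add: prime_dvd_mult_iff)
  then show ?thesis by (simp add: mod_greater_zero_iff_not_dvd)
qed

lemma ex_inverse_mod_prime:
  fixes a p :: nat
  assumes "prime p" "0 < a" "a < p" obtains b where "0 < b" "b < p" "b * a mod p = 1"
proof -
  have "\<not> p dvd a" using assms by (auto dest: dvd_imp_le)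
  then have "coprime a p" using assms by (metis coprime_commute prime_imp_coprime)
  then obtain c where "[a * c = 1] (mod p)" using cong_solve_coprime_nat by auto
  then have c: "(c mod p) * a mod p = 1"
    using prime_gt_1_nat[OF assms(1)] by (simp add: cong_def mod_simps mult.commute)
  moreover have "c mod p \<noteq> 0" using c by (metis mod_0 mult_zero_left zero_neq_one)
  ultimately show ?thesis using assms by (intro that[of "c mod p"]) (auto simp: prime_gt_0_nat)
qed

lemma group_affine_group:
  assumes p: "prime p" shows "group (affine_group p)"
proof (rule groupI)
  have "1 < p" using prime_gt_1_nat[OF p] .
  then show "\<one>\<^bsub>affine_group p\<^esub> \<in> carrier (affine_group p)" by (auto simp: affine_group_def)
  show "x \<otimes>\<^bsub>affine_group p\<^esub> y \<in> carrier (affine_group p)"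
    if "x \<in> carrier (affine_group p)" "y \<in> carrier (affine_group p)" for x y
    using that \<open>1 < p\<close> mod_prime_pos[OF p] by (auto simp: affine_group_def intro!: imageI)
  show "x \<otimes>\<^bsub>affine_group p\<^esub> y \<otimes>\<^bsub>affine_group p\<^esub> z = x \<otimes>\<^bsub>affine_group p\<^esub> (y \<otimes>\<^bsub>affine_group p\<^esub> z)" for x y z
  proof -
    have "(a * a' mod p * d'' + (a * d' + d) mod p) mod p = (a * ((a' * d'' + d') mod p) + d) mod p"
      for a a' d d' d'' :: nat
    proof -
      have "(a * a' mod p * d'' + (a * d' + d) mod p) mod p = (a * a' * d'' + (a * d' + d)) mod p"
        unfolding cong_def[symmetric] by (intro cong_add cong_mult) (simp_all add: cong_def)
      also have "a * a' * d'' + (a * d' + d) = a * (a' * d'' + d') + d" by (simp add: algebra_simps)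
      also have "\<dots> mod p = (a * ((a' * d'' + d') mod p) + d) mod p" 
        unfolding cong_def[symmetric] by (intro cong_add cong_mult) (simp_all add: cong_def)
      finally show ?thesis .
    qed
    then show ?thesis by (simp add: affine_group_def mod_mult_left_eq mod_mult_right_eq mult.assoc)
  qed
  show "\<one>\<^bsub>affine_group p\<^esub> \<otimes>\<^bsub>affine_group p\<^esub> x = x" if "x \<in> carrier (affine_group p)" for x
    using that by (auto simp: affine_group_def)
  show "\<exists>y\<in>carrier (affine_group p). y \<otimes>\<^bsub>affine_group p\<^esub> x = \<one>\<^bsub>affine_group p\<^esub>"
    if x: "x \<in> carrier (affine_group p)" for x
  proof -
    obtain a d where ad: "x = prod_encode (a, d)" "0 < a" "a < p" "d < p" using x by (auto simp: affine_group_def)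
    obtain b where b: "0 < b" "b < p" "b * a mod p = 1" by (rule ex_inverse_mod_prime[OF p ad(2,3)])
    define e where "e = (p - b * d mod p) mod p"
    have "(b * d + e) mod p = (b * d mod p + (p - b * d mod p)) mod p"
      unfolding e_def by (simp add: mod_simps)
    also have "\<dots> = 0" using \<open>1 < p\<close> by simp
    finally have "prod_encode (b, e) \<otimes>\<^bsub>affine_group p\<^esub> x = \<one>\<^bsub>affine_group p\<^esub>"
      using b by (simp add: affine_group_def ad)
    moreover have "prod_encode (b, e) \<in> carrier (affine_group p)"
      using b \<open>1 < p\<close> by (auto simp: affine_group_def e_def)
    ultimately show ?thesis by blast
  qed
qed

lemma comm_group_unit_group:
  assumes p: "prime p" shows "comm_group (unit_group p)"
proof (rule comm_groupI)
  have "1 < p" using prime_gt_1_nat[OF p] .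
  then show "\<one>\<^bsub>unit_group p\<^esub> \<in> carrier (unit_group p)" by (auto simp: unit_group_def)
  show "x \<otimes>\<^bsub>unit_group p\<^esub> y \<in> carrier (unit_group p)"
    if "x \<in> carrier (unit_group p)" "y \<in> carrier (unit_group p)" for x y
    using that \<open>1 < p\<close> mod_prime_pos[OF p] by (auto simp: unit_group_def)
  show "\<exists>y\<in>carrier (unit_group p). y \<otimes>\<^bsub>unit_group p\<^esub> x = \<one>\<^bsub>unit_group p\<^esub>"
    if "x \<in> carrier (unit_group p)" for x
    using that ex_inverse_mod_prime[OF p, of x] by (force simp: unit_group_def)
qed (auto simp: unit_group_def mod_simps algebra_simps)

text \<open>
  The translations are a normal subgroup of order \<open>p\<close>, and the quotient is the group of units, whose exponent divides
  \<open>p - 1\<close> by Fermat's theorem.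
\<close>

lemma affine_group_in_U_pv:
  assumes p: "prime p" shows "affine_group p \<in> U_pv"
proof -
  let ?A = "affine_group p" and ?U = "unit_group p"
  have p1: "1 < p" using prime_gt_1_nat[OF p] .
  interpret A: group ?A by (rule group_affine_group[OF p])
  interpret U: comm_group ?U by (rule comm_group_unit_group[OF p])
  define h where "h u = fst (prod_decode u)" for u
  have hom: "h \<in> hom ?A ?U"
    by (auto simp: hom_def h_def affine_group_def unit_group_def)
  interpret h: group_hom ?A ?U h
    using hom by (simp add: group_hom_def group_hom_axioms_def A.is_group U.is_group)
  define N where "N = kernel ?A ?U h"
  have N: "N = {prod_encode (1, d) |d. d < p}"
    using p1 by (auto simp: N_def kernel_def h_def affine_group_def unit_group_def)
  have fin: "?A \<in> finite_groups" by (simp add: finite_groups_def A.is_group) (simp add: affine_group_def)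
  have norm: "N \<lhd> ?A" unfolding N_def by (rule h.normal_kernel)
  have subg: "subgroup N ?A" unfolding N_def by (rule h.subgroup_kernel)
  have "?A\<lparr>carrier := N\<rparr> \<in> Ab p"
  proof -
    have g: "group (?A\<lparr>carrier := N\<rparr>)" by (rule A.subgroup_imp_group[OF subg])
    have "finite N" unfolding N by simp
    moreover have "comm_group (?A\<lparr>carrier := N\<rparr>)"
      by (rule group.group_comm_groupI[OF g]) (auto simp: N affine_group_def add.commute)
    moreover have "prod_encode (1, d) [^]\<^bsub>?A\<lparr>carrier := N\<rparr>\<^esub> k = prod_encode (1, k * d mod p)"
      if "d < p" for d and k :: nat
      by (induction k) (use p1 in \<open>auto simp: affine_group_def mod_simps algebra_simps\<close>)
    ultimately show ?thesis using g
      by (auto simp: Ab_def finite_groups_def N) (auto simp: affine_group_def)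
  qed
  then have 1: "in_pv (?A\<lparr>carrier := N\<rparr>) (Ab p)"
    unfolding in_pv_def using iso_refl by blast
  have "h ` carrier ?A = carrier ?U"
  proof
    show "carrier ?U \<subseteq> h ` carrier ?A"
    proof
      fix u assume "u \<in> carrier ?U"
      then have "prod_encode (u, 0) \<in> carrier ?A" "u = h (prod_encode (u, 0))"
        by (auto simp: affine_group_def unit_group_def h_def)
      then show "u \<in> h ` carrier ?A" by blast
    qed
  qed auto
  then have "(?A Mod N) \<cong> ?U" unfolding N_def by (rule h.FactGroup_iso)
  moreover have "?U \<in> Ab (p - 1)"
  proof -
    have pow: "u [^]\<^bsub>?U\<^esub> k = u ^ k mod p" if "u \<in> carrier ?U" for u k :: nat
      by (induction k) (use that p1 in \<open>auto simp: unit_group_def mod_simps mult.commute\<close>)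
    have "u ^ (p - 1) mod p = 1" if "u \<in> carrier ?U" for u
    proof -
      have "\<not> p dvd u" using that by (auto simp: unit_group_def dest: dvd_imp_le)
      then show ?thesis using fermat_theorem[OF p] p1 by (simp add: cong_def)
    qed
    then show ?thesis using pow U.comm_group_axioms U.is_group
      by (auto simp: Ab_def finite_groups_def) (auto simp: unit_group_def)
  qed
  ultimately have "in_pv (?A Mod N) (Ab (p - 1))" unfolding in_pv_def by blast
  with 1 fin norm have "?A \<in> pv_prod (Ab p) (Ab (p - 1))" unfolding pv_prod_def by blast
  then show ?thesis using p unfolding U_pv_def pv_join_def by blast
qed

section \<open>Density and fixed points\<close>

text \<open>
  The action is a homomorphism to the affine group. Its kernel is open, the stabiliser of zero
  contains \<open>H\<close>, and the coset of the kernel that contains a generator moving zero is disjoint from \<open>H\<close>.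
\<close>

lemma not_dense_if_obstructed:
  assumes obs: "obstructed p n ws" and ws: "set ws \<subseteq> carrier (free_group n)"
  shows "\<not> pro_dense U_pv (free_group n) (generate (free_group n) (set ws))"
proof -
  let ?F = "free_group n" and ?A = "affine_group p"
  obtain a b d where p: "prime p" and fp: "fixed_point p n ws a b d"
    using obs by (auto simp: obstructed_def)
  have ab: "[a i * b i = 1] (mod int p)" if "i < n" for i using fp that by (simp add: fixed_point_def)
  have d: "\<exists>i<n. \<not> int p dvd d i" using fp by (simp add: fixed_point_def)
  have fix0: "int p dvd act a b d w 0" if "w \<in> set ws" for w using fp that by (simp add: fixed_point_def)
  have p1: "1 < p" using prime_gt_1_nat[OF p] .
  interpret F: group ?F by (rule group_free_group)
  interpret A: group ?A by (rule group_affine_group[OF p])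
  define enc where "enc s t = prod_encode (nat (s mod int p), nat (t mod int p))" for s t :: int
  have nat_mult: "nat (s mod int p) * nat (t mod int p) mod p = nat (s * t mod int p)" for s t
  proof -
    have "int (nat (s mod int p) * nat (t mod int p) mod p) = int (nat (s * t mod int p))"
      using p1 by (simp add: zmod_int mod_simps)
    then show ?thesis by (simp only: of_nat_eq_iff)
  qed
  have nat_add: "(nat (s mod int p) * nat (t mod int p) + nat (u mod int p)) mod p = nat ((s * t + u) mod int p)" for s t u
  proof -
    have "(s mod int p * (t mod int p) + u mod int p) mod int p = (s * t + u) mod int p"
      unfolding cong_def[symmetric] by (intro cong_add cong_mult) (simp_all add: cong_def)
    then have "int ((nat (s mod int p) * nat (t mod int p) + nat (u mod int p)) mod p) = int (nat ((s * t + u) mod int p))"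
      using p1 by (simp add: zmod_int)
    then show ?thesis by (simp only: of_nat_eq_iff)
  qed
  have enc_mult: "enc s t \<otimes>\<^bsub>?A\<^esub> enc s' t' = enc (s * s') (s * t' + t)" for s t s' t'
    using nat_mult nat_add by (simp add: enc_def affine_group_def)
  have enc_one: "enc 1 0 = \<one>\<^bsub>?A\<^esub>" using p1 by (simp add: enc_def affine_group_def)
  have enc_cong: "enc s t = enc s' t'" if "[s = s'] (mod int p)" "[t = t'] (mod int p)" for s t s' t'
    using that by (simp add: enc_def cong_def)
  have enc_closed: "enc s t \<in> carrier ?A" if "\<not> int p dvd s" for s t
  proof -
    have b: "0 \<le> s mod int p" "s mod int p < int p" "0 \<le> t mod int p" "t mod int p < int p"
      using p1 by simp_all
    moreover have "s mod int p \<noteq> 0" using that by (simp add: dvd_eq_mod_eq_0)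
    ultimately have "0 < s mod int p" by linarith
    with b have "0 < s mod int p" "s mod int p < int p" "0 \<le> t mod int p" "t mod int p < int p" by auto
    then show ?thesis by (auto simp: enc_def affine_group_def nat_less_iff intro!: imageI)
  qed
  define g where "g l = (if snd l then enc (a (fst l)) (d (fst l)) else enc (b (fst l)) (- b (fst l) * d (fst l)))" for l
  have nd: "\<not> int p dvd a i" "\<not> int p dvd b i" if "i < n" for i
  proof -
    have "\<not> int p dvd a i * b i" using cong_dvd_iff[OF ab[OF that]] p1 by simp
    then show "\<not> int p dvd a i" "\<not> int p dvd b i" by auto
  qed
  define f where "f w = foldr (\<lambda>l k. g l \<otimes>\<^bsub>?A\<^esub> k) w \<one>\<^bsub>?A\<^esub>" for w
  have hom: "f \<in> hom ?F ?A" unfolding f_def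
  proof (rule free_group_hom[OF A.is_group])
    show "g l \<in> carrier ?A" if "fst l < n" for l using nd[OF that] by (auto simp: g_def intro: enc_closed)
    show "g (inv_letter l) \<otimes>\<^bsub>?A\<^esub> g l = \<one>\<^bsub>?A\<^esub>" if "fst l < n" for l
    proof (cases "snd l")
      case True
      then show ?thesis unfolding enc_one[symmetric] g_def
        using ab[OF that] by (simp add: inv_letter_def enc_mult) (intro enc_cong; simp add: mult.commute)
    next
      case False
      have "[a (fst l) * b (fst l) * d (fst l) = 1 * d (fst l)] (mod int p)"
        by (intro cong_mult ab[OF that] cong_refl)
      then have "[- (a (fst l) * (b (fst l) * d (fst l))) + d (fst l) = 0] (mod int p)"
        using cong_diff[OF cong_refl[of "d (fst l)"]] by (fastforce simp: algebra_simps)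
      with False show ?thesis unfolding enc_one[symmetric] g_def
        using ab[OF that] by (simp add: inv_letter_def enc_mult) (intro enc_cong; simp)
    qed
  qed
  have f_act: "\<exists>s. f w = enc s (act a b d w 0)" for w
  proof (induction w)
    case Nil
    then show ?case by (intro exI[of _ 1]) (simp add: f_def enc_one)
  next
    case (Cons l w)
    then obtain s where s: "f w = enc s (act a b d w 0)" by blast
    have "f (l # w) = g l \<otimes>\<^bsub>?A\<^esub> f w" by (simp add: f_def)
    then show ?case unfolding s g_def
      by (cases "snd l") (auto simp: enc_mult algebra_simps)
  qed
  interpret f: group_hom ?F ?A f
    using hom by (simp add: group_hom_def group_hom_axioms_def F.is_group A.is_group)
  \<comment> \<open>The stabiliser of zero.\<close>
  define S where "S = {prod_encode (u, 0) |u. 0 < u \<and> u < p}"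
  have S: "subgroup S ?A"
  proof (rule A.subgroupI)
    show "S \<subseteq> carrier ?A" using p1 by (auto simp: S_def affine_group_def)
    have "prod_encode (1, 0) \<in> S" using p1 by (auto simp: S_def)
    then show "S \<noteq> {}" by blast
  next
    fix x assume "x \<in> S"
    then obtain u where u: "x = prod_encode (u, 0)" "0 < u" "u < p" by (auto simp: S_def)
    obtain v where v: "0 < v" "v < p" "v * u mod p = 1" by (rule ex_inverse_mod_prime[OF p u(2,3)])
    have "prod_encode (v, 0) \<otimes>\<^bsub>?A\<^esub> x = \<one>\<^bsub>?A\<^esub>" using v by (simp add: u affine_group_def)
    then have "inv\<^bsub>?A\<^esub> x = prod_encode (v, 0)" using u v by (intro A.inv_equality) (auto simp: affine_group_def)
    then show "inv\<^bsub>?A\<^esub> x \<in> S" using v by (auto simp: S_def)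
  next
    fix x y assume "x \<in> S" "y \<in> S"
    then show "x \<otimes>\<^bsub>?A\<^esub> y \<in> S" using mod_prime_pos[OF p] p1 by (auto simp: S_def affine_group_def)
  qed
  have in_S: "f h \<in> S" if "h \<in> generate ?F (set ws)" for h
    using that
  proof (induction rule: generate.induct)
    case one
    then show ?case using subgroup.one_closed[OF S] by simp
  next
    have base: "f w \<in> S" if w: "w \<in> set ws" for w
    proof -
      obtain s where s: "f w = enc s (act a b d w 0)" using f_act by blast
      have "snd (prod_decode (f w)) = 0" using fix0[OF w] unfolding s by (auto simp: enc_def)
      moreover have "f w \<in> carrier ?A" using w ws by (intro f.hom_closed) auto
      ultimately show ?thesis by (auto simp: S_def affine_group_def)
    qed
    { case (incl h) then show ?case by (rule base) }
    { case (inv h)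
      then have "f (inv\<^bsub>?F\<^esub> h) = inv\<^bsub>?A\<^esub> f h" using ws by (intro f.hom_inv) auto
      then show ?case using subgroup.m_inv_closed[OF S base[OF inv]] by simp }
  next
    case (eng h1 h2)
    have "h1 \<in> carrier ?F" "h2 \<in> carrier ?F" using eng(1,2) F.generate_in_carrier[OF ws] by auto
    then show ?case using eng subgroup.m_closed[OF S] by simp
  qed
  obtain i where i: "i < n" "\<not> int p dvd d i" using d by blast
  define x where "x = [(i, True)]"
  have x: "x \<in> carrier ?F" unfolding x_def by (rule free_group_letter[OF i(1)])
  have "f x = enc (a i) (d i)"
    by (simp add: f_def x_def g_def enc_one[symmetric] enc_mult)
  then have "snd (prod_decode (f x)) = nat (d i mod int p)" by (simp add: enc_def)
  moreover have "d i mod int p \<noteq> 0" "0 \<le> d i mod int p" using i(2) p1 by (simp_all add: dvd_eq_mod_eq_0)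
  ultimately have "snd (prod_decode (f x)) \<noteq> 0" by linarith
  then have fx: "f x \<notin> S" by (auto simp: S_def)
  define O' where "O' = {y \<in> carrier ?F. f y \<in> {f x}}"
  have "openin (pro_topology U_pv ?F) O'"
    unfolding pro_topology_def openin_topology_generated_by_iff O'_def
  proof (rule generate_topology_on.Basis, rule CollectI, intro exI conjI)
    show "{y \<in> carrier ?F. f y \<in> {f x}} = {y \<in> carrier ?F. f y \<in> {f x}}" ..
    show "affine_group p \<in> U_pv" by (rule affine_group_in_U_pv[OF p])
    show "f \<in> hom ?F ?A" by (rule hom)
    show "{f x} \<subseteq> carrier ?A" using f.hom_closed[OF x] by simp
  qed
  moreover have "x \<in> O'" using x by (simp add: O'_def)
  moreover have "y \<notin> O'" if "y \<in> generate ?F (set ws)" for y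
    using in_S[OF that] fx by (auto simp: O'_def)
  ultimately have "x \<notin> pro_topology U_pv ?F closure_of generate ?F (set ws)"
    unfolding in_closure_of by blast
  then show ?thesis using x unfolding pro_dense_def by blast
qed

definition agree :: "(('a \<Rightarrow> 'b) \<times> 'c) list \<Rightarrow> 'a \<Rightarrow> 'a \<Rightarrow> bool" where
  "agree L x y \<longleftrightarrow> (\<forall>p\<in>set L. fst p y = fst p x)"

lemma agree_append: "agree (L @ M) x y \<longleftrightarrow> agree L x y \<and> agree M x y"
  unfolding agree_def set_append ball_Un by (rule refl)

text \<open>
  A neighbourhood of \<open>x\<close> contains all elements with the same image as \<open>x\<close> under finitely many
  homomorphisms to groups of the pseudovariety.
\<close>

lemma pro_topology_nbhd:
  assumes "openin (pro_topology V G) T" "x \<in> T"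
  shows "\<exists>L. (\<forall>p\<in>set L. snd p \<in> V \<and> fst p \<in> hom G (snd p)) \<and> {y \<in> carrier G. agree L x y} \<subseteq> T"
  using assms unfolding pro_topology_def openin_topology_generated_by_iff
proof (induction arbitrary: x rule: generate_topology_on.induct)
  case (Int S T)
  have "x \<in> S" "x \<in> T" using Int.prems by auto
  from Int.IH(1)[OF this(1)] obtain L where L: "\<forall>p\<in>set L. snd p \<in> V \<and> fst p \<in> hom G (snd p)"
    "{y \<in> carrier G. agree L x y} \<subseteq> S" by (elim exE conjE) (rule that)
  from Int.IH(2)[OF \<open>x \<in> T\<close>] obtain M where M: "\<forall>p\<in>set M. snd p \<in> V \<and> fst p \<in> hom G (snd p)"
    "{y \<in> carrier G. agree M x y} \<subseteq> T" by (elim exE conjE) (rule that)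
  show ?case
  proof (intro exI[of _ "L @ M"] conjI)
    show "\<forall>p\<in>set (L @ M). snd p \<in> V \<and> fst p \<in> hom G (snd p)" using L(1) M(1) by (simp add: ball_Un)
    show "{y \<in> carrier G. agree (L @ M) x y} \<subseteq> S \<inter> T"
    proof
      fix y assume "y \<in> {y \<in> carrier G. agree (L @ M) x y}"
      then show "y \<in> S \<inter> T" using L(2) M(2) by (auto simp: agree_append)
    qed
  qed
next
  case (UN \<T>)
  then obtain T where T: "T \<in> \<T>" "x \<in> T" by blast
  from UN.IH[OF this] obtain L where "\<forall>p\<in>set L. snd p \<in> V \<and> fst p \<in> hom G (snd p)"
    "{y \<in> carrier G. agree L x y} \<subseteq> T" by (elim exE conjE) (rule that)
  moreover have "T \<subseteq> \<Union>\<T>" using T(1) by (rule Union_upper)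
  ultimately show ?case by (metis (no_types, lifting) order_trans)
next
  case (Basis T)
  then obtain f K S where "T = {x \<in> carrier G. f x \<in> S}" "K \<in> V" "f \<in> hom G K" by blast
  with Basis show ?case by (intro exI[of _ "[(f, K)]"]) (auto simp: agree_def)
qed auto

lemma topspace_pro_topology:
  assumes "K \<in> V" "group K" shows "topspace (pro_topology V G) = carrier G"
proof -
  have "(\<lambda>_. \<one>\<^bsub>K\<^esub>) \<in> hom G K" using assms(2) by (auto simp: hom_def group.is_monoid)
  then have "{x \<in> carrier G. (\<lambda>_. \<one>\<^bsub>K\<^esub>) x \<in> carrier K} \<in>
      {{x \<in> carrier G. f x \<in> S} | f K S. K \<in> V \<and> f \<in> hom G K \<and> S \<subseteq> carrier K}" (is "?X \<in> ?\<S>")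
    using assms(1) by blast
  then have "?X \<subseteq> \<Union>?\<S>" by (rule Union_upper)
  moreover have "?X = carrier G" using group.is_monoid[OF assms(2)] monoid.one_closed by auto
  moreover have "\<Union>?\<S> \<subseteq> carrier G" by (rule Union_least) blast
  ultimately show ?thesis unfolding pro_topology_def topology_generated_by_topspace by blast
qed

text \<open>
  A point outside the closure of \<open>H\<close> is separated from \<open>H\<close> by finitely many homomorphisms to members of
  the pseudovariety, hence by one homomorphism to their product \<open>P\<close>. The preimage \<open>B\<close> of the image of \<open>H\<close> is
  a proper subgroup of the free group, to which the theorem on affine actions applies. The product is a group of
  functions, and not itself a member of the pseudovariety; only its laws are used.
\<close>

lemma obstructed_if_not_dense:
  assumes ws: "set ws \<subseteq> carrier (free_group n)"
    and nd: "\<not> pro_dense U_pv (free_group n) (generate (free_group n) (set ws))"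
  shows "\<exists>p. obstructed p n ws"
proof -
  let ?F = "free_group n"
  define H where "H = generate ?F (set ws)"
  interpret F: group ?F by (rule group_free_group)
  have H: "subgroup H ?F" unfolding H_def by (rule F.generate_is_subgroup[OF ws])
  have top: "topspace (pro_topology U_pv ?F) = carrier ?F"
    by (rule topspace_pro_topology[OF affine_group_in_U_pv[OF two_is_prime_nat] group_affine_group[OF two_is_prime_nat]])
  obtain x T where x: "x \<in> carrier ?F" "openin (pro_topology U_pv ?F) T" "x \<in> T" "T \<inter> H = {}"
  proof -
    have "pro_topology U_pv ?F closure_of H \<subseteq> carrier ?F" using closure_of_subset_topspace top by metis
    then obtain x where "x \<in> carrier ?F" "x \<notin> pro_topology U_pv ?F closure_of H"
      using nd unfolding pro_dense_def H_def by blast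
    then show ?thesis using that top unfolding in_closure_of by blast
  qed
  obtain L where L: "\<forall>p\<in>set L. snd p \<in> U_pv \<and> fst p \<in> hom ?F (snd p)"
    and LT: "{y \<in> carrier ?F. agree L x y} \<subseteq> T"
    using pro_topology_nbhd[OF x(2,3)] by blast
  define I where "I = {..<length L}"
  define P where "P = product_group I (\<lambda>i. snd (L ! i))"
  define \<phi> where "\<phi> y = (\<lambda>i\<in>I. fst (L ! i) y)" for y
  have Li: "group (snd (L ! i))" "finite (carrier (snd (L ! i)))" "affine_laws (snd (L ! i))"
    "fst (L ! i) \<in> hom ?F (snd (L ! i))" if "i \<in> I" for i
    using bspec[OF L, of "L ! i"] affine_laws_U_pv[of "snd (L ! i)"] that by (auto simp: I_def)
  have I: "finite I" by (simp add: I_def)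
  have P: "group P" "affine_laws P" unfolding P_def
    by (rule product_group[OF Li(1)], assumption) (rule affine_laws_product[OF I Li(1) Li(3)])
  have Pfin: "finite (carrier P)" unfolding P_def carrier_product_group
    by (intro finite_PiE I Li)
  have \<phi>: "\<phi> \<in> hom ?F P" unfolding P_def
  proof (intro homI)
    have c: "fst (L ! i) y \<in> carrier (snd (L ! i))" if "i \<in> I" "y \<in> carrier ?F" for i y
      using Li(4)[OF that(1)] that(2) by (auto simp: hom_def)
    have m: "fst (L ! i) (y \<otimes>\<^bsub>?F\<^esub> z) = fst (L ! i) y \<otimes>\<^bsub>snd (L ! i)\<^esub> fst (L ! i) z"
      if "i \<in> I" "y \<in> carrier ?F" "z \<in> carrier ?F" for i y z
      using Li(4)[OF that(1)] that(2,3) by (auto simp: hom_def)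
    show "\<phi> y \<in> carrier (product_group I (\<lambda>i. snd (L ! i)))" if "y \<in> carrier ?F" for y
      using c that by (auto simp: \<phi>_def)
    show "\<phi> (y \<otimes>\<^bsub>?F\<^esub> z) = \<phi> y \<otimes>\<^bsub>product_group I (\<lambda>i. snd (L ! i))\<^esub> \<phi> z"
      if "y \<in> carrier ?F" "z \<in> carrier ?F" for y z
      using m that by (auto simp: \<phi>_def)
  qed
  interpret \<phi>: group_hom ?F P \<phi>
    by (intro group_hom.intro group_hom_axioms.intro F.is_group P \<phi>)
  define B where "B = {y \<in> carrier ?F. \<phi> y \<in> \<phi> ` H}"
  have Hc: "h \<in> carrier ?F" if "h \<in> H" for h using that subgroup.subset[OF H] by blast
  have B: "subgroup B ?F"
  proof (rule F.subgroupI)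
    show "B \<subseteq> carrier ?F" by (auto simp: B_def)
    show "B \<noteq> {}" using subgroup.one_closed[OF H] by (auto simp: B_def)
  next
    fix y assume "y \<in> B"
    then obtain h where h: "y \<in> carrier ?F" "h \<in> H" "\<phi> y = \<phi> h" by (auto simp: B_def)
    then have "\<phi> (inv\<^bsub>?F\<^esub> y) = \<phi> (inv\<^bsub>?F\<^esub> h)" using Hc by simp
    then show "inv\<^bsub>?F\<^esub> y \<in> B" using h subgroup.m_inv_closed[OF H] by (auto simp: B_def)
  next
    fix y z assume "y \<in> B" "z \<in> B"
    then obtain h k where h: "y \<in> carrier ?F" "h \<in> H" "\<phi> y = \<phi> h" "z \<in> carrier ?F" "k \<in> H" "\<phi> z = \<phi> k"
      by (auto simp: B_def)
    then have "\<phi> (y \<otimes>\<^bsub>?F\<^esub> z) = \<phi> (h \<otimes>\<^bsub>?F\<^esub> k)" using Hc by simp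
    then show "y \<otimes>\<^bsub>?F\<^esub> z \<in> B" using h subgroup.m_closed[OF H] F.m_closed by (auto simp: B_def)
  qed
  have HB: "H \<subseteq> B" using Hc by (auto simp: B_def)
  have "x \<notin> B"
  proof
    assume "x \<in> B"
    then obtain h where h: "h \<in> H" "\<phi> x = \<phi> h" by (auto simp: B_def)
    have "fst p h = fst p x" if p: "p \<in> set L" for p
    proof -
      obtain i where i: "i < length L" "p = L ! i" using p by (auto simp: in_set_conv_nth)
      then show ?thesis using fun_cong[OF h(2), of i] by (simp add: \<phi>_def I_def)
    qed
    then have "agree L x h" by (simp add: agree_def)
    then have "h \<in> T" using LT Hc[OF h(1)] by blast
    then show False using x h by blast
  qed
  then have Bne: "B \<noteq> carrier ?F" using x by blast
  have ker: "g \<in> B" if "g \<in> carrier ?F" "\<phi> g = \<one>\<^bsub>P\<^esub>" for g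
    using that subgroup.one_closed[OF H] \<phi>.hom_one by (auto simp: B_def intro!: image_eqI[of _ _ "\<one>\<^bsub>?F\<^esub>"])
  have lt: "[(i, True)] \<in> carrier ?F" if "i < n" for i by (rule free_group_letter[OF that])
  obtain p \<delta> a b d where p: "prime p"
    and ab: "\<And>i. i < n \<Longrightarrow> [a i * b i = 1] (mod int p)"
    and \<delta>: "\<And>i h. i < n \<Longrightarrow> h \<in> carrier ?F \<Longrightarrow> [\<delta> ([(i, True)] \<otimes>\<^bsub>?F\<^esub> h) = a i * \<delta> h + d i] (mod int p)"
    and \<delta>B: "\<And>h. h \<in> B \<Longrightarrow> [\<delta> h = 0] (mod int p)" and \<delta>1: "\<exists>g\<in>carrier ?F. \<not> int p dvd \<delta> g"
    by (rule F.ex_affine_action[OF P(1) Pfin P(2) \<phi> B Bne ker lt]) (assumption | rule that)+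
  \<comment> \<open>The recursion for \<open>\<delta>\<close> at a generator determines its value at the inverse of that generator.\<close>
  have act: "[act a b d w 0 = \<delta> w] (mod int p)" if "w \<in> carrier ?F" for w
    using that
  proof (induction w)
    case Nil
    then show ?case using \<delta>B[OF subgroup.one_closed[OF B]] by (simp add: free_group_simps cong_sym)
  next
    case (Cons l w)
    obtain i s where l: "l = (i, s)" by (cases l)
    have i: "i < n" and w: "w \<in> carrier ?F" using Cons.prems by (auto simp: l free_group_simps reduced_Cons)
    have lw: "[(i, s)] \<otimes>\<^bsub>?F\<^esub> w = l # w" using Cons.prems by (simp add: l free_group_simps reduce_reduced)
    note IH = Cons.IH[OF w]
    show ?case
    proof (cases s)
      case True
      have "[act a b d (l # w) 0 = a i * \<delta> w + d i] (mod int p)"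
        using True l IH by (simp add: cong_add cong_scalar_left)
      also have "[a i * \<delta> w + d i = \<delta> (l # w)] (mod int p)"
        using \<delta>[OF i w] lw True by (simp add: cong_sym)
      finally show ?thesis .
    next
      case False
      have "inv\<^bsub>?F\<^esub> [(i, True)] \<otimes>\<^bsub>?F\<^esub> w = l # w" using lw False free_group_inv_letter[OF i, of True] by simp
      then have "[(i, True)] \<otimes>\<^bsub>?F\<^esub> (l # w) = w" using F.mult_inv_cancel[OF lt[OF i] w] by simp
      then have d: "[\<delta> w = a i * \<delta> (l # w) + d i] (mod int p)" using \<delta>[OF i Cons.prems] by simp
      have "act a b d (l # w) 0 = b i * (act a b d w 0 - d i)" using False l by simp
      also have "[\<dots> = b i * (a i * \<delta> (l # w) + d i - d i)] (mod int p)"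
        by (intro cong_scalar_left cong_diff cong_trans[OF IH d] cong_refl)
      also have "b i * (a i * \<delta> (l # w) + d i - d i) = (a i * b i) * \<delta> (l # w)" by simp
      also have "[(a i * b i) * \<delta> (l # w) = 1 * \<delta> (l # w)] (mod int p)"
        by (intro cong_mult ab[OF i] cong_refl)
      finally show ?thesis by simp
    qed
  qed
  have "\<exists>i<n. \<not> int p dvd d i"
  proof (rule ccontr)
    assume *: "\<not> ?thesis"
    obtain g where g: "g \<in> carrier ?F" "\<not> int p dvd \<delta> g" using \<delta>1 by blast
    have "int p dvd act a b d g 0"
      by (rule act_zero) (use * g(1) in \<open>auto simp: free_group_simps\<close>)
    then show False using act[OF g(1)] g(2) cong_dvd_iff by blast
  qed
  moreover have "int p dvd act a b d w 0" if "w \<in> set ws" for w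
  proof -
    have "w \<in> B" using that HB generate.incl[of w "set ws"] by (auto simp: H_def)
    then have "[act a b d w 0 = 0] (mod int p)" using act[of w] \<delta>B[of w] that ws by (blast intro: cong_trans)
    then show ?thesis by (simp add: cong_0_iff)
  qed
  ultimately have "fixed_point p n ws a b d" using ab by (simp add: fixed_point_def)
  then have "obstructed p n ws" using p unfolding obstructed_def by blast
  then show ?thesis ..
qed

theorem dense_iff_not_obstructed:
  assumes "set ws \<subseteq> carrier (free_group n)"
  shows "pro_dense U_pv (free_group n) (generate (free_group n) (set ws)) \<longleftrightarrow> (\<forall>p. \<not> obstructed p n ws)"
proof
  assume "pro_dense U_pv (free_group n) (generate (free_group n) (set ws))"
  then show "\<forall>p. \<not> obstructed p n ws" using not_dense_if_obstructed[OF _ assms] by (intro allI notI) auto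
next
  assume "\<forall>p. \<not> obstructed p n ws"
  then show "pro_dense U_pv (free_group n) (generate (free_group n) (set ws))"
    using obstructed_if_not_dense[OF assms] by metis
qed

section \<open>Polynomials with coefficients in a subring\<close>

definition subring_set :: "'a::comm_ring_1 set \<Rightarrow> bool" where
  "subring_set S \<longleftrightarrow> 0 \<in> S \<and> 1 \<in> S \<and> (\<forall>x\<in>S. \<forall>y\<in>S. x + y \<in> S \<and> x - y \<in> S \<and> x * y \<in> S)"

definition over :: "'a::zero set \<Rightarrow> 'a poly \<Rightarrow> bool" where
  "over S p \<longleftrightarrow> (\<forall>i. coeff p i \<in> S)"

context
  fixes S :: "'a::comm_ring_1 set"
  assumes S: "subring_set S"
begin

lemma subring_zero: "0 \<in> S" and subring_one: "1 \<in> S"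
  and subring_add: "x \<in> S \<Longrightarrow> y \<in> S \<Longrightarrow> x + y \<in> S"
  and subring_diff: "x \<in> S \<Longrightarrow> y \<in> S \<Longrightarrow> x - y \<in> S"
  and subring_mult: "x \<in> S \<Longrightarrow> y \<in> S \<Longrightarrow> x * y \<in> S"
  using S by (auto simp: subring_set_def)

lemma subring_sum: "(\<And>i. i \<in> I \<Longrightarrow> f i \<in> S) \<Longrightarrow> sum f I \<in> S"
  by (induction I rule: infinite_finite_induct) (auto intro: subring_zero subring_add)

lemma subring_power: "x \<in> S \<Longrightarrow> x ^ k \<in> S"
  by (induction k) (auto intro: subring_one subring_mult)

lemma over_0: "over S 0" and over_const: "c \<in> S \<Longrightarrow> over S [:c:]"
  and over_add: "over S p \<Longrightarrow> over S q \<Longrightarrow> over S (p + q)"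
  and over_diff: "over S p \<Longrightarrow> over S q \<Longrightarrow> over S (p - q)"
  and over_mult: "over S p \<Longrightarrow> over S q \<Longrightarrow> over S (p * q)"
  and over_smult: "c \<in> S \<Longrightarrow> over S p \<Longrightarrow> over S (smult c p)"
  and over_monom: "c \<in> S \<Longrightarrow> over S (monom c k)"
  and over_pCons: "c \<in> S \<Longrightarrow> over S p \<Longrightarrow> over S (pCons c p)"
  by (auto simp: over_def coeff_mult coeff_pCons split: nat.split
      intro: subring_zero subring_add subring_diff subring_mult subring_sum)

lemma over_poly: "over S p \<Longrightarrow> x \<in> S \<Longrightarrow> poly p x \<in> S"
  unfolding poly_altdef over_def by (intro subring_sum subring_mult subring_power) auto

text \<open>
  Division with remainder by a polynomial whose leading coefficient need not be a unit. The bound on the degree of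
  the quotient is needed when a minimal equation is divided by a polynomial of smaller degree.
\<close>

lemma pseudo_division:
  assumes F: "over S F" "degree F > 0" and p: "over S p"
  shows "\<exists>k q r. over S q \<and> over S r \<and> smult (lead_coeff F ^ k) p = q * F + r \<and>
    degree r < degree F \<and> (q = 0 \<or> degree q + degree F \<le> degree p)"
  using p
proof (induction "degree p" arbitrary: p rule: less_induct)
  case less
  show ?case
  proof (cases "degree p < degree F")
    case True
    then show ?thesis using less.prems by (intro exI[of _ 0] exI[of _ p]) (auto intro: over_0)
  next
    case False
    define t where "t = monom (lead_coeff p) (degree p - degree F)"
    define p1 where "p1 = smult (lead_coeff F) p - t * F"
    have t: "over S t" "degree t \<le> degree p - degree F" unfolding t_def
      using less.prems by (intro over_monom degree_monom_le; simp add: over_def)+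
    have p1: "over S p1" unfolding p1_def using less.prems F t
      by (intro over_diff over_smult over_mult) (auto simp: over_def)
    have "degree p1 \<le> degree p" unfolding p1_def
      using degree_mult_le[of t F] t(2) False by (intro degree_diff_le) (auto intro: degree_smult_le order_trans)
    moreover have "coeff p1 (degree p) = 0" unfolding p1_def t_def using False
      by (simp add: coeff_monom_mult)
    ultimately have "degree p1 < degree p \<or> p1 = 0" by (metis eq_zero_or_degree_less)
    then have "degree p1 < degree p" using False F(2) by auto
    from less.hyps[OF this p1] obtain k q r where *: "over S q" "over S r"
      "smult (lead_coeff F ^ k) p1 = q * F + r" "degree r < degree F" "q = 0 \<or> degree q + degree F \<le> degree p1"
      by blast
    define q' where "q' = q + smult (lead_coeff F ^ k) t"
    have "smult (lead_coeff F ^ Suc k) p = smult (lead_coeff F ^ k) p1 + smult (lead_coeff F ^ k) t * F"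
      by (simp add: p1_def smult_diff_right mult.commute)
    also have "\<dots> = q' * F + r" by (simp add: * q'_def algebra_simps)
    finally have eq: "smult (lead_coeff F ^ Suc k) p = q' * F + r" .
    have "over S q'" unfolding q'_def using * t F
      by (intro over_add over_smult subring_power) (auto simp: over_def)
    moreover have "degree q' \<le> degree p - degree F" unfolding q'_def
      using *(5) t(2) \<open>degree p1 \<le> degree p\<close>
      by (intro degree_add_le) (auto intro: order_trans[OF degree_smult_le])
    ultimately show ?thesis using eq * False by (intro exI[of _ "Suc k"] exI[of _ q'] exI[of _ r]) auto
  qed
qed

end

lemma subring_set_UNIV: "subring_set UNIV" by (simp add: subring_set_def)

lemma over_UNIV: "over UNIV p" by (simp add: over_def)

lemma subring_set_Rats: "subring_set (\<rat> :: complex set)"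
  by (auto simp: subring_set_def)

section \<open>Number fields\<close>

definition num_field :: "complex \<Rightarrow> complex set" where
  "num_field \<theta> = {poly p \<theta> |p. over \<rat> p}"

lemma num_fieldI: "over \<rat> p \<Longrightarrow> poly p \<theta> \<in> num_field \<theta>"
  by (auto simp: num_field_def)

lemma subring_set_num_field: "subring_set (num_field \<theta>)"
  unfolding subring_set_def
proof (intro conjI ballI)
  show "0 \<in> num_field \<theta>" "1 \<in> num_field \<theta>"
    using num_fieldI[of 0 \<theta>] num_fieldI[of "[:1:]" \<theta>] over_0[OF subring_set_Rats] over_const[OF subring_set_Rats, of 1]
    by auto
  fix x y assume "x \<in> num_field \<theta>" "y \<in> num_field \<theta>"
  then obtain p q where "over \<rat> p" "x = poly p \<theta>" "over \<rat> q" "y = poly q \<theta>" by (auto simp: num_field_def)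
  then show "x + y \<in> num_field \<theta>" "x - y \<in> num_field \<theta>" "x * y \<in> num_field \<theta>"
    using num_fieldI[of "p + q" \<theta>] num_fieldI[of "p - q" \<theta>] num_fieldI[of "p * q" \<theta>]
      over_add[OF subring_set_Rats] over_diff[OF subring_set_Rats] over_mult[OF subring_set_Rats] by auto
qed

lemma Rats_num_field: "q \<in> \<rat> \<Longrightarrow> q \<in> num_field \<theta>"
  using num_fieldI[of "[:q:]" \<theta>] over_const[OF subring_set_Rats] by simp

lemma self_num_field: "\<theta> \<in> num_field \<theta>"
  using num_fieldI[of "[:0, 1:]" \<theta>] by (simp add: over_def coeff_pCons split: nat.split)

lemma num_field_mono:
  assumes "\<theta> \<in> num_field \<eta>" shows "num_field \<theta> \<subseteq> num_field \<eta>"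
proof
  fix z assume "z \<in> num_field \<theta>"
  then obtain p where "over \<rat> p" "z = poly p \<theta>" by (auto simp: num_field_def)
  then show "z \<in> num_field \<eta>"
    using over_poly[OF subring_set_num_field _ assms, of p] Rats_num_field by (auto simp: over_def)
qed

lemma algebraic_iff_over: "algebraic (z :: complex) \<longleftrightarrow> (\<exists>p. over \<rat> p \<and> p \<noteq> 0 \<and> poly p z = 0)"
  by (simp add: algebraic_altdef over_def conj_assoc)

lemma vector_space_rat: "vector_space (\<lambda>(q::rat) (z::complex). of_rat q * z)"
  by standard (auto simp: algebra_simps of_rat_add of_rat_mult)

interpretation rat_vec: vector_space "\<lambda>(q::rat) (z::complex). of_rat q * z"
  by (rule vector_space_rat)

text \<open>
  If multiplication by \<open>z\<close> preserves a space of finite dimension containing \<open>1\<close>, then the powers of \<open>z\<close> are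
  linearly dependent, or two of them coincide.
\<close>

lemma algebraic_of_finite_span:
  assumes "finite B" and closed: "\<And>v. v \<in> rat_vec.span B \<Longrightarrow> z * v \<in> rat_vec.span B"
    and one: "1 \<in> rat_vec.span B"
  shows "algebraic z"
proof -
  have pow: "z ^ k \<in> rat_vec.span B" for k
    by (induction k) (use one closed in auto)
  show ?thesis
  proof (cases "inj (\<lambda>k::nat. z ^ k)")
    case False
    then obtain i j where ij: "i \<noteq> j" "z ^ i = z ^ j" by (auto simp: inj_def)
    then have "coeff (monom 1 i - monom 1 j) i \<noteq> (0 :: complex)" by simp
    then have "monom 1 i - monom 1 j \<noteq> (0 :: complex poly)" by (metis coeff_0)
    moreover have "poly (monom 1 i - monom 1 j) z = 0" using ij by (simp add: poly_monom)
    ultimately show ?thesis by (intro algebraicI'[of "monom 1 i - monom 1 j"]) auto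
  next
    case True
    let ?S = "(\<lambda>k. z ^ k) ` {..card B}"
    have inj: "inj_on (\<lambda>k. z ^ k) {..card B}" using True by (rule inj_on_subset) simp
    have "rat_vec.dependent ?S"
    proof (rule ccontr)
      assume "\<not> rat_vec.dependent ?S"
      then have "card ?S \<le> card B" using pow assms(1) by (intro conjunct2[OF rat_vec.independent_span_bound]) auto
      then show False using card_image[OF inj] by simp
    qed
    then obtain u where u: "\<exists>x\<in>?S. u x \<noteq> 0" "(\<Sum>x\<in>?S. of_rat (u x) * x) = 0"
      using rat_vec.dependent_finite[of ?S] by auto
    define p where "p = (\<Sum>k\<le>card B. monom (of_rat (u (z ^ k)) :: complex) k)"
    have coeff: "coeff p k = (if k \<le> card B then of_rat (u (z ^ k)) else 0)" for k
      by (simp add: p_def coeff_sum coeff_monom)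
    have "poly p z = (\<Sum>k\<le>card B. of_rat (u (z ^ k)) * z ^ k)"
      by (simp add: p_def poly_sum poly_monom)
    also have "\<dots> = 0" using u(2)[unfolded sum.reindex[OF inj]] by (simp add: o_def)
    finally have "poly p z = 0" .
    moreover have "p \<noteq> 0"
    proof -
      obtain k where "k \<le> card B" "u (z ^ k) \<noteq> 0" using u(1) by auto
      then have "coeff p k \<noteq> 0" by (simp add: coeff)
      then show ?thesis by auto
    qed
    moreover have "coeff p k \<in> \<rat>" for k by (simp add: coeff)
    ultimately show ?thesis by (intro algebraicI')
  qed
qed

text \<open>By this equation, the powers of \<open>v\<close> below the degree of \<open>g\<close> span all powers.\<close>

lemma poly_root_power:
  fixes v :: complex
  assumes "poly g v = 0" "g \<noteq> 0" "degree g \<le> j"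
  shows "v ^ j = (\<Sum>k<degree g. - (coeff g k / lead_coeff g) * v ^ (j - degree g + k))"
proof -
  have "0 = v ^ (j - degree g) * poly g v" using assms by simp
  also have "\<dots> = (\<Sum>k\<le>degree g. coeff g k * v ^ (j - degree g + k))"
    by (simp add: poly_altdef sum_distrib_left power_add algebra_simps)
  also have "\<dots> = (\<Sum>k<degree g. coeff g k * v ^ (j - degree g + k)) + lead_coeff g * v ^ j"
    using assms(3) by (simp flip: lessThan_Suc_atMost)
  finally have "v ^ j = - (\<Sum>k<degree g. coeff g k * v ^ (j - degree g + k)) / lead_coeff g"
    using assms(2) by (simp add: field_simps eq_neg_iff_add_eq_0)
  then show ?thesis by (simp add: sum_negf sum_divide_distrib)
qed

lemma num_field_algebraic:
  assumes \<theta>: "algebraic \<theta>" and z: "z \<in> num_field \<theta>" shows "algebraic z"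
proof -
  obtain f where f: "over \<rat> f" "f \<noteq> 0" "poly f \<theta> = 0" using \<theta> by (auto simp: algebraic_iff_over)
  define B where "B = (\<lambda>i. \<theta> ^ i) ` {..<degree f}"
  have pow: "\<theta> ^ i \<in> rat_vec.span B" for i
  proof (induction i rule: less_induct)
    case (less i)
    show ?case
    proof (cases "i < degree f")
      case True
      then show ?thesis by (auto simp: B_def intro: rat_vec.span_base)
    next
      case False
      have "- (coeff f k / lead_coeff f) * \<theta> ^ (i - degree f + k) \<in> rat_vec.span B" if "k < degree f" for k
      proof -
        have "- (coeff f k / lead_coeff f) \<in> \<rat>" using f(1) by (auto simp: over_def)
        then obtain q where q: "- (coeff f k / lead_coeff f) = of_rat q" by (rule Rats_cases)
        show ?thesis unfolding q using False that by (intro rat_vec.span_scale less) simp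
      qed
      then show ?thesis using poly_root_power[OF f(3,2), of i] False
        by (simp del: minus_divide_left) (intro rat_vec.span_sum, auto)
    qed
  qed
  have eq: "num_field \<theta> \<subseteq> rat_vec.span B"
  proof
    fix y assume "y \<in> num_field \<theta>"
    then obtain p where p: "over \<rat> p" "y = poly p \<theta>" by (auto simp: num_field_def)
    have "coeff p i * \<theta> ^ i \<in> rat_vec.span B" for i
    proof -
      obtain q where q: "coeff p i = of_rat q" using p(1) by (auto simp: over_def elim: Rats_cases)
      show ?thesis unfolding q by (intro rat_vec.span_scale pow)
    qed
    then show "y \<in> rat_vec.span B" unfolding p(2) poly_altdef by (intro rat_vec.span_sum)
  qed
  have sub: "rat_vec.span B \<subseteq> num_field \<theta>"
  proof (rule rat_vec.span_minimal)
    show "B \<subseteq> num_field \<theta>" unfolding B_def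
      using subring_power[OF subring_set_num_field self_num_field] by blast
    show "rat_vec.subspace (num_field \<theta>)" unfolding rat_vec.subspace_def
      using subring_set_num_field[of \<theta>] Rats_num_field by (auto simp: subring_set_def)
  qed
  show ?thesis
  proof (rule algebraic_of_finite_span[of B])
    show "finite B" by (simp add: B_def)
    show "1 \<in> rat_vec.span B" using pow[of 0] by simp
    show "z * v \<in> rat_vec.span B" if "v \<in> rat_vec.span B" for v
      using subring_mult[OF subring_set_num_field z] that sub eq by blast
  qed
qed

text \<open>
  The equation of \<open>z\<close> with nonzero constant term \<open>c\<close> reads \<open>z q(z) = - c\<close>.
\<close>

lemma num_field_inverse:
  assumes "algebraic \<theta>" "z \<in> num_field \<theta>" shows "inverse z \<in> num_field \<theta>"
proof (cases "z = 0")
  case True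
  then show ?thesis using subring_zero[OF subring_set_num_field] by simp
next
  case False
  obtain p' :: "int poly" where p': "coeff p' 0 \<noteq> 0" "poly (map_poly of_int p') z = 0"
    using algebraicE'_nonzero[OF num_field_algebraic[OF assms] False] by blast
  define p :: "complex poly" where "p = map_poly of_int p'"
  have p: "\<And>i. coeff p i \<in> \<rat>" "coeff p 0 \<noteq> 0" "poly p z = 0"
    using p' by (simp_all add: p_def coeff_map_poly)
  obtain c q where pq: "p = pCons c q" by (cases p)
  then have c: "c \<noteq> 0" "c + z * poly q z = 0" using p by auto
  have "over \<rat> q" unfolding over_def using p(1) pq coeff_pCons_Suc by metis
  then have "poly q z \<in> num_field \<theta>"
    using over_poly[OF subring_set_num_field _ assms(2), of q] Rats_num_field by (auto simp: over_def)
  moreover have "- inverse c \<in> \<rat>" using p(1)[of 0] pq by simp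
  then have "- inverse c \<in> num_field \<theta>" by (rule Rats_num_field)
  ultimately have "- inverse c * poly q z \<in> num_field \<theta>"
    by (intro subring_mult[OF subring_set_num_field])
  moreover have "inverse z = - inverse c * poly q z"
  proof -
    have "z * poly q z = - c" using c(2) by (simp add: add_eq_0_iff)
    then have "poly q z = - c * inverse z" using False by (simp add: field_simps)
    then show ?thesis using c(1) by simp
  qed
  ultimately show ?thesis by simp
qed

text \<open>
  The products of low powers of \<open>\<theta>\<close> and \<open>v\<close> span a space that is closed under multiplication by \<open>\<theta>\<close>
  and by \<open>v\<close>.
\<close>

lemma algebraic_adjoin:
  assumes \<theta>: "algebraic \<theta>" and g: "over (num_field \<theta>) g" "g \<noteq> 0" "poly g v = 0"
  shows "algebraic (\<theta> + of_nat c * v)" "algebraic v"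
proof -
  obtain f where f: "over \<rat> f" "f \<noteq> 0" "poly f \<theta> = 0" using \<theta> by (auto simp: algebraic_iff_over)
  define B where "B = (\<lambda>(i, j). \<theta> ^ i * v ^ j) ` ({..<degree f} \<times> {..<degree g})"
  have low: "\<theta> ^ i * v ^ j \<in> rat_vec.span B" if "j < degree g" for i j
  proof (induction i rule: less_induct)
    case (less i)
    show ?case
    proof (cases "i < degree f")
      case True
      then show ?thesis using that by (auto simp: B_def intro!: rat_vec.span_base)
    next
      case False
      have "- (coeff f k / lead_coeff f) * (\<theta> ^ (i - degree f + k) * v ^ j) \<in> rat_vec.span B" if "k < degree f" for k
      proof -
        have "- (coeff f k / lead_coeff f) \<in> \<rat>" using f(1) by (auto simp: over_def)
        then obtain q where q: "- (coeff f k / lead_coeff f) = of_rat q" by (rule Rats_cases)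
        show ?thesis unfolding q using False that by (intro rat_vec.span_scale less) simp
      qed
      then have "(\<Sum>k<degree f. - (coeff f k / lead_coeff f) * (\<theta> ^ (i - degree f + k) * v ^ j)) \<in> rat_vec.span B"
        by (intro rat_vec.span_sum) auto
      also have "(\<Sum>k<degree f. - (coeff f k / lead_coeff f) * (\<theta> ^ (i - degree f + k) * v ^ j)) = \<theta> ^ i * v ^ j"
        using False by (subst poly_root_power[OF f(3,2), of i]) (simp_all add: sum_distrib_right mult.assoc del: minus_divide_left)
      finally show ?thesis .
    qed
  qed
  have coef: "z * v ^ j \<in> rat_vec.span B"
    if z: "z \<in> num_field \<theta>" and IH: "\<And>i. \<theta> ^ i * v ^ j \<in> rat_vec.span B" for z j
  proof -
    obtain p where p: "over \<rat> p" "z = poly p \<theta>" using z by (auto simp: num_field_def)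
    have "coeff p i * (\<theta> ^ i * v ^ j) \<in> rat_vec.span B" for i
    proof -
      obtain q where q: "coeff p i = of_rat q" using p(1) by (auto simp: over_def elim: Rats_cases)
      show ?thesis unfolding q by (intro rat_vec.span_scale IH)
    qed
    then have "(\<Sum>i\<le>degree p. coeff p i * (\<theta> ^ i * v ^ j)) \<in> rat_vec.span B" by (intro rat_vec.span_sum)
    then show ?thesis by (simp add: p(2) poly_altdef sum_distrib_right mult.assoc)
  qed
  have all: "\<theta> ^ i * v ^ j \<in> rat_vec.span B" for i j
  proof (induction j arbitrary: i rule: less_induct)
    case (less j)
    show ?case
    proof (cases "j < degree g")
      case True
      then show ?thesis by (rule low)
    next
      case False
      have "\<theta> ^ i * - (coeff g k / lead_coeff g) * v ^ (j - degree g + k) \<in> rat_vec.span B" if "k < degree g" for k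
      proof (rule coef)
        have "- 1 \<in> num_field \<theta>" by (intro Rats_num_field) auto
        moreover have "coeff g k \<in> num_field \<theta>" "inverse (lead_coeff g) \<in> num_field \<theta>"
          using g(1) num_field_inverse[OF \<theta>] by (auto simp: over_def)
        ultimately have "\<theta> ^ i * (- 1 * (coeff g k * inverse (lead_coeff g))) \<in> num_field \<theta>"
          by (intro subring_mult[OF subring_set_num_field] subring_power[OF subring_set_num_field] self_num_field)
        then show "\<theta> ^ i * - (coeff g k / lead_coeff g) \<in> num_field \<theta>" by (simp add: divide_inverse)
        show "\<theta> ^ i' * v ^ (j - degree g + k) \<in> rat_vec.span B" for i'
          using less[of "j - degree g + k"] False that by simp
      qed
      then have "(\<Sum>k<degree g. \<theta> ^ i * - (coeff g k / lead_coeff g) * v ^ (j - degree g + k)) \<in> rat_vec.span B"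
        by (intro rat_vec.span_sum) auto
      also have "(\<Sum>k<degree g. \<theta> ^ i * - (coeff g k / lead_coeff g) * v ^ (j - degree g + k)) = \<theta> ^ i * v ^ j"
        using False by (subst poly_root_power[OF g(3,2), of j]) (simp_all add: sum_distrib_left mult.assoc del: minus_divide_left)
      finally show ?thesis .
    qed
  qed
  have fin: "finite B" by (simp add: B_def)
  have one: "1 \<in> rat_vec.span B" using all[of 0 0] by simp
  have mult: "y * w \<in> rat_vec.span B"
    if w: "w \<in> rat_vec.span B" and y: "\<And>i j. y * (\<theta> ^ i * v ^ j) \<in> rat_vec.span B" for y w
    using w
  proof (induction rule: rat_vec.span_induct_alt)
    case base
    then show ?case using rat_vec.span_zero by simp
  next
    case (step q x w)
    then have "of_rat q * (y * x) + y * w \<in> rat_vec.span B"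
      using y by (intro rat_vec.span_add rat_vec.span_scale) (auto simp: B_def)
    then show ?case by (simp add: algebra_simps)
  qed
  have mv: "v * (\<theta> ^ i * v ^ j) \<in> rat_vec.span B" for i j using all[of i "Suc j"] by (simp add: algebra_simps)
  have m\<theta>: "\<theta> * (\<theta> ^ i * v ^ j) \<in> rat_vec.span B" for i j using all[of "Suc i" j] by (simp add: algebra_simps)
  have "(\<theta> + of_nat c * v) * (\<theta> ^ i * v ^ j) \<in> rat_vec.span B" for i j
  proof -
    have "\<theta> * (\<theta> ^ i * v ^ j) + of_rat (of_nat c) * (v * (\<theta> ^ i * v ^ j)) \<in> rat_vec.span B"
      by (intro rat_vec.span_add rat_vec.span_scale mv m\<theta>)
    then show ?thesis by (simp add: algebra_simps)
  qed
  then show "algebraic (\<theta> + of_nat c * v)" by (intro algebraic_of_finite_span[OF fin mult one])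
  show "algebraic v" by (intro algebraic_of_finite_span[OF fin mult one] mv)
qed

lemma ex_minimal_degree:
  assumes "P q" obtains p where "P p" "\<And>q. P q \<Longrightarrow> degree p \<le> degree q"
  using ex_has_least_nat[of P q degree] assms by blast

text \<open>
  The primitive element theorem, in the usual way: \<open>\<theta> + c v\<close> generates for all but finitely many
  integers \<open>c\<close>, because for those the polynomials \<open>g(X)\<close> and \<open>f(\<theta> + c v - c X)\<close>, where \<open>f\<close> and \<open>g\<close>
  are the equations of \<open>\<theta>\<close> and \<open>v\<close>, have \<open>v\<close> as their only common root.
\<close>

lemma primitive_element:
  assumes \<theta>: "algebraic \<theta>" and g0: "over (num_field \<theta>) g0" "g0 \<noteq> 0" "poly g0 v = 0"
  obtains \<eta> where "algebraic \<eta>" "num_field \<theta> \<subseteq> num_field \<eta>" "v \<in> num_field \<eta>"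
proof -
  have "algebraic v" by (rule algebraic_adjoin(2)[OF \<theta> g0])
  then obtain g1 where g1: "over \<rat> g1 \<and> g1 \<noteq> 0 \<and> poly g1 v = 0" by (auto simp: algebraic_iff_over)
  obtain g where g: "over \<rat> g" "g \<noteq> 0" "poly g v = 0"
    and g_min: "\<And>q. over \<rat> q \<and> q \<noteq> 0 \<and> poly q v = 0 \<Longrightarrow> degree g \<le> degree q"
    by (rule ex_minimal_degree[of "\<lambda>g. over \<rat> g \<and> g \<noteq> 0 \<and> poly g v = 0", OF g1]) blast
  obtain f where f: "over \<rat> f" "f \<noteq> 0" "poly f \<theta> = 0" using \<theta> by (auto simp: algebraic_iff_over)
  have dg: "degree g > 0"
  proof (rule ccontr)
    assume "\<not> degree g > 0"
    then obtain c where "g = [:c:]" by (auto elim: degree_eq_zeroE)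
    then show False using g by simp
  qed
  have simple: "poly (pderiv g) v \<noteq> 0"
  proof
    assume "poly (pderiv g) v = 0"
    moreover have "over \<rat> (pderiv g)" using g(1) by (auto simp: over_def coeff_pderiv)
    moreover have "pderiv g \<noteq> 0" using dg by (simp add: pderiv_eq_0_iff)
    ultimately show False using g_min[of "pderiv g"] degree_pderiv[of g] dg by simp
  qed
  obtain c :: nat where c: "\<And>\<alpha> \<beta>. poly f \<alpha> = 0 \<Longrightarrow> poly g \<beta> = 0 \<Longrightarrow> \<alpha> + of_nat c * \<beta> = \<theta> + of_nat c * v \<Longrightarrow> \<beta> = v"
  proof -
    define Bad where "Bad = (\<lambda>(\<alpha>, \<beta>). (\<alpha> - \<theta>) / (v - \<beta>)) ` ({\<alpha>. poly f \<alpha> = 0} \<times> {\<beta>. poly g \<beta> = 0})"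
    have "finite Bad" unfolding Bad_def using f g by (intro finite_imageI finite_cartesian_product poly_roots_finite)
    moreover have "infinite (range (of_nat :: nat \<Rightarrow> complex))"
      by (metis finite_imageD infinite_UNIV_nat inj_of_nat)
    ultimately have "\<not> range of_nat \<subseteq> Bad" by (metis finite_subset)
    then obtain c :: nat where c: "of_nat c \<notin> Bad" by blast
    have "\<beta> = v" if "poly f \<alpha> = 0" "poly g \<beta> = 0" "\<alpha> + of_nat c * \<beta> = \<theta> + of_nat c * v" for \<alpha> \<beta>
    proof (rule ccontr)
      assume ne: "\<beta> \<noteq> v"
      have "of_nat c * (v - \<beta>) = \<alpha> - \<theta>" using that(3) by (simp add: algebra_simps)
      then have "of_nat c = (\<alpha> - \<theta>) / (v - \<beta>)" using ne by (simp add: field_simps)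
      then have "of_nat c \<in> Bad" unfolding Bad_def using that by (intro image_eqI[of _ _ "(\<alpha>, \<beta>)"]) auto
      with c show False by simp
    qed
    then show ?thesis by (rule that)
  qed
  define \<eta> where "\<eta> = \<theta> + of_nat c * v"
  have \<eta>: "algebraic \<eta>" unfolding \<eta>_def by (rule algebraic_adjoin(1)[OF \<theta> g0])
  note sr = subring_set_num_field[of \<eta>]
  have over_rat: "over (num_field \<eta>) p" if "over \<rat> p" for p
    using that Rats_num_field by (auto simp: over_def)
  define F where "F = pcompose f [:\<eta>, - of_nat c:]"
  have F_over: "over (num_field \<eta>) F"
  proof -
    have l: "over (num_field \<eta>) [:\<eta>, - of_nat c:]"
      by (intro over_pCons[OF sr] over_0[OF sr] self_num_field Rats_num_field) auto
    have "over (num_field \<eta>) (pcompose p [:\<eta>, - of_nat c:])" if "over (num_field \<eta>) p" for p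
      using that
    proof (induction p)
      case (pCons a p)
      have "a \<in> num_field \<eta>" "over (num_field \<eta>) p"
        using pCons.prems by (metis over_def coeff_pCons_0, metis over_def coeff_pCons_Suc)
      then show ?case unfolding pcompose_pCons
        by (intro over_add[OF sr] over_mult[OF sr] over_const[OF sr] l pCons.IH)
    qed (simp add: over_0[OF sr])
    then show ?thesis unfolding F_def using over_rat[OF f(1)] by blast
  qed
  have F_poly: "poly F x = poly f (\<eta> - of_nat c * x)" for x by (simp add: F_def poly_pcompose algebra_simps)
  \<comment> \<open>The minimal polynomial of \<open>v\<close> over the field of \<open>\<eta>\<close>; it divides \<open>g\<close> and \<open>F\<close>, so its only root is \<open>v\<close>.\<close>
  obtain h where h: "over (num_field \<eta>) h" "h \<noteq> 0" "poly h v = 0"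
    and h_min: "\<And>q. over (num_field \<eta>) q \<and> q \<noteq> 0 \<and> poly q v = 0 \<Longrightarrow> degree h \<le> degree q"
    by (rule ex_minimal_degree[of "\<lambda>h. over (num_field \<eta>) h \<and> h \<noteq> 0 \<and> poly h v = 0" g])
       (use over_rat g in blast)+
  have dh: "degree h > 0"
  proof (rule ccontr)
    assume "\<not> degree h > 0"
    then obtain c where "h = [:c:]" by (auto elim: degree_eq_zeroE)
    then show False using h by simp
  qed
  have dvd: "h dvd p" if p: "over (num_field \<eta>) p" "poly p v = 0" for p
  proof -
    obtain k q r where *: "over (num_field \<eta>) r" "smult (lead_coeff h ^ k) p = q * h + r" "degree r < degree h"
      using pseudo_division[OF sr h(1) dh p(1)] by blast
    have "poly r v = lead_coeff h ^ k * poly p v - poly q v * poly h v"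
      using arg_cong[OF *(2), of "\<lambda>p. poly p v"] by simp
    then have "r = 0" using h_min[of r] * p h by (metis diff_zero linorder_not_less mult_zero_right)
    then have "h dvd smult (lead_coeff h ^ k) p" using * by simp
    then show ?thesis using h(2) by (simp add: dvd_smult_iff)
  qed
  have "poly F v = 0" using f(3) by (simp add: F_poly \<eta>_def)
  then have hF: "h dvd F" using dvd F_over by blast
  have hg: "h dvd g" using dvd over_rat g by blast
  have root: "x = v" if "poly h x = 0" for x
  proof (rule c[of "\<eta> - of_nat c * x"])
    show "poly f (\<eta> - of_nat c * x) = 0" using that hF by (metis F_poly dvdE mult_zero_left poly_mult)
    show "poly g x = 0" using that hg by (metis dvdE mult_zero_left poly_mult)
    show "\<eta> - of_nat c * x + of_nat c * x = \<theta> + of_nat c * v" by (simp add: \<eta>_def)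
  qed
  obtain h1 where h1: "h = [:- v, 1:] * h1" using h(3) by (metis dvdE poly_eq_0_iff_dvd)
  have "degree h1 = 0"
  proof (rule ccontr)
    assume "degree h1 \<noteq> 0"
    then have "\<not> constant (poly h1)" by (simp add: constant_degree)
    then obtain x where x: "poly h1 x = 0" using fundamental_theorem_of_algebra by blast
    then have "poly h x = 0" by (simp add: h1)
    then have "poly h1 v = 0" using root x by blast
    then obtain h2 where "h1 = [:- v, 1:] * h2" by (metis dvdE poly_eq_0_iff_dvd)
    then obtain k where k: "g = [:- v, 1:] * ([:- v, 1:] * k)" using hg h1 by (metis dvdE mult.assoc)
    have "poly (pderiv g) v = 0" unfolding k by (subst pderiv_mult) simp
    with simple show False by simp
  qed
  then obtain e where e: "h1 = [:e:]" by (auto elim: degree_eq_zeroE)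
  have "e \<noteq> 0" using h(2) e h1 by auto
  have "h = [:- v * e, e:]" by (simp add: h1 e)
  then have "- v * e \<in> num_field \<eta>" "e \<in> num_field \<eta>"
    using h(1) by (metis over_def coeff_pCons_0, metis over_def coeff_pCons_0 coeff_pCons_Suc)
  then have "0 - (- v * e) * inverse e \<in> num_field \<eta>"
    by (metis subring_diff[OF sr] subring_mult[OF sr] subring_zero[OF sr] num_field_inverse[OF \<eta>])
  then have v: "v \<in> num_field \<eta>" using \<open>e \<noteq> 0\<close> by (simp add: mult.assoc)
  have "\<eta> - of_nat c * v \<in> num_field \<eta>"
    by (intro subring_diff[OF sr] subring_mult[OF sr] v self_num_field Rats_num_field) auto
  then have "num_field \<theta> \<subseteq> num_field \<eta>" by (intro num_field_mono) (simp add: \<eta>_def)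
  with \<eta> v show ?thesis by (intro that)
qed

section \<open>Reduction of algebraic numbers modulo primes of degree one\<close>

text \<open>
  Euclid's argument: were only the primes dividing \<open>s\<close> to divide values of \<open>f\<close>, then with
  \<open>c = f(0)\<close> the number \<open>f(c s y) / c\<close>, which is congruent to one modulo \<open>s\<close>, would be a unit.
\<close>

lemma ex_prime_dvd_value:
  fixes f :: "int poly" and s :: int
  assumes "degree f > 0" "s \<noteq> 0"
  obtains p :: nat and x :: int where "prime p" "int p dvd poly f x" "\<not> int p dvd s"
proof (cases "coeff f 0 = 0")
  case True
  obtain p where p: "prime p" "nat \<bar>s\<bar> < p" using bigger_prime by blast
  have "\<not> int p dvd s"
  proof
    assume "int p dvd s"
    then have "int p \<le> \<bar>s\<bar>" using assms(2) by (metis dvd_imp_le_int abs_of_nat)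
    with p(2) show False by linarith
  qed
  then show ?thesis using p True by (intro that[of p 0]) (simp_all add: poly_0_coeff_0)
next
  case False
  obtain c g where f: "f = pCons c g" by (cases f)
  have c: "c \<noteq> 0" and g: "g \<noteq> 0" using False assms(1) f by auto
  define h where "h = pCons 1 (smult s (pcompose g [:0, c * s:]))"
  have "pcompose g [:0, c * s:] \<noteq> 0" using g c assms(2) by (simp add: pcompose_eq_0_iff)
  then have dh: "degree h > 0" using assms(2) by (simp add: h_def)
  have hv: "poly f (c * s * y) = c * poly h y" for y
    by (simp add: f h_def poly_pcompose algebra_simps)
  have "h - [:k:] \<noteq> 0" for k using dh by (metis degree_pCons_0 eq_iff_diff_eq_0 less_irrefl)
  then have "finite {y. poly (h - [:k:]) y = 0}" for k by (intro poly_roots_finite)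
  then have "finite (\<Union>k\<in>{-1, 0, 1}. {y. poly (h - [:k:]) y = 0})" by blast
  then obtain y where y: "y \<notin> (\<Union>k\<in>{-1, 0, 1}. {y. poly (h - [:k:]) y = 0})"
    using ex_new_if_finite[OF infinite_UNIV_int] by blast
  then have "poly h y \<notin> {-1, 0, 1}" by auto
  then have "nat \<bar>poly h y\<bar> \<noteq> 1" by auto
  then obtain p where p: "prime p" "p dvd nat \<bar>poly h y\<bar>" using prime_factor_nat by blast
  then have ph: "int p dvd poly h y" by (metis abs_of_nat dvd_abs_iff int_dvd_int_iff int_nat_eq nat_0_le abs_ge_zero)
  have "\<not> int p dvd s"
  proof
    assume "int p dvd s"
    moreover have "poly h y = 1 + s * (y * poly (pcompose g [:0, c * s:]) y)" by (simp add: h_def algebra_simps)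
    ultimately have "int p dvd 1" using ph by (metis dvd_add_left_iff dvd_mult2)
    then show False using p(1) by (metis int_dvd_int_iff not_prime_unit of_nat_1)
  qed
  with p(1) ph hv[of y] show ?thesis by (intro that[of p "c * s * y"]) auto
qed

text \<open>
  A relation with these properties is a ring homomorphism to the field with \<open>p\<close> elements, defined
  on a subring of the complex numbers; its value at \<open>z\<close> is given by any \<open>u\<close> related to \<open>z\<close>.
\<close>

definition reduction :: "nat \<Rightarrow> (complex \<Rightarrow> int \<Rightarrow> bool) \<Rightarrow> bool" where
  "reduction p R \<longleftrightarrow> prime p \<and> R 1 1 \<and> (\<forall>u. R 0 u \<longrightarrow> int p dvd u) \<and>
     (\<forall>y z u v. R y u \<longrightarrow> R z v \<longrightarrow> R (y + z) (u + v) \<and> R (y - z) (u - v) \<and> R (y * z) (u * v))"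

text \<open>
  Send \<open>\<theta>\<close> to an integer \<open>x\<close> at which its equation \<open>f\<close> has a value divisible by \<open>p\<close>. This is well defined on the
  ring generated by \<open>\<theta>\<close> and \<open>1/s\<close> if \<open>s\<close> is prime to \<open>p\<close> and divisible by the leading coefficient of \<open>f\<close>; taking \<open>s\<close>
  divisible also by denominators of the elements of \<open>A\<close> puts them into that ring.
\<close>

lemma ex_reduction:
  assumes \<theta>: "algebraic \<theta>" and A: "finite A" "A \<subseteq> num_field \<theta>"
  shows "\<exists>p R. reduction p R \<and> (\<forall>z\<in>A. \<exists>u. R z u)"
proof -
  define ev :: "int poly \<Rightarrow> complex" where "ev P = poly (map_poly of_int P) \<theta>" for P
  have ev_simps: "ev (P + Q) = ev P + ev Q" "ev (P - Q) = ev P - ev Q" "ev (P * Q) = ev P * ev Q"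
    "ev (smult k P) = of_int k * ev P" "ev 1 = 1" "ev 0 = 0" for P Q k
  proof -
    have *: "map_poly of_int (P + Q) = (map_poly of_int P + map_poly of_int Q :: complex poly)"
      "map_poly of_int (P - Q) = (map_poly of_int P - map_poly of_int Q :: complex poly)"
      "map_poly of_int (P * Q) = (map_poly of_int P * map_poly of_int Q :: complex poly)"
      "map_poly of_int (smult k P) = (smult (of_int k) (map_poly of_int P) :: complex poly)"
      by (auto simp: poly_eq_iff coeff_map_poly coeff_mult)
    show "ev (P + Q) = ev P + ev Q" "ev (P - Q) = ev P - ev Q" "ev (P * Q) = ev P * ev Q"
      "ev (smult k P) = of_int k * ev P" "ev 1 = 1" "ev 0 = 0" by (simp_all add: ev_def *)
  qed
  have "\<exists>f. f \<noteq> 0 \<and> ev f = 0" using \<theta> unfolding ev_def by (metis algebraicE')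
  then obtain f0 where "f0 \<noteq> 0 \<and> ev f0 = 0" ..
  then obtain f where f: "f \<noteq> 0" "ev f = 0" and f_min: "\<And>q. q \<noteq> 0 \<and> ev q = 0 \<Longrightarrow> degree f \<le> degree q"
    using ex_minimal_degree[of "\<lambda>f. f \<noteq> 0 \<and> ev f = 0" f0] by blast
  have df: "degree f > 0"
  proof (rule ccontr)
    assume "\<not> degree f > 0"
    then obtain c where "f = [:c:]" by (auto elim: degree_eq_zeroE)
    then show False using f by (simp add: ev_def map_poly_pCons)
  qed
  have "\<exists>D P. D \<noteq> 0 \<and> of_int D * z = ev P" if z: "z \<in> A" for z
  proof -
    obtain q where q: "over \<rat> q" "z = poly q \<theta>" using z A(2) by (auto simp: num_field_def)
    from q(1) have "\<exists>D P. D \<noteq> 0 \<and> smult (of_int D) q = map_poly of_int P"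
    proof (induction q)
      case 0
      show ?case by (intro exI[of _ 1] exI[of _ 0]) simp
    next
      case (pCons a q)
      have a: "a \<in> \<rat>" and "over \<rat> q"
        using pCons.prems by (metis over_def coeff_pCons_0, metis over_def coeff_pCons_Suc)
      then obtain D P where D: "D \<noteq> 0" "smult (of_int D) q = map_poly of_int P" using pCons.IH by blast
      obtain n d where "d > 0" and nd2: "a = of_int n / of_int d"
        using a by (rule Rats_cases')
      then have nd: "d \<noteq> 0" "a = of_int n / of_int d" by auto
      have "smult (of_int (D * d)) (pCons a q) = map_poly of_int (pCons (D * n) (smult d P))"
      proof -
        have "smult (of_int (D * d)) q = smult (of_int d) (smult (of_int D) q)" by (simp add: mult.commute)
        also have "\<dots> = map_poly of_int (smult d P)" unfolding D(2) by (simp add: poly_eq_iff coeff_map_poly)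
        finally show ?thesis using nd by (simp add: map_poly_pCons)
      qed
      then show ?case using D(1) nd(1) by (intro exI[of _ "D * d"] exI[of _ "pCons (D * n) (smult d P)"]) simp
    qed
    then obtain D P where D: "D \<noteq> 0" "smult (of_int D) q = map_poly of_int P" by blast
    then have "of_int D * z = ev P" unfolding ev_def q(2) by (metis poly_smult)
    with D(1) show ?thesis by blast
  qed
  then obtain D P where DP: "\<And>z. z \<in> A \<Longrightarrow> D z \<noteq> 0" "\<And>z. z \<in> A \<Longrightarrow> of_int (D z) * z = ev (P z)"
    by metis
  define s where "s = lead_coeff f * prod D A"
  have "s \<noteq> 0" using f DP A(1) by (simp add: s_def)
  then obtain p x where p: "prime p" "int p dvd poly f x" "\<not> int p dvd s"
    by (rule ex_prime_dvd_value[OF df])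
  have pp: "prime (int p)" using p(1) by simp
  have pow: "int p dvd c ^ k * u \<Longrightarrow> \<not> int p dvd c \<Longrightarrow> int p dvd u" for c k u
    using pp by (metis prime_dvd_mult_iff prime_dvd_power)
  \<comment> \<open>\<open>z\<close> is a fraction \<open>P(\<theta>) / s\<^sup>k\<close>, and \<open>u\<close> is congruent to \<open>P(x) / s\<^sup>k\<close>.\<close>
  define R where "R z u \<longleftrightarrow> (\<exists>P k. of_int s ^ k * z = ev P \<and> int p dvd s ^ k * u - poly P x)" for z u
  have R1: "R 1 1" unfolding R_def by (intro exI[of _ 1] exI[of _ 0]) (simp add: ev_simps)
  have R_zero: "int p dvd u" if R0: "R 0 u" for u
  proof -
    obtain P k where P: "ev P = 0" "int p dvd s ^ k * u - poly P x" using R0 by (auto simp: R_def)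
    obtain j q r where *: "smult (lead_coeff f ^ j) P = q * f + r" "degree r < degree f"
      using pseudo_division[OF subring_set_UNIV over_UNIV df over_UNIV] by blast
    have "ev r = of_int (lead_coeff f ^ j) * ev P - ev q * ev f"
      using arg_cong[OF *(1), of ev] by (simp add: ev_simps)
    then have "r = 0" using f_min[of r] *(2) P f by (metis diff_zero linorder_not_less mult_zero_right)
    then have "lead_coeff f ^ j * poly P x = poly q x * poly f x"
      using arg_cong[OF *(1), of "\<lambda>P. poly P x"] by simp
    then have "int p dvd lead_coeff f ^ j * poly P x" using p(2) by simp
    moreover have "\<not> int p dvd lead_coeff f" using p(3) by (auto simp: s_def)
    ultimately have "int p dvd poly P x" by (rule pow)
    then have "int p dvd s ^ k * u" using P(2) by (metis diff_add_cancel dvd_add)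
    then show ?thesis using p(3) by (rule pow)
  qed
  have R_ops: "R (y + z) (u + v) \<and> R (y - z) (u - v) \<and> R (y * z) (u * v)" if Ryz: "R y u" "R z v" for y z u v
  proof -
    obtain P k Q l where P: "of_int s ^ k * y = ev P" "int p dvd s ^ k * u - poly P x"
      and Q: "of_int s ^ l * z = ev Q" "int p dvd s ^ l * v - poly Q x" using Ryz by (auto simp: R_def)
    have dP: "int p dvd s ^ l * (s ^ k * u - poly P x)" and dQ: "int p dvd s ^ k * (s ^ l * v - poly Q x)"
      using P(2) Q(2) by auto
    have e: "of_int s ^ (k + l) * y = of_int (s ^ l) * ev P" "of_int s ^ (k + l) * z = of_int (s ^ k) * ev Q"
      by (simp_all add: power_add mult.commute mult.left_commute flip: P(1) Q(1))
    have "R (y + z) (u + v)" unfolding R_def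
    proof (intro exI conjI)
      show "of_int s ^ (k + l) * (y + z) = ev (smult (s ^ l) P + smult (s ^ k) Q)"
        by (simp only: ev_simps distrib_left e)
      have "s ^ (k + l) * (u + v) - poly (smult (s ^ l) P + smult (s ^ k) Q) x =
          s ^ l * (s ^ k * u - poly P x) + s ^ k * (s ^ l * v - poly Q x)"
        by (simp add: power_add algebra_simps)
      then show "int p dvd s ^ (k + l) * (u + v) - poly (smult (s ^ l) P + smult (s ^ k) Q) x"
        using dP dQ by (metis dvd_add)
    qed
    moreover have "R (y - z) (u - v)" unfolding R_def
    proof (intro exI conjI)
      show "of_int s ^ (k + l) * (y - z) = ev (smult (s ^ l) P - smult (s ^ k) Q)"
        by (simp only: ev_simps right_diff_distrib e)
      have "s ^ (k + l) * (u - v) - poly (smult (s ^ l) P - smult (s ^ k) Q) x =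
          s ^ l * (s ^ k * u - poly P x) - s ^ k * (s ^ l * v - poly Q x)"
        by (simp add: power_add algebra_simps)
      then show "int p dvd s ^ (k + l) * (u - v) - poly (smult (s ^ l) P - smult (s ^ k) Q) x"
        using dP dQ by (metis dvd_diff)
    qed
    moreover have "R (y * z) (u * v)" unfolding R_def
    proof (intro exI conjI)
      show "of_int s ^ (k + l) * (y * z) = ev (P * Q)"
        by (simp add: ev_simps power_add flip: P(1) Q(1))
      have "s ^ (k + l) * (u * v) - poly (P * Q) x =
          (s ^ k * u - poly P x) * (s ^ l * v) + poly P x * (s ^ l * v - poly Q x)"
        by (simp add: power_add algebra_simps)
      then show "int p dvd s ^ (k + l) * (u * v) - poly (P * Q) x"
        using P(2) Q(2) by (metis dvd_add dvd_mult dvd_mult2)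
    qed
    ultimately show ?thesis by blast
  qed
  have "\<exists>u. R z u" if z: "z \<in> A" for z
  proof -
    define t where "t = lead_coeff f * prod D (A - {z})"
    have st: "s = D z * t" unfolding s_def t_def using prod.remove[OF A(1) z, of D] by simp
    have "coprime s (int p)" using p(3) pp by (metis coprime_commute prime_imp_coprime)
    then obtain i where i: "[s * i = 1] (mod int p)" using cong_solve_coprime_int by blast
    define u where "u = i * poly (smult t (P z)) x"
    have "[(s * i) * poly (smult t (P z)) x = 1 * poly (smult t (P z)) x] (mod int p)"
      by (intro cong_mult i cong_refl)
    then have "int p dvd s ^ 1 * u - poly (smult t (P z)) x"
      unfolding u_def by (simp add: cong_iff_dvd_diff mult.assoc)
    moreover have "of_int s ^ 1 * z = ev (smult t (P z))"
      by (simp add: ev_simps st flip: DP(2)[OF z])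
    ultimately show ?thesis unfolding R_def by blast
  qed
  moreover have "reduction p R" unfolding reduction_def
    by (intro conjI p(1) R1 allI impI R_zero R_ops[THEN conjunct1] R_ops[THEN conjunct2, THEN conjunct1]
        R_ops[THEN conjunct2, THEN conjunct2])
  ultimately show ?thesis by (intro exI[of _ p] exI[of _ R] conjI ballI)
qed

section \<open>Points of finitely generated rings over number fields\<close>

text \<open>
  All computations in the domain \<open>'r / m\<close> are carried out modulo \<open>m\<close> in the given ring, so that no quotient
  types are needed.
\<close>

definition prime_ideal_set :: "'r::comm_ring_1 set \<Rightarrow> bool" where
  "prime_ideal_set m \<longleftrightarrow> 0 \<in> m \<and> 1 \<notin> m \<and> (\<forall>x\<in>m. \<forall>y\<in>m. x + y \<in> m) \<and>
     (\<forall>r. \<forall>x\<in>m. r * x \<in> m) \<and> (\<forall>x y. x * y \<in> m \<longrightarrow> x \<in> m \<or> y \<in> m)"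

text \<open>Homomorphisms from the image of \<open>S\<close> modulo \<open>m\<close> to the complex numbers.\<close>

definition hom_mod :: "'r::comm_ring_1 set \<Rightarrow> 'r set \<Rightarrow> ('r \<Rightarrow> complex) \<Rightarrow> bool" where
  "hom_mod m S \<phi> \<longleftrightarrow> \<phi> 1 = 1 \<and> (\<forall>x\<in>S. \<forall>y\<in>S. \<phi> (x + y) = \<phi> x + \<phi> y \<and> \<phi> (x * y) = \<phi> x * \<phi> y) \<and>
     (\<forall>x\<in>S. x \<in> m \<longrightarrow> \<phi> x = 0)"

definition adjoin :: "'r::comm_ring_1 set \<Rightarrow> 'r \<Rightarrow> 'r set" where
  "adjoin S y = {poly p y |p. over S p}"

lemma adjoinI: "over S p \<Longrightarrow> poly p y \<in> adjoin S y"
  by (auto simp: adjoin_def)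

lemma subring_set_adjoin:
  assumes S: "subring_set S" shows "subring_set (adjoin S y)"
  unfolding subring_set_def
proof (intro conjI ballI)
  show "0 \<in> adjoin S y" using adjoinI[of S 0 y] over_0[OF S] by simp
  show "1 \<in> adjoin S y" using adjoinI[of S "[:1:]" y] over_const[OF S] subring_one[OF S] by simp
  fix u v assume "u \<in> adjoin S y" "v \<in> adjoin S y"
  then obtain p q where "over S p" "u = poly p y" "over S q" "v = poly q y" by (auto simp: adjoin_def)
  then show "u + v \<in> adjoin S y" "u - v \<in> adjoin S y" "u * v \<in> adjoin S y"
    using adjoinI[of S "p + q" y] adjoinI[of S "p - q" y] adjoinI[of S "p * q" y]
      over_add[OF S] over_diff[OF S] over_mult[OF S] by auto
qed

lemma subset_adjoin: "subring_set S \<Longrightarrow> S \<subseteq> adjoin S y"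
proof
  fix x assume "subring_set S" "x \<in> S"
  then show "x \<in> adjoin S y" using adjoinI[of S "[:x:]" y] over_const by auto
qed

lemma self_adjoin: "subring_set S \<Longrightarrow> y \<in> adjoin S y"
  using adjoinI[of S "[:0, 1:]" y] by (simp add: over_pCons over_0 subring_zero subring_one)

context
  fixes m S :: "'r::comm_ring_1 set"
  assumes m: "prime_ideal_set m" and S: "subring_set S"
begin

lemma prime_ideal_simps:
  shows ideal_zero: "0 \<in> m" and ideal_one: "1 \<notin> m"
    and ideal_add: "x \<in> m \<Longrightarrow> y \<in> m \<Longrightarrow> x + y \<in> m"
    and ideal_mult: "x \<in> m \<Longrightarrow> r * x \<in> m"
    and ideal_prime: "x * y \<in> m \<Longrightarrow> x \<in> m \<or> y \<in> m"
  using m by (auto simp: prime_ideal_set_def)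

lemma ideal_mult': "x \<in> m \<Longrightarrow> x * r \<in> m"
  using ideal_mult[of x r] by (simp add: mult.commute)

lemma ideal_diff: "x \<in> m \<Longrightarrow> y \<in> m \<Longrightarrow> x - y \<in> m"
  using ideal_add[of x "- 1 * y"] ideal_mult[of y "- 1"] by simp

lemma ideal_diff_iff: "x - y \<in> m \<Longrightarrow> x \<in> m \<longleftrightarrow> y \<in> m"
  using ideal_add[of "x - y" y] ideal_diff[of x "x - y"] by auto

lemma ideal_power: "x ^ k \<in> m \<Longrightarrow> x \<in> m"
  by (induction k) (auto simp: ideal_one dest: ideal_prime)

lemma ideal_sum: "(\<And>i. i \<in> I \<Longrightarrow> f i \<in> m) \<Longrightarrow> sum f I \<in> m"
  by (induction I rule: infinite_finite_induct) (auto intro: ideal_zero ideal_add)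

lemma ideal_poly: "(\<And>i. coeff p i \<in> m) \<Longrightarrow> poly p y \<in> m"
proof (induction p)
  case (pCons a p)
  have "a \<in> m" using pCons.prems[of 0] by simp
  moreover have "poly p y \<in> m" using pCons.IH pCons.prems[of "Suc _"] by simp
  ultimately show ?case by (simp add: ideal_add ideal_mult)
qed (simp add: ideal_zero)

lemma drop_lead_coeff:
  assumes p: "over S p" "lead_coeff p \<in> m" "coeff p i \<notin> m"
  shows "\<exists>p'. over S p' \<and> degree p' < degree p \<and> coeff p' i \<notin> m \<and> poly p' y - poly p y \<in> m"
proof (intro exI conjI)
  define p' where "p' = p - monom (lead_coeff p) (degree p)"
  have coeff: "coeff p' j = (if j = degree p then 0 else coeff p j)" for j
    by (simp add: p'_def coeff_monom)
  show "over S p'" using p(1) subring_zero[OF S] by (auto simp: over_def coeff)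
  have "i \<noteq> degree p" using p by auto
  then show i: "coeff p' i \<notin> m" using p by (simp add: coeff)
  have "p' \<noteq> 0" using i ideal_zero by auto
  moreover have "degree p' \<le> degree p" by (intro degree_le) (auto simp: coeff coeff_eq_0)
  moreover have "coeff p' (degree p) = 0" by (simp add: coeff)
  ultimately show "degree p' < degree p" by (metis eq_zero_or_degree_less)
  show "poly p' y - poly p y \<in> m"
    using ideal_diff[OF ideal_zero ideal_mult[OF p(2), of "y ^ degree p"]]
    by (simp add: p'_def poly_monom mult.commute)
qed

lemma ex_lead_coeff_not_in_ideal:
  assumes "over S p" "coeff p i \<notin> m"
  shows "\<exists>q. over S q \<and> lead_coeff q \<notin> m \<and> degree q \<le> degree p \<and> poly q y - poly p y \<in> m"
  using assms
proof (induction "degree p" arbitrary: p rule: less_induct)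
  case less
  show ?case
  proof (cases "lead_coeff p \<in> m")
    case False
    then show ?thesis using less.prems by (intro exI[of _ p]) (auto simp: ideal_zero)
  next
    case True
    obtain p' where p': "over S p'" "degree p' < degree p" "coeff p' i \<notin> m" "poly p' y - poly p y \<in> m"
      using drop_lead_coeff[OF less.prems(1) True less.prems(2)] by blast
    obtain q where q: "over S q" "lead_coeff q \<notin> m" "degree q \<le> degree p'" "poly q y - poly p' y \<in> m"
      using less.hyps[OF p'(2,1,3)] by blast
    have "poly q y - poly p y \<in> m" using ideal_add[OF q(4) p'(4)] by simp
    then show ?thesis using q p'(2) by (intro exI[of _ q]) auto
  qed
qed

text \<open>
  An element algebraic over \<open>S\<close> modulo \<open>m\<close> has a minimal equation \<open>F\<close>, and every polynomial in it that
  does not vanish modulo \<open>m\<close> divides a nonzero constant. The second statement is proved by the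
  Euclidean algorithm for that polynomial and the minimal equation.
\<close>

context
  fixes F :: "'r poly" and y :: 'r
  assumes F: "over S F" "poly F y \<in> m" "lead_coeff F \<notin> m"
    and F_min: "\<And>q. over S q \<and> poly q y \<in> m \<and> lead_coeff q \<notin> m \<Longrightarrow> degree F \<le> degree q"
begin

lemma minimal_eq_degree: "degree F > 0"
proof (rule ccontr)
  assume "\<not> degree F > 0"
  then obtain c where "F = [:c:]" by (auto elim: degree_eq_zeroE)
  then show False using F by simp
qed

lemma minimal_eq_coeffs:
  assumes "over S r" "poly r y \<in> m" "degree r < degree F" shows "coeff r i \<in> m"
proof (rule ccontr)
  assume "coeff r i \<notin> m"
  then obtain q where q: "over S q" "lead_coeff q \<notin> m" "degree q \<le> degree r" "poly q y - poly r y \<in> m"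
    using ex_lead_coeff_not_in_ideal[OF assms(1)] by blast
  then have "poly q y \<in> m" using assms(2) ideal_diff_iff by blast
  then show False using F_min[of q] q assms(3) by auto
qed

lemma ex_dividing_constant:
  assumes "over S p" "poly p y \<notin> m"
  shows "\<exists>q c. over S q \<and> c \<in> S \<and> c \<notin> m \<and> poly q y * poly p y - c \<in> m"
  using assms
proof (induction "degree p" arbitrary: p rule: less_induct)
  case less
  note dF = minimal_eq_degree
  consider "lead_coeff p \<in> m" | "lead_coeff p \<notin> m" "degree F \<le> degree p"
    | "lead_coeff p \<notin> m" "degree p < degree F" "degree p > 0" | "lead_coeff p \<notin> m" "degree p = 0"
    by linarith
  then show ?case
  proof cases
    case 1
    obtain i where i: "coeff p i \<notin> m" using ideal_poly less.prems(2) by blast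
    obtain p' where p': "over S p'" "degree p' < degree p" "poly p' y - poly p y \<in> m"
      using drop_lead_coeff[OF less.prems(1) 1 i] by blast
    have "poly p' y \<notin> m" using ideal_diff_iff[OF p'(3)] less.prems(2) by blast
    then obtain q c where q: "over S q" "c \<in> S" "c \<notin> m" "poly q y * poly p' y - c \<in> m"
      using less.hyps[OF p'(2,1)] by blast
    have "(poly q y * poly p' y - c) - poly q y * (poly p' y - poly p y) \<in> m"
      by (rule ideal_diff[OF q(4) ideal_mult[OF p'(3)]])
    then have "poly q y * poly p y - c \<in> m" by (simp add: algebra_simps)
    then show ?thesis using q by blast
  next
    case 2
    obtain k q r where qr: "over S q" "over S r" "smult (lead_coeff F ^ k) p = q * F + r" "degree r < degree F"
      using pseudo_division[OF S F(1) dF less.prems(1)] by blast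
    have eq: "lead_coeff F ^ k * poly p y = poly q y * poly F y + poly r y"
      using arg_cong[OF qr(3), of "\<lambda>p. poly p y"] by simp
    have d: "lead_coeff F ^ k * poly p y - poly r y \<in> m"
      unfolding eq using ideal_mult[OF F(2)] by simp
    have "poly r y \<notin> m"
    proof
      assume "poly r y \<in> m"
      then have "lead_coeff F ^ k * poly p y \<in> m" using d ideal_diff_iff by blast
      then show False using ideal_prime ideal_power F(3) less.prems(2) by blast
    qed
    moreover have "degree r < degree p" using qr(4) 2 by simp
    ultimately obtain s c where s: "over S s" "c \<in> S" "c \<notin> m" "poly s y * poly r y - c \<in> m"
      using less.hyps[OF _ qr(2)] by blast
    have "(poly s y * poly r y - c) + poly s y * (lead_coeff F ^ k * poly p y - poly r y) \<in> m"
      by (rule ideal_add[OF s(4) ideal_mult[OF d]])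
    also have "(poly s y * poly r y - c) + poly s y * (lead_coeff F ^ k * poly p y - poly r y) =
        poly (smult (lead_coeff F ^ k) s) y * poly p y - c" by (simp add: algebra_simps)
    finally have "poly (smult (lead_coeff F ^ k) s) y * poly p y - c \<in> m" .
    moreover have "over S (smult (lead_coeff F ^ k) s)" using s(1) F(1)
      by (intro over_smult[OF S] subring_power[OF S]) (auto simp: over_def)
    ultimately show ?thesis using s(2,3) by blast
  next
    \<comment> \<open>Here \<open>F\<close> is divided by \<open>p\<close>. If the remainder vanished modulo \<open>m\<close>, the quotient would be a smaller
      equation of \<open>y\<close>.\<close>
    case 3
    obtain k q r where qr: "over S q" "over S r" "smult (lead_coeff p ^ k) F = q * p + r" "degree r < degree p"
      "q = 0 \<or> degree q + degree p \<le> degree F"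
      using pseudo_division[OF S less.prems(1) 3(3) F(1)] by blast
    have eq: "lead_coeff p ^ k * poly F y = poly q y * poly p y + poly r y"
      using arg_cong[OF qr(3), of "\<lambda>p. poly p y"] by simp
    have d: "poly q y * poly p y + poly r y \<in> m" using ideal_mult[OF F(2), of "lead_coeff p ^ k"] by (simp add: eq)
    have "poly r y \<notin> m"
    proof
      assume r: "poly r y \<in> m"
      then have "poly q y * poly p y \<in> m" using ideal_diff[OF d r] by simp
      then have "poly q y \<in> m" using ideal_prime less.prems(2) by blast
      moreover have "degree q < degree F" using qr(5) 3 by auto
      ultimately have q: "coeff q i \<in> m" for i using minimal_eq_coeffs[OF qr(1)] by blast
      have rc: "coeff r i \<in> m" for i using minimal_eq_coeffs[OF qr(2) r] qr(4) 3 by simp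
      have "coeff (q * p + r) (degree F) \<in> m"
        unfolding coeff_add coeff_mult using rc q
        by (intro ideal_add) (auto intro!: ideal_sum ideal_mult')
      then have "lead_coeff p ^ k * lead_coeff F \<in> m" by (simp flip: qr(3))
      then show False using ideal_prime ideal_power F(3) 3(1) by blast
    qed
    then obtain s c where s: "over S s" "c \<in> S" "c \<notin> m" "poly s y * poly r y - c \<in> m"
      using less.hyps[OF qr(4,2)] by blast
    have "(poly s y * poly r y - c) - poly s y * (poly q y * poly p y + poly r y) \<in> m"
      by (rule ideal_diff[OF s(4) ideal_mult[OF d]])
    also have "(poly s y * poly r y - c) - poly s y * (poly q y * poly p y + poly r y) =
        poly (0 - s * q) y * poly p y - c" by (simp add: algebra_simps)
    finally have "poly (0 - s * q) y * poly p y - c \<in> m" .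
    moreover have "over S (0 - s * q)"
      by (intro over_diff[OF S] over_mult[OF S] over_0[OF S] s(1) qr(1))
    ultimately show ?thesis using s(2,3) by blast
  next
    case 4
    then obtain c where "p = [:c:]" by (auto elim: degree_eq_zeroE)
    moreover have "c \<in> S" using less.prems(1) \<open>p = [:c:]\<close> by (metis over_def coeff_pCons_0)
    ultimately show ?thesis using 4 over_const[OF S subring_one[OF S]] ideal_zero
      by (intro exI[of _ "[:1:]"] exI[of _ c]) simp
  qed
qed

end

context
  fixes \<phi> :: "'r \<Rightarrow> complex"
  assumes \<phi>: "hom_mod m S \<phi>"
begin

lemma hom_mod_simps:
  shows hom_one: "\<phi> 1 = 1"
    and hom_add: "u \<in> S \<Longrightarrow> v \<in> S \<Longrightarrow> \<phi> (u + v) = \<phi> u + \<phi> v"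
    and hom_mult: "u \<in> S \<Longrightarrow> v \<in> S \<Longrightarrow> \<phi> (u * v) = \<phi> u * \<phi> v"
    and hom_ideal: "u \<in> S \<Longrightarrow> u \<in> m \<Longrightarrow> \<phi> u = 0"
  using \<phi> by (auto simp: hom_mod_def)

lemma hom_zero: "\<phi> 0 = 0"
  using hom_ideal[OF subring_zero[OF S] ideal_zero] .

lemma hom_diff: "u \<in> S \<Longrightarrow> v \<in> S \<Longrightarrow> \<phi> (u - v) = \<phi> u - \<phi> v"
  using hom_add[of "u - v" v] subring_diff[OF S] by simp

lemma hom_sum: "(\<And>i. i \<in> I \<Longrightarrow> f i \<in> S) \<Longrightarrow> \<phi> (sum f I) = (\<Sum>i\<in>I. \<phi> (f i))"
  by (induction I rule: infinite_finite_induct) (auto simp: hom_zero hom_add subring_sum[OF S])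

lemma hom_power: "u \<in> S \<Longrightarrow> \<phi> (u ^ k) = \<phi> u ^ k"
  by (induction k) (auto simp: hom_one hom_mult subring_power[OF S])

lemma coeff_map_hom: "coeff (map_poly \<phi> p) i = \<phi> (coeff p i)"
  by (simp add: coeff_map_poly hom_zero)

lemma map_hom_add: "over S p \<Longrightarrow> over S q \<Longrightarrow> map_poly \<phi> (p + q) = map_poly \<phi> p + map_poly \<phi> q"
  and map_hom_diff: "over S p \<Longrightarrow> over S q \<Longrightarrow> map_poly \<phi> (p - q) = map_poly \<phi> p - map_poly \<phi> q"
  and map_hom_mult: "over S p \<Longrightarrow> over S q \<Longrightarrow> map_poly \<phi> (p * q) = map_poly \<phi> p * map_poly \<phi> q"
  and map_hom_smult: "c \<in> S \<Longrightarrow> over S p \<Longrightarrow> map_poly \<phi> (smult c p) = smult (\<phi> c) (map_poly \<phi> p)"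
  by (auto simp: poly_eq_iff coeff_map_hom over_def coeff_mult hom_add hom_diff hom_sum hom_mult
      subring_mult[OF S])

lemma map_hom_const: "map_poly \<phi> [:c:] = [:\<phi> c:]"
  by (simp add: poly_eq_iff coeff_map_hom coeff_pCons hom_zero split: nat.split)

lemma extend_hom_mod:
  assumes W: "\<And>p. over S p \<Longrightarrow> poly p y \<in> m \<Longrightarrow> poly (map_poly \<phi> p) v = 0"
  obtains \<psi> where "hom_mod m (adjoin S y) \<psi>" "\<And>p. over S p \<Longrightarrow> \<psi> (poly p y) = poly (map_poly \<phi> p) v"
proof -
  define \<psi> where "\<psi> z = poly (map_poly \<phi> (SOME p. over S p \<and> poly p y = z)) v" for z
  have \<psi>: "\<psi> (poly p y) = poly (map_poly \<phi> p) v" if p: "over S p" for p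
  proof -
    define q where "q = (SOME q. over S q \<and> poly q y = poly p y)"
    have q: "over S q" "poly q y = poly p y"
      using someI[of "\<lambda>q. over S q \<and> poly q y = poly p y" p] p unfolding q_def by auto
    have "poly (map_poly \<phi> (q - p)) v = 0"
      using q p ideal_zero by (intro W over_diff[OF S]) auto
    then show ?thesis using q(1) p by (simp add: \<psi>_def map_hom_diff flip: q_def)
  qed
  have "hom_mod m (adjoin S y) \<psi>" unfolding hom_mod_def
  proof (intro conjI ballI impI)
    show "\<psi> 1 = 1" using \<psi>[OF over_const[OF S subring_one[OF S]]] by (simp add: map_hom_const hom_one)
  next
    fix a b assume "a \<in> adjoin S y" "b \<in> adjoin S y"
    then obtain p q where pq: "over S p" "a = poly p y" "over S q" "b = poly q y" by (auto simp: adjoin_def)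
    show "\<psi> (a + b) = \<psi> a + \<psi> b"
      using \<psi>[OF over_add[OF S pq(1,3)]] pq by (simp add: \<psi> map_hom_add)
    show "\<psi> (a * b) = \<psi> a * \<psi> b"
      using \<psi>[OF over_mult[OF S pq(1,3)]] pq by (simp add: \<psi> map_hom_mult)
  next
    fix a assume "a \<in> adjoin S y" "a \<in> m"
    then show "\<psi> a = 0" using W \<psi> by (auto simp: adjoin_def)
  qed
  then show ?thesis using \<psi> by (rule that)
qed

end

text \<open>
  The extension theorem. A homomorphism that does not vanish at a suitable element \<open>s'\<close> of \<open>S\<close> extends
  to \<open>S[y]\<close> with a prescribed element \<open>s\<close> not going to zero: if \<open>y\<close> is transcendental over \<open>S\<close> modulo
  \<open>m\<close>, its image can be any integer outside a finite set; otherwise it has to be a root of the minimal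
  equation, which exists since \<open>s'\<close> ensures that the equation does not lose its degree.
\<close>

lemma extend_hom_mod_nonzero:
  assumes s: "s \<in> adjoin S y" "s \<notin> m"
  shows "\<exists>s'\<in>S. s' \<notin> m \<and> (\<forall>\<phi> \<theta>. hom_mod m S \<phi> \<and> algebraic \<theta> \<and> \<phi> ` S \<subseteq> num_field \<theta> \<and> \<phi> s' \<noteq> 0 \<longrightarrow>
    (\<exists>\<psi> \<eta>. hom_mod m (adjoin S y) \<psi> \<and> algebraic \<eta> \<and> \<psi> ` adjoin S y \<subseteq> num_field \<eta> \<and> \<psi> s \<noteq> 0))"
proof -
  obtain p0 where p0: "over S p0" "s = poly p0 y" using s by (auto simp: adjoin_def)
  have into: "\<psi> ` adjoin S y \<subseteq> num_field \<eta>"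
    if vals: "\<phi> ` S \<subseteq> num_field \<eta>" "v \<in> num_field \<eta>" and \<psi>: "\<And>p. over S p \<Longrightarrow> \<psi> (poly p y) = poly (map_poly \<phi> p) v"
      and \<phi>: "hom_mod m S \<phi>"
    for \<psi> \<phi> \<eta> v
  proof
    fix z assume "z \<in> \<psi> ` adjoin S y"
    then obtain p where p: "over S p" "z = poly (map_poly \<phi> p) v" using \<psi> by (auto simp: adjoin_def)
    have "over (num_field \<eta>) (map_poly \<phi> p)" using p(1) vals(1) by (auto simp: over_def coeff_map_hom[OF \<phi>])
    then show "z \<in> num_field \<eta>" unfolding p(2) using vals(2) by (intro over_poly[OF subring_set_num_field])
  qed
  show ?thesis
  proof (cases "\<exists>p. over S p \<and> poly p y \<in> m \<and> (\<exists>i. coeff p i \<notin> m)")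
    case False
    then have trans: "coeff p i \<in> m" if "over S p" "poly p y \<in> m" for p i using that by blast
    obtain i where i: "coeff p0 i \<notin> m" using ideal_poly s(2) p0(2) by blast
    show ?thesis
    proof (intro bexI conjI allI impI)
      show "coeff p0 i \<notin> m" by (rule i)
      show "coeff p0 i \<in> S" using p0(1) by (simp add: over_def)
      fix \<phi> \<theta> assume *: "hom_mod m S \<phi> \<and> algebraic \<theta> \<and> \<phi> ` S \<subseteq> num_field \<theta> \<and> \<phi> (coeff p0 i) \<noteq> 0"
      then have \<phi>: "hom_mod m S \<phi>" by blast
      have "coeff (map_poly \<phi> p0) i \<noteq> 0" using * by (simp add: coeff_map_hom[OF \<phi>])
      then have "map_poly \<phi> p0 \<noteq> 0" by auto
      then have "finite {v. poly (map_poly \<phi> p0) v = 0}" by (rule poly_roots_finite)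
      moreover have "infinite (range (of_nat :: nat \<Rightarrow> complex))"
        by (metis finite_imageD infinite_UNIV_nat inj_of_nat)
      ultimately have "\<not> range of_nat \<subseteq> {v. poly (map_poly \<phi> p0) v = 0}" by (metis finite_subset)
      then obtain c :: nat where c: "poly (map_poly \<phi> p0) (of_nat c) \<noteq> 0" by blast
      have W: "poly (map_poly \<phi> p) (of_nat c) = 0" if p: "over S p" "poly p y \<in> m" for p
      proof -
        have "map_poly \<phi> p = 0" using trans[OF p] p(1)
          by (auto simp: poly_eq_iff coeff_map_hom[OF \<phi>] over_def intro: hom_ideal[OF \<phi>])
        then show ?thesis by simp
      qed
      obtain \<psi> where \<psi>: "hom_mod m (adjoin S y) \<psi>" "\<And>p. over S p \<Longrightarrow> \<psi> (poly p y) = poly (map_poly \<phi> p) (of_nat c)"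
        using extend_hom_mod[OF \<phi> W] by blast
      have "\<psi> ` adjoin S y \<subseteq> num_field \<theta>"
        by (rule into[OF _ _ \<psi>(2) \<phi>]) (use * Rats_num_field in auto)
      moreover have "\<psi> s \<noteq> 0" using c \<psi>(2)[OF p0(1)] p0(2) by simp
      ultimately show "\<exists>\<psi> \<eta>. hom_mod m (adjoin S y) \<psi> \<and> algebraic \<eta> \<and> \<psi> ` adjoin S y \<subseteq> num_field \<eta> \<and> \<psi> s \<noteq> 0"
        using \<psi>(1) * by blast
    qed
  next
    case True
    then obtain q where "over S q \<and> poly q y \<in> m \<and> lead_coeff q \<notin> m"
      using ex_lead_coeff_not_in_ideal ideal_diff_iff by metis
    then have "\<exists>F. (over S F \<and> poly F y \<in> m \<and> lead_coeff F \<notin> m) \<and>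
        (\<forall>q. over S q \<and> poly q y \<in> m \<and> lead_coeff q \<notin> m \<longrightarrow> degree F \<le> degree q)"
      by (rule ex_has_least_nat[of "\<lambda>F. over S F \<and> poly F y \<in> m \<and> lead_coeff F \<notin> m" q degree])
    then obtain F where F': "over S F \<and> poly F y \<in> m \<and> lead_coeff F \<notin> m"
      and F_min: "\<And>q. over S q \<and> poly q y \<in> m \<and> lead_coeff q \<notin> m \<Longrightarrow> degree F \<le> degree q"
      by (elim exE conjE) (rule that, blast+)
    from F' have F: "over S F" "poly F y \<in> m" "lead_coeff F \<notin> m" by auto
    note dF = minimal_eq_degree[OF F F_min]
    note coeffs = minimal_eq_coeffs[OF F F_min]
    obtain q c where qc: "over S q" "c \<in> S" "c \<notin> m" "poly q y * poly p0 y - c \<in> m"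
      using ex_dividing_constant[OF F F_min p0(1)] s(2) p0(2) by blast
    have lS: "lead_coeff F \<in> S" using F by (simp add: over_def)
    show ?thesis
    proof (intro bexI conjI allI impI)
      show "lead_coeff F * c \<notin> m" using ideal_prime F(3) qc(3) by blast
      show "lead_coeff F * c \<in> S" using lS qc(2) by (rule subring_mult[OF S])
      fix \<phi> \<theta> assume *: "hom_mod m S \<phi> \<and> algebraic \<theta> \<and> \<phi> ` S \<subseteq> num_field \<theta> \<and> \<phi> (lead_coeff F * c) \<noteq> 0"
      then have \<phi>: "hom_mod m S \<phi>" by blast
      have nz: "\<phi> (lead_coeff F) \<noteq> 0" "\<phi> c \<noteq> 0" using * hom_mult[OF \<phi> lS qc(2)] by auto
      define G where "G = map_poly \<phi> F"
      have "degree G \<ge> degree F" using nz(1) by (intro le_degree) (simp add: G_def coeff_map_hom[OF \<phi>])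
      then have dG: "degree G > 0" using dF by simp
      then have "\<not> constant (poly G)" by (simp add: constant_degree)
      then obtain v where v: "poly G v = 0" using fundamental_theorem_of_algebra by blast
      have "over (num_field \<theta>) G" using F * by (auto simp: G_def over_def coeff_map_hom[OF \<phi>])
      moreover have "G \<noteq> 0" using dG by auto
      ultimately obtain \<eta> where \<eta>: "algebraic \<eta>" "num_field \<theta> \<subseteq> num_field \<eta>" "v \<in> num_field \<eta>"
        using primitive_element[of \<theta> G v] v * by blast
      have W: "poly (map_poly \<phi> p) v = 0" if p: "over S p" "poly p y \<in> m" for p
      proof -
        obtain k t r where tr: "over S t" "over S r" "smult (lead_coeff F ^ k) p = t * F + r" "degree r < degree F"
          using pseudo_division[OF S F(1) dF p(1)] by blast
        have "poly r y = lead_coeff F ^ k * poly p y - poly t y * poly F y"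
          using arg_cong[OF tr(3), of "\<lambda>p. poly p y"] by simp
        also have "\<dots> \<in> m" by (rule ideal_diff[OF ideal_mult[OF p(2)] ideal_mult[OF F(2)]])
        finally have "coeff r i \<in> m" for i using coeffs[OF _ tr(2) _ tr(4)] by blast
        then have "map_poly \<phi> r = 0" using tr(2)
          by (auto simp: poly_eq_iff coeff_map_hom[OF \<phi>] over_def intro: hom_ideal[OF \<phi>])
        moreover have "smult (\<phi> (lead_coeff F) ^ k) (map_poly \<phi> p) = map_poly \<phi> t * G + map_poly \<phi> r"
          using arg_cong[OF tr(3), of "map_poly \<phi>"] p(1) tr(1,2) F(1) lS
          by (simp add: map_hom_smult[OF \<phi>] map_hom_add[OF \<phi>] map_hom_mult[OF \<phi>] over_mult[OF S]
              subring_power[OF S] hom_power[OF \<phi>] G_def)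
        ultimately have "\<phi> (lead_coeff F) ^ k * poly (map_poly \<phi> p) v = poly (map_poly \<phi> t) v * poly G v"
          by (metis add.right_neutral poly_mult poly_smult)
        then show ?thesis using v nz(1) by simp
      qed
      obtain \<psi> where \<psi>: "hom_mod m (adjoin S y) \<psi>" "\<And>p. over S p \<Longrightarrow> \<psi> (poly p y) = poly (map_poly \<phi> p) v"
        using extend_hom_mod[OF \<phi> W] by blast
      have "\<psi> ` adjoin S y \<subseteq> num_field \<eta>"
        by (rule into[OF _ \<eta>(3) \<psi>(2) \<phi>]) (use * \<eta>(2) in auto)
      moreover have "\<psi> s \<noteq> 0"
      proof
        assume "\<psi> s = 0"
        then have "poly (map_poly \<phi> p0) v = 0" using \<psi>(2)[OF p0(1)] p0(2) by simp
        moreover have "over S (q * p0 - [:c:])"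
          by (intro over_diff[OF S] over_mult[OF S] over_const[OF S] qc(1,2) p0(1))
        then have "poly (map_poly \<phi> (q * p0 - [:c:])) v = 0" using qc(4) by (intro W) simp_all
        moreover have "map_poly \<phi> (q * p0 - [:c:]) = map_poly \<phi> q * map_poly \<phi> p0 - [:\<phi> c:]"
          using qc p0(1) by (simp add: map_hom_diff[OF \<phi>] map_hom_mult[OF \<phi>] map_hom_const[OF \<phi>] over_mult[OF S] over_const[OF S])
        ultimately show False using nz(2) by simp
      qed
      ultimately show "\<exists>\<psi> \<eta>. hom_mod m (adjoin S y) \<psi> \<and> algebraic \<eta> \<and> \<psi> ` adjoin S y \<subseteq> num_field \<eta> \<and> \<psi> s \<noteq> 0"
        using \<psi>(1) \<eta>(1) by blast
    qed
  qed
qed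

end

text \<open>
  A weak Nullstellensatz for the domain generated by \<open>ys\<close> modulo \<open>m\<close>. The generators are adjoined to the
  integers one after another. The induction has to provide points at which a given nonzero element does not
  vanish, because the extension to the next generator asks for that.
\<close>

lemma ex_algebraic_point:
  fixes m :: "'r::comm_ring_1 set"
  assumes m: "prime_ideal_set m" and char: "\<And>k. of_int k \<in> m \<Longrightarrow> k = 0"
  shows "\<exists>S \<phi> \<theta>. subring_set S \<and> set ys \<subseteq> S \<and> hom_mod m S \<phi> \<and> algebraic \<theta> \<and> \<phi> ` S \<subseteq> num_field \<theta>"
proof -
  define A where "A ys = foldr (\<lambda>y S. adjoin S y) ys (range of_int :: 'r set)" for ys
  have A: "subring_set (A ys)" for ys
  proof (induction ys)
    case Nil
    have "0 \<in> range (of_int :: int \<Rightarrow> 'r)" "1 \<in> range (of_int :: int \<Rightarrow> 'r)"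
      by (metis of_int_0 rangeI, metis of_int_1 rangeI)
    then show ?case unfolding A_def subring_set_def foldr.simps id_apply
      by (auto simp flip: of_int_add of_int_diff of_int_mult)
  qed (simp add: A_def subring_set_adjoin)
  have ys: "set ys \<subseteq> A ys" for ys
    by (induction ys) (use A subset_adjoin self_adjoin in \<open>force simp: A_def\<close>)+
  have "\<exists>\<phi> \<theta>. hom_mod m (A ys) \<phi> \<and> algebraic \<theta> \<and> \<phi> ` A ys \<subseteq> num_field \<theta> \<and> \<phi> s \<noteq> 0"
    if "s \<in> A ys" "s \<notin> m" for s
    using that
  proof (induction ys arbitrary: s)
    case Nil
    define \<phi> :: "'r \<Rightarrow> complex" where "\<phi> x = of_int (SOME k. of_int k = x)" for x
    have \<phi>: "\<phi> (of_int k) = of_int k" for k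
    proof -
      define l where "l = (SOME l. of_int l = (of_int k :: 'r))"
      have "of_int l = (of_int k :: 'r)" unfolding l_def by (rule someI[of _ k]) simp
      then have "of_int (l - k) \<in> m" using prime_ideal_simps(1)[OF m subring_set_UNIV] by simp
      then show ?thesis using char[of "l - k"] by (simp add: \<phi>_def flip: l_def)
    qed
    have "hom_mod m (range of_int) \<phi>" unfolding hom_mod_def
    proof (intro conjI ballI impI)
      show "\<phi> 1 = 1" using \<phi>[of 1] by simp
      fix x y :: 'r assume "x \<in> range of_int" "y \<in> range of_int"
      then obtain k l where "x = of_int k" "y = of_int l" by blast
      then show "\<phi> (x + y) = \<phi> x + \<phi> y" "\<phi> (x * y) = \<phi> x * \<phi> y"
        using \<phi>[of "k + l"] \<phi>[of "k * l"] \<phi> by auto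
    next
      fix x :: 'r assume "x \<in> range of_int" "x \<in> m"
      then show "\<phi> x = 0" using char \<phi> by auto
    qed
    moreover have "\<phi> ` range of_int \<subseteq> num_field 0" using \<phi> Rats_num_field by auto
    moreover have "\<phi> s \<noteq> 0" using Nil \<phi> prime_ideal_simps(1)[OF m subring_set_UNIV] by (auto simp: A_def)
    ultimately show ?case unfolding A_def foldr.simps id_apply by (intro exI[of _ \<phi>] exI[of _ 0]) simp
  next
    case (Cons y ys)
    then have "s \<in> adjoin (A ys) y" by (simp add: A_def)
    from extend_hom_mod_nonzero[OF m A this Cons.prems(2)] obtain s' where s': "s' \<in> A ys" "s' \<notin> m"
      and ext: "\<forall>\<phi> \<theta>. hom_mod m (A ys) \<phi> \<and> algebraic \<theta> \<and> \<phi> ` A ys \<subseteq> num_field \<theta> \<and> \<phi> s' \<noteq> 0 \<longrightarrow>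
        (\<exists>\<psi> \<eta>. hom_mod m (adjoin (A ys) y) \<psi> \<and> algebraic \<eta> \<and> \<psi> ` adjoin (A ys) y \<subseteq> num_field \<eta> \<and> \<psi> s \<noteq> 0)"
      by blast
    have "A (y # ys) = adjoin (A ys) y" by (simp add: A_def)
    then show ?case using ext Cons.IH[OF s'] by metis
  qed
  from this[OF subring_one[OF A] prime_ideal_simps(2)[OF m subring_set_UNIV]] show ?thesis using A ys by blast
qed

section \<open>Fixed points from proper submodules\<close>

text \<open>
  For relations in place of functions, so that it applies to homomorphisms that are defined only on a subring or
  have values determined only modulo a prime.
\<close>

lemma act_transfer:
  assumes R: "\<And>x y u v. R x u \<Longrightarrow> R y v \<Longrightarrow> R (x + y) (u + v) \<and> R (x - y) (u - v) \<and> R (x * y) (u * v)"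
    and gen: "\<And>i. i \<in> fst ` set w \<Longrightarrow> R (a i) (a' i) \<and> R (b i) (b' i) \<and> R (d i) (d' i)"
    and t: "R t t'"
  shows "R (act a b d w t) (act a' b' d' w t')"
  using gen
proof (induction w)
  case (Cons l w)
  then show ?case by (cases "snd l") (auto intro!: R[THEN conjunct1] R[THEN conjunct2, THEN conjunct1]
      R[THEN conjunct2, THEN conjunct2])
qed (simp add: t)

text \<open>
  The image of zero under a word is linear in the translation parts of the generators; its
  coefficients are the Fox derivatives of the word, evaluated at the slopes.
\<close>

definition fox :: "(nat \<Rightarrow> 'r::comm_ring_1) \<Rightarrow> (nat \<Rightarrow> 'r) \<Rightarrow> word \<Rightarrow> nat \<Rightarrow> 'r" where
  "fox a b w i = act a b (\<lambda>l. of_bool (l = i)) w 0"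

lemma act_eq_sum_fox:
  assumes "fst ` set w \<subseteq> {..<n}"
  shows "act a b d w 0 = (\<Sum>i<n. d i * fox a b w i)"
  using assms
proof (induction w)
  case (Cons l w)
  have d: "d (fst l) = (\<Sum>i<n. d i * of_bool (fst l = i))" using Cons.prems by simp
  have IH: "act a b d w 0 = (\<Sum>i<n. d i * fox a b w i)" using Cons by auto
  show ?case
  proof (cases "snd l")
    case True
    then have "(\<Sum>i<n. d i * fox a b (l # w) i) = (\<Sum>i<n. a (fst l) * (d i * fox a b w i) + d i * of_bool (fst l = i))"
      by (intro sum.cong) (auto simp: fox_def algebra_simps)
    also have "\<dots> = a (fst l) * act a b d w 0 + d (fst l)"
      by (simp only: sum.distrib sum_distrib_left[symmetric] IH[symmetric] d[symmetric])
    finally show ?thesis using True by simp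
  next
    case False
    then have "(\<Sum>i<n. d i * fox a b (l # w) i) = (\<Sum>i<n. b (fst l) * (d i * fox a b w i) - b (fst l) * (d i * of_bool (fst l = i)))"
      by (intro sum.cong) (auto simp: fox_def algebra_simps)
    also have "\<dots> = b (fst l) * act a b d w 0 - b (fst l) * d (fst l)"
      by (simp only: sum_subtractf sum_distrib_left[symmetric] IH[symmetric] d[symmetric])
    finally show ?thesis using False by (simp add: right_diff_distrib)
  qed
qed (simp add: fox_def)

lemma fox_eq_0: "i \<notin> fst ` set w \<Longrightarrow> fox a b w i = 0"
  unfolding fox_def by (induction w) auto

definition submodule_set :: "(nat \<Rightarrow> 'r::comm_ring_1) set \<Rightarrow> bool" where
  "submodule_set L \<longleftrightarrow> (\<lambda>_. 0) \<in> L \<and> (\<forall>x\<in>L. \<forall>y\<in>L. (\<lambda>i. x i + y i) \<in> L) \<and> (\<forall>r. \<forall>x\<in>L. (\<lambda>i. r * x i) \<in> L)"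

definition unit_vec :: "nat \<Rightarrow> nat \<Rightarrow> 'r::comm_ring_1" where
  "unit_vec i = (\<lambda>l. of_bool (l = i))"

lemma submodule_set_simps:
  assumes "submodule_set L"
  shows submodule_zero: "(\<lambda>_. 0) \<in> L"
    and submodule_add: "x \<in> L \<Longrightarrow> y \<in> L \<Longrightarrow> (\<lambda>i. x i + y i) \<in> L"
    and submodule_scale: "x \<in> L \<Longrightarrow> (\<lambda>i. r * x i) \<in> L"
  using assms by (auto simp: submodule_set_def)

lemma submodule_diff:
  assumes "submodule_set L" "x \<in> L" "y \<in> L" shows "(\<lambda>i. x i - y i) \<in> L"
  using submodule_add[OF assms(1,2) submodule_scale[OF assms(1,3), of "- 1"]] by simp

lemma submodule_sum:
  assumes L: "submodule_set L" and "\<And>k. k \<in> I \<Longrightarrow> f k \<in> L" shows "(\<lambda>i. \<Sum>k\<in>I. f k i) \<in> L"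
  using assms(2)
  by (induction I rule: infinite_finite_induct) (auto intro: submodule_zero[OF L] submodule_add[OF L])

text \<open>
  By Zorn's lemma: finitely many vectors are missing if any, so they cannot all appear only in the union of a chain.
\<close>

lemma ex_maximal_submodule:
  assumes L0: "submodule_set L0" "\<exists>i<n. unit_vec i \<notin> L0"
  obtains M where "submodule_set M" "L0 \<subseteq> M" "\<exists>i<n. unit_vec i \<notin> M"
    "\<And>L. submodule_set L \<Longrightarrow> M \<subset> L \<Longrightarrow> \<forall>i<n. unit_vec i \<in> L"
proof -
  define \<A> where "\<A> = {L. submodule_set L \<and> L0 \<subseteq> L \<and> (\<exists>i<n. unit_vec i \<notin> L)}"
  have "\<exists>M\<in>\<A>. \<forall>X\<in>\<A>. M \<subseteq> X \<longrightarrow> X = M"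
  proof (rule subset_Zorn_nonempty)
    show "\<A> \<noteq> {}" using L0 by (auto simp: \<A>_def)
    fix \<C> assume C: "\<C> \<noteq> {}" "subset.chain \<A> \<C>"
    have sub: "\<And>L. L \<in> \<C> \<Longrightarrow> L \<in> \<A>" using C(2) by (auto simp: subset.chain_def)
    have pair: "\<exists>L\<in>\<C>. x \<in> L \<and> y \<in> L" if "x \<in> \<Union>\<C>" "y \<in> \<Union>\<C>" for x y
    proof -
      have "finite {x, y}" "{x, y} \<subseteq> \<Union>\<C>" using that by auto
      then obtain L where "L \<in> \<C>" "{x, y} \<subseteq> L" by (rule finite_subset_Union_chain[OF _ _ C])
      then show ?thesis by auto
    qed
    have subm: "\<And>L. L \<in> \<C> \<Longrightarrow> submodule_set L" using sub by (simp add: \<A>_def)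
    have "submodule_set (\<Union>\<C>)" unfolding submodule_set_def
    proof (intro conjI ballI allI)
      show "(\<lambda>_. 0) \<in> \<Union>\<C>" using C(1) sub by (auto simp: \<A>_def submodule_set_def)
    next
      fix x y assume "x \<in> \<Union>\<C>" "y \<in> \<Union>\<C>"
      then obtain L where L: "L \<in> \<C>" "x \<in> L" "y \<in> L" using pair by blast
      show "(\<lambda>i. x i + y i) \<in> \<Union>\<C>" using submodule_add[OF subm[OF L(1)] L(2,3)] L(1) by blast
    next
      fix x r assume "x \<in> \<Union>\<C>"
      then obtain L where L: "L \<in> \<C>" "x \<in> L" by blast
      show "(\<lambda>i. r * x i) \<in> \<Union>\<C>" using submodule_scale[OF subm[OF L(1)] L(2)] L(1) by blast
    qed
    moreover have "L0 \<subseteq> \<Union>\<C>" using C(1) sub by (fastforce simp: \<A>_def)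
    moreover have "\<exists>i<n. unit_vec i \<notin> \<Union>\<C>"
    proof (rule ccontr)
      assume "\<not> ?thesis"
      then have "finite (unit_vec ` {..<n})" "unit_vec ` {..<n} \<subseteq> \<Union>\<C>" by auto
      then obtain L where "L \<in> \<C>" "unit_vec ` {..<n} \<subseteq> L" by (rule finite_subset_Union_chain[OF _ _ C])
      then show False using sub by (fastforce simp: \<A>_def)
    qed
    ultimately show "\<Union>\<C> \<in> \<A>" by (simp add: \<A>_def)
  qed
  then obtain M where M: "M \<in> \<A>" "\<And>X. X \<in> \<A> \<Longrightarrow> M \<subseteq> X \<Longrightarrow> X = M" by blast
  show ?thesis
  proof (rule that[of M])
    show "submodule_set M" "L0 \<subseteq> M" "\<exists>i<n. unit_vec i \<notin> M" using M(1) by (auto simp: \<A>_def)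
    show "\<forall>i<n. unit_vec i \<in> L" if "submodule_set L" "M \<subset> L" for L
    proof (rule ccontr)
      assume "\<not> ?thesis"
      then have "L \<in> \<A>" using that M(1) by (auto simp: \<A>_def)
      then show False using M(2)[of L] that(2) by blast
    qed
  qed
qed

text \<open>
  If the Fox derivatives of the words lie in a proper submodule of the free module of rank \<open>n\<close>, then
  a maximal submodule containing it has a field as quotient, in which the classes of the unit vectors
  are translation parts such that all words fix zero. This solution is moved to an algebraic number
  field and from there to a prime field.
\<close>

theorem ex_obstruction:
  fixes L0 :: "(nat \<Rightarrow> 'r::comm_ring_1) set"
  assumes ab: "\<And>i. i < n \<Longrightarrow> a i * b i = 1"
    and L0: "submodule_set L0" "\<exists>i<n. unit_vec i \<notin> L0"
    and ws: "\<And>w. w \<in> set ws \<Longrightarrow> fst ` set w \<subseteq> {..<n}" "\<And>w. w \<in> set ws \<Longrightarrow> fox a b w \<in> L0"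
    and unit: "\<And>k. k \<noteq> 0 \<Longrightarrow> \<exists>r::'r. r * of_int k = 1"
  shows "\<exists>p. obstructed p n ws"
proof -
  obtain M where M: "submodule_set M" "L0 \<subseteq> M" "\<exists>i<n. unit_vec i \<notin> M"
    and max: "\<And>L. submodule_set L \<Longrightarrow> M \<subset> L \<Longrightarrow> \<forall>i<n. unit_vec i \<in> L"
    using ex_maximal_submodule[OF L0] by metis
  note M_simps = submodule_zero[OF M(1)] submodule_add[OF M(1)] submodule_scale[OF M(1)]
  obtain i0 where i0: "i0 < n" "unit_vec i0 \<notin> M" using M(3) by blast
  define e where "e = (unit_vec i0 :: nat \<Rightarrow> 'r)"
  have e: "e \<notin> M" using i0 by (simp add: e_def)
  have span: "\<exists>y\<in>M. \<exists>r. unit_vec i = (\<lambda>l. y l + r * x l)" if x: "x \<notin> M" and i: "i < n" for x i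
  proof -
    define L where "L = {\<lambda>l. y l + r * x l |y r. y \<in> M}"
    have "submodule_set L" unfolding submodule_set_def
    proof (intro conjI ballI allI)
      show "(\<lambda>_. 0) \<in> L" unfolding L_def
        by (rule CollectI, rule exI[of _ "\<lambda>_. 0"], rule exI[of _ 0]) (simp add: M_simps(1))
    next
      fix u v assume "u \<in> L" "v \<in> L"
      then obtain y r z s where "u = (\<lambda>l. y l + r * x l)" "y \<in> M" "v = (\<lambda>l. z l + s * x l)" "z \<in> M"
        by (auto simp: L_def)
      then show "(\<lambda>l. u l + v l) \<in> L" unfolding L_def
        by (intro CollectI exI[of _ "\<lambda>l. y l + z l"] exI[of _ "r + s"]) (auto simp: M_simps(2) algebra_simps)
    next
      fix u t assume "u \<in> L"
      then obtain y r where "u = (\<lambda>l. y l + r * x l)" "y \<in> M" by (auto simp: L_def)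
      then show "(\<lambda>l. t * u l) \<in> L" unfolding L_def
        by (intro CollectI exI[of _ "\<lambda>l. t * y l"] exI[of _ "t * r"]) (auto simp: M_simps(3) algebra_simps)
    qed
    moreover have "M \<subseteq> L"
    proof
      fix y assume "y \<in> M"
      then show "y \<in> L" unfolding L_def by (intro CollectI exI[of _ y] exI[of _ 0]) simp
    qed
    moreover have "x \<in> L" unfolding L_def
      by (rule CollectI, rule exI[of _ "\<lambda>_. 0"], rule exI[of _ 1]) (simp add: M_simps(1))
    ultimately have "unit_vec i \<in> L" using max[of L] x i by blast
    then show ?thesis by (auto simp: L_def)
  qed
  \<comment> \<open>The annihilator of the class of \<open>e\<close>. Modulo \<open>M\<close>, all unit vectors are multiples of \<open>e\<close>, so their span is
    isomorphic to the ring modulo \<open>m\<close>.\<close>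
  define m where "m = {r. (\<lambda>l. r * e l) \<in> M}"
  have one: "1 \<notin> m" using e by (simp add: m_def)
  have m_mult: "r * x \<in> m" if "x \<in> m" for r x
    using M_simps(3)[of "\<lambda>l. x * e l" r] that by (simp add: m_def mult.assoc)
  have m: "prime_ideal_set m" unfolding prime_ideal_set_def
  proof (intro conjI ballI allI impI one m_mult)
    show "0 \<in> m" using M_simps(1) by (simp add: m_def)
    show "x + y \<in> m" if "x \<in> m" "y \<in> m" for x y
      using M_simps(2)[of "\<lambda>l. x * e l" "\<lambda>l. y * e l"] that by (simp add: m_def distrib_right)
    show "x \<in> m \<or> y \<in> m" if xy: "x * y \<in> m" for x y
    proof (rule disjCI)
      assume "y \<notin> m"
      then have "(\<lambda>l. y * e l) \<notin> M" by (simp add: m_def)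
      then obtain z t where z: "z \<in> M" "e = (\<lambda>l. z l + t * (y * e l))"
        using span[OF _ i0(1)] unfolding e_def by blast
      have "(\<lambda>l. x * z l + t * (x * y * e l)) \<in> M"
        using M_simps(2)[OF M_simps(3)[OF z(1)] M_simps(3)] xy by (simp add: m_def)
      also have "(\<lambda>l. x * z l + t * (x * y * e l)) = (\<lambda>l. x * (z l + t * (y * e l)))"
        by (simp add: algebra_simps)
      also have "\<dots> = (\<lambda>l. x * e l)" by (subst (2) z(2)) (rule refl)
      finally show "x \<in> m" by (simp add: m_def)
    qed
  qed
  have char: "k = 0" if k: "of_int k \<in> m" for k
  proof (rule ccontr)
    assume "k \<noteq> 0"
    then obtain r where "r * of_int k = (1 :: 'r)" using unit by blast
    then show False using m_mult[OF k, of r] one by simp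
  qed
  have "\<exists>d. \<exists>y\<in>M. unit_vec i = (\<lambda>l. y l + d * e l)" if "i < n" for i using span[OF e that] by blast
  then obtain d0 where d0: "\<And>i. i < n \<Longrightarrow> \<exists>y\<in>M. unit_vec i = (\<lambda>l. y l + d0 i * e l)" by metis
  \<comment> \<open>The class of the \<open>i\<close>-th unit vector is \<open>d i\<close> times the class of \<open>e\<close>.\<close>
  define d where "d = d0(i0 := 1)"
  have "\<exists>y\<in>M. unit_vec i = (\<lambda>l. y l + d i * e l)" if "i < n" for i
  proof (cases "i = i0")
    case True
    then show ?thesis using M_simps(1) by (intro bexI[of _ "\<lambda>_. 0"]) (simp_all add: d_def e_def)
  qed (use d0 that in \<open>auto simp: d_def\<close>)
  then obtain y where y: "\<And>i. i < n \<Longrightarrow> y i \<in> M" "\<And>i. i < n \<Longrightarrow> unit_vec i = (\<lambda>l. y i l + d i * e l)" by metis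
  have act_m: "act a b d w 0 \<in> m" if w: "w \<in> set ws" for w
  proof -
    have J: "fox a b w l = (\<Sum>i<n. fox a b w i * y i l) + act a b d w 0 * e l" for l
    proof -
      have "fox a b w l = (\<Sum>i<n. fox a b w i * unit_vec i l)"
      proof (cases "l < n")
        case False
        then have "l \<notin> fst ` set w" using ws(1)[OF w] by auto
        with False show ?thesis by (auto simp: fox_eq_0 unit_vec_def intro!: sum.neutral[symmetric])
      qed (simp add: unit_vec_def)
      also have "\<dots> = (\<Sum>i<n. fox a b w i * (y i l + d i * e l))" using y(2) by (intro sum.cong) auto
      also have "\<dots> = (\<Sum>i<n. fox a b w i * y i l) + (\<Sum>i<n. d i * fox a b w i) * e l"
        by (simp add: distrib_left sum.distrib) (simp add: sum_distrib_left sum_distrib_right ac_simps)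
      finally show ?thesis by (simp add: act_eq_sum_fox[OF ws(1)[OF w]])
    qed
    have "(\<lambda>l. \<Sum>i<n. fox a b w i * y i l) \<in> M"
      using y(1) by (intro submodule_sum[OF M(1)] M_simps(3)) auto
    moreover have "fox a b w \<in> M" using ws(2)[OF w] M(2) by blast
    ultimately have "(\<lambda>l. fox a b w l - (\<Sum>i<n. fox a b w i * y i l)) \<in> M" by (intro submodule_diff[OF M(1)])
    also have "(\<lambda>l. fox a b w l - (\<Sum>i<n. fox a b w i * y i l)) = (\<lambda>l. act a b d w 0 * e l)"
      using J by (intro ext) (metis add_diff_cancel_left')
    finally show ?thesis by (simp add: m_def)
  qed
  have "\<exists>S \<phi> \<theta>. subring_set S \<and> set (map a [0..<n] @ map b [0..<n] @ map d [0..<n]) \<subseteq> S \<and>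
      hom_mod m S \<phi> \<and> algebraic \<theta> \<and> \<phi> ` S \<subseteq> num_field \<theta>"
    by (rule ex_algebraic_point[OF m]) (rule char)
  then obtain S \<phi> \<theta> where S: "subring_set S" "set (map a [0..<n] @ map b [0..<n] @ map d [0..<n]) \<subseteq> S"
    and \<phi>: "hom_mod m S \<phi>" "\<phi> ` S \<subseteq> num_field \<theta>" and \<theta>: "algebraic \<theta>"
    by (elim exE conjE) (rule that)
  have inS: "a i \<in> S" "b i \<in> S" "d i \<in> S" if "i < n" for i using S(2) that by auto
  define A where "A = (\<lambda>i. \<phi> (a i)) ` {..<n} \<union> (\<lambda>i. \<phi> (b i)) ` {..<n} \<union> (\<lambda>i. \<phi> (d i)) ` {..<n}"
  have "finite A" "A \<subseteq> num_field \<theta>" using \<phi>(2) inS by (auto simp: A_def)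
  from ex_reduction[OF \<theta> this] obtain p R where red: "reduction p R" and RA: "\<forall>z\<in>A. \<exists>u. R z u"
    by (elim exE conjE) (rule that)
  have "\<forall>i. \<exists>u. i < n \<longrightarrow> R (\<phi> (a i)) u" "\<forall>i. \<exists>u. i < n \<longrightarrow> R (\<phi> (b i)) u" "\<forall>i. \<exists>u. i < n \<longrightarrow> R (\<phi> (d i)) u"
    using RA by (auto simp: A_def)
  then obtain a' b' d' where a': "\<And>i. i < n \<Longrightarrow> R (\<phi> (a i)) (a' i)"
    and b': "\<And>i. i < n \<Longrightarrow> R (\<phi> (b i)) (b' i)" and d': "\<And>i. i < n \<Longrightarrow> R (\<phi> (d i)) (d' i)"
    unfolding choice_iff by blast
  have R1: "R 1 1" and R0: "\<And>u. R 0 u \<Longrightarrow> int p dvd u" and p: "prime p"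
    and Rops: "\<And>y z u v. R y u \<Longrightarrow> R z v \<Longrightarrow> R (y + z) (u + v) \<and> R (y - z) (u - v) \<and> R (y * z) (u * v)"
    using red by (simp_all add: reduction_def)
  have R1_dvd: "int p dvd u - 1" if u: "R 1 u" for u
    using Rops[OF u R1] by (intro R0) simp
  have "fixed_point p n ws a' b' d'" unfolding fixed_point_def
  proof (intro conjI allI impI ballI)
    fix i assume i: "i < n"
    have "\<phi> (a i) * \<phi> (b i) = \<phi> (a i * b i)" using hom_mult[OF m S(1) \<phi>(1) inS(1,2)[OF i]] by simp
    also have "\<dots> = 1" using ab[OF i] hom_one[OF m S(1) \<phi>(1)] by simp
    finally have "R 1 (a' i * b' i)" using Rops[OF a'[OF i] b'[OF i]] by simp
    then show "[a' i * b' i = 1] (mod int p)" using R1_dvd by (simp add: cong_iff_dvd_diff)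
  next
    have "\<phi> (d i0) = 1" using hom_one[OF m S(1) \<phi>(1)] by (simp add: d_def)
    then have "int p dvd d' i0 - 1" using R1_dvd d'[OF i0(1)] by simp
    then have "\<not> int p dvd d' i0" using p
      by (metis dvd_diff_right_iff int_dvd_int_iff not_prime_unit of_nat_1)
    then show "\<exists>i<n. \<not> int p dvd d' i" using i0(1) by blast
  next
    fix w assume w: "w \<in> set ws"
    have lt: "i < n" if "i \<in> fst ` set w" for i using ws(1)[OF w] that by auto
    have "act a b d w 0 \<in> S \<and> \<phi> (act a b d w 0) = act (\<phi> \<circ> a) (\<phi> \<circ> b) (\<phi> \<circ> d) w 0"
    proof (rule act_transfer[of "\<lambda>x z. x \<in> S \<and> \<phi> x = z"])
      show "0 \<in> S \<and> \<phi> 0 = 0" using subring_zero[OF S(1)] hom_zero[OF m S(1) \<phi>(1)] by simp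
      show "(a i \<in> S \<and> \<phi> (a i) = (\<phi> \<circ> a) i) \<and> (b i \<in> S \<and> \<phi> (b i) = (\<phi> \<circ> b) i) \<and> (d i \<in> S \<and> \<phi> (d i) = (\<phi> \<circ> d) i)"
        if "i \<in> fst ` set w" for i using inS lt[OF that] by simp
    qed (auto simp: subring_add[OF S(1)] subring_diff[OF S(1)] subring_mult[OF S(1)]
        hom_add[OF m S(1) \<phi>(1)] hom_diff[OF m S(1) \<phi>(1)] hom_mult[OF m S(1) \<phi>(1)])
    moreover have "\<phi> (act a b d w 0) = 0" using calculation act_m[OF w] hom_ideal[OF m S(1) \<phi>(1)] by blast
    ultimately have 0: "act (\<phi> \<circ> a) (\<phi> \<circ> b) (\<phi> \<circ> d) w 0 = 0" by simp
    have "R (act (\<phi> \<circ> a) (\<phi> \<circ> b) (\<phi> \<circ> d) w 0) (act a' b' d' w 0)"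
    proof (rule act_transfer[of R])
      show "R 0 0" using Rops[OF R1 R1] by simp
    qed (use Rops a' b' d' lt in auto)
    then show "int p dvd act a' b' d' w 0" using R0 0 by simp
  qed
  then have "obstructed p n ws" using p unfolding obstructed_def by blast
  then show ?thesis ..
qed

section \<open>Certificates\<close>

text \<open>
  Letters and words as data for algorithms: the sign of a letter is a number, zero for the inverse
  of a generator.
\<close>

type_synonym nletter = "nat \<times> nat"
type_synonym nword = "nletter list"

definition word_of :: "nword \<Rightarrow> word" where
  "word_of w = map (\<lambda>l. (fst l, snd l \<noteq> 0)) w"

definition letter_sign :: "nat \<Rightarrow> 'r::comm_ring_1" where
  "letter_sign s = (if s = 0 then - 1 else 1)"

definition monomial :: "(nat \<Rightarrow> 'r::comm_ring_1) \<Rightarrow> (nat \<Rightarrow> 'r) \<Rightarrow> nword \<Rightarrow> 'r" where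
  "monomial a b u = foldr (\<lambda>l x. (if snd l \<noteq> 0 then a (fst l) else b (fst l)) * x) u 1"

text \<open>
  The terms of the Fox derivatives of a word. A term \<open>(s, i, u)\<close> belongs to the derivative with respect
  to the \<open>i\<close>-th generator; it is the monomial of \<open>u\<close> with sign \<open>s\<close>.
\<close>

definition fox_terms :: "nword \<Rightarrow> (nat \<times> nat \<times> nword) list" where
  "fox_terms w = foldr (\<lambda>l ts. (snd l, fst l, if snd l = 0 then [l] else []) #
     map (\<lambda>t. (fst t, fst (snd t), l # snd (snd t))) ts) w []"

definition term_val :: "(nat \<Rightarrow> 'r::comm_ring_1) \<Rightarrow> (nat \<Rightarrow> 'r) \<Rightarrow> (nat \<Rightarrow> 'r) \<Rightarrow> nat \<times> nat \<times> nword \<Rightarrow> 'r" where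
  "term_val a b d t = letter_sign (fst t) * (monomial a b (snd (snd t)) * d (fst (snd t)))"

lemma monomial_simps [simp]:
  "monomial a b [] = 1"
  "monomial a b (l # u) = (if snd l \<noteq> 0 then a (fst l) else b (fst l)) * monomial a b u"
  "monomial a b (u @ v) = monomial a b u * monomial a b v"
proof -
  show 1: "monomial a b [] = 1" and 2: "monomial a b (l # u) = (if snd l \<noteq> 0 then a (fst l) else b (fst l)) * monomial a b u" for l u
    by (simp_all add: monomial_def)
  show "monomial a b (u @ v) = monomial a b u * monomial a b v"
    by (induction u) (simp_all add: 1 2 mult.assoc)
qed

lemma act_eq_fox_terms: "act a b d (word_of w) 0 = sum_list (map (term_val a b d) (fox_terms w))"
proof (induction w)
  case (Cons l w)
  have *: "sum_list (map (term_val a b d) (map (\<lambda>t. (fst t, fst (snd t), l # snd (snd t))) ts)) =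
      (if snd l \<noteq> 0 then a (fst l) else b (fst l)) * sum_list (map (term_val a b d) ts)" for ts
    by (induction ts) (simp_all add: term_val_def algebra_simps)
  have "fox_terms (l # w) = (snd l, fst l, if snd l = 0 then [l] else []) #
     map (\<lambda>t. (fst t, fst (snd t), l # snd (snd t))) (fox_terms w)" by (simp add: fox_terms_def)
  then have "sum_list (map (term_val a b d) (fox_terms (l # w))) =
      term_val a b d (snd l, fst l, if snd l = 0 then [l] else []) +
      (if snd l \<noteq> 0 then a (fst l) else b (fst l)) * sum_list (map (term_val a b d) (fox_terms w))"
    using * by simp
  also have "\<dots> = act a b d (word_of (l # w)) 0"
    unfolding Cons.IH[symmetric] by (simp add: word_of_def term_val_def letter_sign_def algebra_simps)
  finally show ?case ..
qed (simp add: word_of_def fox_terms_def)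

text \<open>
  A combination of Fox derivatives: the list entry \<open>(s, w, v)\<close> stands for the derivatives of \<open>w\<close>
  multiplied by the sign \<open>s\<close> and the monomial of \<open>v\<close>.
\<close>

type_synonym combination = "(nat \<times> nword \<times> nword) list"

definition comb_terms :: "combination \<Rightarrow> (nat \<times> nat \<times> nword) list" where
  "comb_terms C = concat (map (\<lambda>c. map (\<lambda>t. (if fst c = 0 then (if fst t = 0 then 1 else 0) else fst t,
     fst (snd t), snd (snd c) @ snd (snd t))) (fox_terms (fst (snd c)))) C)"

definition comb_val :: "(nat \<Rightarrow> 'r::comm_ring_1) \<Rightarrow> (nat \<Rightarrow> 'r) \<Rightarrow> (nat \<Rightarrow> 'r) \<Rightarrow> combination \<Rightarrow> 'r" where
  "comb_val a b d C = sum_list (map (\<lambda>c. letter_sign (fst c) * (monomial a b (snd (snd c)) *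
     act a b d (word_of (fst (snd c))) 0)) C)"

lemma comb_val_eq_terms: "comb_val a b d C = sum_list (map (term_val a b d) (comb_terms C))"
proof (induction C)
  case (Cons c C)
  have *: "sum_list (map (term_val a b d) (map (\<lambda>t. (if fst c = 0 then (if fst t = 0 then 1 else 0) else fst t,
     fst (snd t), snd (snd c) @ snd (snd t))) ts)) =
     letter_sign (fst c) * (monomial a b (snd (snd c)) * sum_list (map (term_val a b d) ts))" for ts
    by (induction ts) (simp_all add: term_val_def letter_sign_def algebra_simps)
  have t: "comb_terms (c # C) = map (\<lambda>t. (if fst c = 0 then (if fst t = 0 then 1 else 0) else fst t,
     fst (snd t), snd (snd c) @ snd (snd t))) (fox_terms (fst (snd c))) @ comb_terms C" by (simp add: comb_terms_def)
  show ?case unfolding t map_append sum_list_append * act_eq_fox_terms[symmetric]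
    using Cons.IH by (simp add: comb_val_def)
qed (simp add: comb_val_def comb_terms_def)

definition pos_count :: "nat \<Rightarrow> nword \<Rightarrow> nat" where
  "pos_count i u = length (filter (\<lambda>l. fst l = i \<and> snd l \<noteq> 0) u)"

definition neg_count :: "nat \<Rightarrow> nword \<Rightarrow> nat" where
  "neg_count i u = length (filter (\<lambda>l. fst l = i \<and> snd l = 0) u)"

text \<open>
  Equality in the free abelian group, where the difference of positive and negative occurrences counts. The
  equation avoids subtraction, and only letters of the two words have to be examined.
\<close>

definition same_exp :: "nword \<Rightarrow> nword \<Rightarrow> bool" where
  "same_exp u v \<longleftrightarrow> (\<forall>l\<in>set (u @ v). pos_count (fst l) u + neg_count (fst l) v = pos_count (fst l) v + neg_count (fst l) u)"

definition exponent :: "nword \<Rightarrow> nat \<Rightarrow> int" where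
  "exponent u i = int (pos_count i u) - int (neg_count i u)"

lemma counts_eq_0: "i \<notin> fst ` set u \<Longrightarrow> pos_count i u = 0 \<and> neg_count i u = 0"
  by (auto simp: pos_count_def neg_count_def filter_empty_conv)

lemma same_exp_iff: "same_exp u v \<longleftrightarrow> exponent u = exponent v"
proof
  assume *: "same_exp u v"
  show "exponent u = exponent v"
  proof
    fix i
    show "exponent u i = exponent v i"
    proof (cases "i \<in> fst ` set (u @ v)")
      case True
      then have "pos_count i u + neg_count i v = pos_count i v + neg_count i u"
        using * unfolding same_exp_def by blast
      then show ?thesis by (simp add: exponent_def)
    next
      case False
      then show ?thesis using counts_eq_0[of i u] counts_eq_0[of i v] by (simp add: exponent_def image_Un)
    qed
  qed
next
  assume "exponent u = exponent v"
  then have "exponent u i = exponent v i" for i by simp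
  then have "pos_count i u + neg_count i v = pos_count i v + neg_count i u" for i
    unfolding exponent_def by (smt (verit) of_nat_add of_nat_eq_iff)
  then show "same_exp u v" by (simp add: same_exp_def)
qed

definition occurrences :: "bool \<Rightarrow> nat \<Rightarrow> nword \<Rightarrow> (nat \<times> nat \<times> nword) list \<Rightarrow> nat" where
  "occurrences pos i u T = length (filter (\<lambda>t. (fst t \<noteq> 0 \<longleftrightarrow> pos) \<and> fst (snd t) = i \<and> same_exp u (snd (snd t))) T)"

text \<open>
  The combination \<open>C\<close> of Fox derivatives is \<open>k\<close> times the \<open>i\<close>-th unit vector, as can be seen by counting
  the terms with the same monomial.
\<close>

definition is_multiple_of_unit :: "nat \<Rightarrow> nat \<Rightarrow> combination \<Rightarrow> bool" where
  "is_multiple_of_unit i k C \<longleftrightarrow>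
     occurrences True i [] (comb_terms C) = occurrences False i [] (comb_terms C) + k \<and>
     (\<forall>t\<in>set (comb_terms C). (fst (snd t) = i \<and> same_exp [] (snd (snd t))) \<or>
        occurrences True (fst (snd t)) (snd (snd t)) (comb_terms C) =
        occurrences False (fst (snd t)) (snd (snd t)) (comb_terms C))"

text \<open>
  The combinations in the list need not be in any order; for each generator there has to be a suitable one.
\<close>

definition certificate :: "nat \<Rightarrow> nword list \<Rightarrow> nat \<Rightarrow> (nat \<times> combination) list \<Rightarrow> bool" where
  "certificate n ws N Cs \<longleftrightarrow> (\<forall>i<n. \<exists>c\<in>set Cs. 0 < fst c \<and> fst c \<le> N \<and>
     (\<forall>e\<in>set (snd c). \<exists>w\<in>set ws. fst (snd e) = w) \<and> is_multiple_of_unit i (fst c) (snd c))"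

lemma sign_sum_occurrences:
  "sum_list (map (\<lambda>t. letter_sign (fst t)) (filter (\<lambda>t. fst (snd t) = i \<and> same_exp u (snd (snd t))) T)) =
   of_nat (occurrences True i u T) - of_nat (occurrences False i u T)"
  by (induction T) (auto simp: occurrences_def letter_sign_def)

lemma sum_list_by_key:
  assumes "finite K" "key ` set T \<subseteq> K"
  shows "sum_list (map f T) = (\<Sum>k\<in>K. sum_list (map f (filter (\<lambda>t. key t = k) T)))"
  using assms(2)
proof (induction T)
  case (Cons t T)
  have "(\<Sum>k\<in>K. sum_list (map f (filter (\<lambda>t. key t = k) (t # T)))) =
      (\<Sum>k\<in>K. (if key t = k then f t else 0) + sum_list (map f (filter (\<lambda>t. key t = k) T)))"
    by (intro sum.cong) auto
  also have "\<dots> = f t + (\<Sum>k\<in>K. sum_list (map f (filter (\<lambda>t. key t = k) T)))"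
    using Cons.prems assms(1) by (simp add: sum.distrib)
  finally show ?case using Cons by simp
qed simp

lemma monomial_eq_prod:
  assumes "fst ` set u \<subseteq> {..<B}"
  shows "monomial a b u = (\<Prod>i<B. a i ^ pos_count i u * b i ^ neg_count i u)"
  using assms
proof (induction u)
  case (Cons l u)
  define c where "c = (if snd l \<noteq> 0 then a (fst l) else b (fst l))"
  have "(\<Prod>i<B. a i ^ pos_count i (l # u) * b i ^ neg_count i (l # u)) =
      (\<Prod>i<B. (if i = fst l then c else 1) * (a i ^ pos_count i u * b i ^ neg_count i u))"
    by (intro prod.cong) (auto simp: c_def pos_count_def neg_count_def ac_simps)
  also have "\<dots> = c * (\<Prod>i<B. a i ^ pos_count i u * b i ^ neg_count i u)"
    using Cons.prems by (simp add: prod.distrib)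
  finally show ?case using Cons by (simp add: c_def)
qed (simp add: pos_count_def neg_count_def)

lemma monomial_cong:
  fixes m :: int
  assumes ab: "\<And>i. [a i * b i = 1] (mod m)" and same: "same_exp u v"
  shows "[monomial a b u = monomial a b v] (mod m)"
proof -
  have pow: "[a i ^ (x + k) * b i ^ (y + k) = a i ^ x * b i ^ y] (mod m)" for i x y k
  proof -
    have "a i ^ (x + k) * b i ^ (y + k) = (a i * b i) ^ k * (a i ^ x * b i ^ y)"
      by (simp add: power_add power_mult_distrib algebra_simps)
    also have "[\<dots> = 1 ^ k * (a i ^ x * b i ^ y)] (mod m)"
      by (intro cong_mult cong_pow ab cong_refl)
    finally show ?thesis by simp
  qed
  have "[a i ^ pos_count i u * b i ^ neg_count i u = a i ^ pos_count i v * b i ^ neg_count i v] (mod m)" for i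
  proof -
    have "exponent u i = exponent v i" using same by (simp add: same_exp_iff)
    then have e: "pos_count i u + neg_count i v = pos_count i v + neg_count i u"
      unfolding exponent_def by linarith
    show ?thesis
    proof (cases "pos_count i u \<le> pos_count i v")
      case True
      then obtain k where "pos_count i v = pos_count i u + k" by (metis le_Suc_ex)
      moreover from this have "neg_count i v = neg_count i u + k" using e by simp
      ultimately show ?thesis using pow by (simp add: cong_sym)
    next
      case False
      then obtain k where "pos_count i u = pos_count i v + k" by (metis le_Suc_ex nle_le)
      moreover from this have "neg_count i u = neg_count i v + k" using e by simp
      ultimately show ?thesis using pow by simp
    qed
  qed
  moreover obtain B where "fst ` set (u @ v) \<subseteq> {..<B}"
    by (metis finite_imageI finite_nat_iff_bounded finite_set)
  then have "fst ` set u \<subseteq> {..<B}" "fst ` set v \<subseteq> {..<B}" by auto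
  ultimately show ?thesis by (simp add: monomial_eq_prod cong_prod)
qed

text \<open>
  Terms with the same generator and exponents have the same value, so they cancel or add up according to the
  signs counted by the certificate.
\<close>

lemma comb_val_multiple_of_unit:
  fixes m :: int
  assumes ab: "\<And>i. [a i * b i = 1] (mod m)" and mult: "is_multiple_of_unit i k C"
  shows "[comb_val a b d C = int k * d i] (mod m)"
proof -
  define T where "T = comb_terms C"
  define key where "key t = (fst (snd t), exponent (snd (snd t)))" for t :: "nat \<times> nat \<times> nword"
  define g where "g t = monomial a b (snd (snd t)) * d (fst (snd t))" for t :: "nat \<times> nat \<times> nword"
  define t0 :: "nat \<times> nat \<times> nword" where "t0 = (1, i, [])"
  have g_cong: "[g t = g t'] (mod m)" if "key t = key t'" for t t'
    using that monomial_cong[OF ab, of "snd (snd t)" "snd (snd t')"]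
    by (simp add: g_def key_def same_exp_iff cong_scalar_right)
  define K where "K = insert (key t0) (key ` set T)"
  define D where "D r = int (occurrences True (fst (snd r)) (snd (snd r)) T) - int (occurrences False (fst (snd r)) (snd (snd r)) T)"
    for r :: "nat \<times> nat \<times> nword"
  have count: "sum_list (map (\<lambda>t. letter_sign (fst t)) (filter (\<lambda>t. key t = key r) T)) = D r" for r
  proof -
    have e: "(\<lambda>t. key t = key r) = (\<lambda>t. fst (snd t) = fst (snd r) \<and> same_exp (snd (snd r)) (snd (snd t)))"
      by (auto simp: key_def same_exp_iff)
    show ?thesis unfolding e D_def by (rule sign_sum_occurrences)
  qed
  have block: "[sum_list (map (term_val a b d) (filter (\<lambda>t. key t = key r) T)) = g r * D r] (mod m)" for r
  proof -
    have "[sum_list (map (term_val a b d) (filter (\<lambda>t. key t = key r) S)) =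
        g r * sum_list (map (\<lambda>t. letter_sign (fst t)) (filter (\<lambda>t. key t = key r) S))] (mod m)" for S
    proof (induction S)
      case (Cons t S)
      have "[term_val a b d t = g r * letter_sign (fst t)] (mod m)" if "key t = key r"
        using cong_scalar_left[OF g_cong[OF that], of "letter_sign (fst t)"] by (simp add: term_val_def g_def mult.commute)
      then show ?case using Cons by (auto simp: distrib_left intro: cong_add)
    qed simp
    from this[of T] show ?thesis by (simp only: count)
  qed
  have zero: "D r = 0" if "r \<in> set T" "key r \<noteq> key t0" for r
    using that mult by (auto simp: is_multiple_of_unit_def T_def[symmetric] D_def key_def t0_def same_exp_iff)
  have "comb_val a b d C = (\<Sum>\<kappa>\<in>K. sum_list (map (term_val a b d) (filter (\<lambda>t. key t = \<kappa>) T)))"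
    unfolding comb_val_eq_terms T_def[symmetric] by (rule sum_list_by_key) (auto simp: K_def)
  also have "[\<dots> = (\<Sum>\<kappa>\<in>K. if \<kappa> = key t0 then g t0 * D t0 else 0)] (mod m)"
  proof (rule cong_sum)
    fix \<kappa> assume \<kappa>: "\<kappa> \<in> K"
    show "[sum_list (map (term_val a b d) (filter (\<lambda>t. key t = \<kappa>) T)) = (if \<kappa> = key t0 then g t0 * D t0 else 0)] (mod m)"
    proof (cases "\<kappa> = key t0")
      case False
      then obtain r where "r \<in> set T" "\<kappa> = key r" using \<kappa> by (auto simp: K_def)
      then show ?thesis using block[of r] zero[of r] False by simp
    qed (use block in simp)
  qed
  also have "(\<Sum>\<kappa>\<in>K. if \<kappa> = key t0 then g t0 * D t0 else 0) = g t0 * D t0" by (simp add: K_def)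
  also have "\<dots> = int k * d i"
    using mult by (simp add: is_multiple_of_unit_def T_def[symmetric] D_def g_def t0_def)
  finally show ?thesis .
qed

lemma act_cong_letters:
  "(\<And>i. i \<in> fst ` set w \<Longrightarrow> a i = a' i \<and> b i = b' i \<and> d i = d' i) \<Longrightarrow> act a b d w t = act a' b' d' w t"
  by (induction w) auto

text \<open>
  At a fixed point all Fox derivatives of the words, applied to the vector \<open>d\<close>, vanish modulo \<open>p\<close>, and so does every
  combination of them. So \<open>p\<close> divides \<open>k * d i\<close>, where \<open>k\<close> is the certified multiple of the \<open>i\<close>-th unit vector; for
  an \<open>i\<close> with \<open>d i\<close> not divisible by \<open>p\<close> this gives \<open>p \<le> k\<close>.
\<close>

lemma certificate_sound:
  assumes cert: "certificate n ws N Cs" and obs: "obstructed p n (map word_of ws)"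
    and letters: "\<And>w. w \<in> set ws \<Longrightarrow> fst ` set w \<subseteq> {..<n}"
  shows "p \<le> N"
proof -
  obtain a b d where p: "prime p" and fp: "fixed_point p n (map word_of ws) a b d"
    using obs by (auto simp: obstructed_def)
  obtain i where i: "i < n" "\<not> int p dvd d i" using fp by (auto simp: fixed_point_def)
  obtain c where c: "0 < fst c" "fst c \<le> N" "\<forall>e\<in>set (snd c). \<exists>w\<in>set ws. fst (snd e) = w"
    "is_multiple_of_unit i (fst c) (snd c)"
    using cert i(1) unfolding certificate_def by blast
  define k C where "k = fst c" and "C = snd c"
  have C: "0 < k" "k \<le> N" "\<And>e. e \<in> set C \<Longrightarrow> fst (snd e) \<in> set ws" "is_multiple_of_unit i k C"
    using c by (auto simp: k_def C_def)
  \<comment> \<open>The monomials of a certificate may contain generators of any index; those from \<open>n\<close> on get slope one.\<close>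
  define a' where "a' = (\<lambda>i. if i < n then a i else 1)"
  define b' where "b' = (\<lambda>i. if i < n then b i else 1)"
  have ab: "[a' i * b' i = 1] (mod int p)" for i using fp by (simp add: fixed_point_def a'_def b'_def)
  have act_dvd: "int p dvd act a' b' d (word_of w) 0" if w: "w \<in> set ws" for w
  proof -
    have "act a' b' d (word_of w) 0 = act a b d (word_of w) 0"
      using letters[OF w] by (intro act_cong_letters) (auto simp: a'_def b'_def word_of_def)
    then show ?thesis using fp w by (simp add: fixed_point_def)
  qed
  have "int p dvd comb_val a' b' d C'" if "\<forall>e\<in>set C'. fst (snd e) \<in> set ws" for C'
    using that
  proof (induction C')
    case (Cons c C')
    then have "int p dvd act a' b' d (word_of (fst (snd c))) 0" "int p dvd comb_val a' b' d C'"
      using act_dvd by simp_all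
    then show ?case by (simp add: comb_val_def)
  qed (simp add: comb_val_def)
  then have "int p dvd comb_val a' b' d C" using C(3) by blast
  then have "int p dvd int k * d i"
    by (rule cong_dvd_iff[OF comb_val_multiple_of_unit[OF ab C(4)], THEN iffD1])
  then have "int p dvd int k" using i(2) p by (metis prime_dvd_mult_iff prime_nat_int_transfer)
  then have "p \<le> k" using C(1) by (simp add: dvd_imp_le)
  then show ?thesis using C(2) by simp
qed

section \<open>Existence of certificates\<close>

text \<open>The group ring of a free abelian group, that is, the ring of Laurent polynomials.\<close>

type_synonym laurent = "(nat \<Rightarrow>\<^sub>0 int) \<Rightarrow>\<^sub>0 rat"

definition gen_x :: "nat \<Rightarrow> laurent" where
  "gen_x i = Poly_Mapping.single (Poly_Mapping.single i 1) 1"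

definition gen_y :: "nat \<Rightarrow> laurent" where
  "gen_y i = Poly_Mapping.single (Poly_Mapping.single i (- 1)) 1"

definition exp_vec :: "nword \<Rightarrow> nat \<Rightarrow>\<^sub>0 int" where
  "exp_vec u = foldr (\<lambda>l e. Poly_Mapping.single (fst l) (if snd l \<noteq> 0 then 1 else - 1) + e) u 0"

lemma gen_x_y: "gen_x i * gen_y i = 1"
  by (simp add: gen_x_def gen_y_def mult_single flip: single_add)

lemma exp_vec_append: "exp_vec (u @ v) = exp_vec u + exp_vec v"
  by (induction u) (simp_all add: exp_vec_def add.assoc)

lemma lookup_exp_vec: "Poly_Mapping.lookup (exp_vec u) = exponent u"
proof
  show "Poly_Mapping.lookup (exp_vec u) i = exponent u i" for i
    by (induction u) (auto simp: exp_vec_def exponent_def pos_count_def neg_count_def lookup_add lookup_single when_def)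
qed

lemma exp_vec_eq_iff: "exp_vec u = exp_vec v \<longleftrightarrow> same_exp u v"
  by (simp add: poly_mapping_eq_iff lookup_exp_vec same_exp_iff)

lemma monomial_laurent: "monomial gen_x gen_y u = Poly_Mapping.single (exp_vec u) 1"
  by (induction u) (auto simp: exp_vec_def gen_x_def gen_y_def mult_single)

lemma ex_exp_vec: "\<exists>u. exp_vec u = e"
proof -
  have "Poly_Mapping.keys e \<subseteq> UNIV" by simp
  then show ?thesis
  proof (induction e rule: frag_induction)
    case zero
    show ?case by (intro exI[of _ "[]"]) (simp add: exp_vec_def)
  next
    case (one x)
    show ?case by (intro exI[of _ "[(x, 1)]"]) (simp add: exp_vec_def)
  next
    case (diff e f)
    then obtain u v where uv: "exp_vec u = e" "exp_vec v = f" by blast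
    have "exp_vec (map (\<lambda>l. (fst l, if snd l \<noteq> 0 then 0 else 1)) v) = - exp_vec v"
      by (induction v) (auto simp: exp_vec_def single_uminus)
    then show ?case using uv
      by (intro exI[of _ "u @ map (\<lambda>l. (fst l, if snd l \<noteq> 0 then 0 else 1)) v"]) (simp add: exp_vec_append)
  qed
qed

definition comb_row :: "combination \<Rightarrow> nat \<Rightarrow> laurent" where
  "comb_row C i = comb_val gen_x gen_y (\<lambda>l. of_bool (l = i)) C"

lemma comb_row_append: "comb_row (C @ C') i = comb_row C i + comb_row C' i"
  by (simp add: comb_row_def comb_val_def)

lemma comb_row_replicate: "comb_row (concat (replicate k C)) i = of_nat k * comb_row C i"
  by (induction k) (simp_all add: comb_row_append algebra_simps, simp add: comb_row_def comb_val_def)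

definition shift_comb :: "nat \<Rightarrow> nword \<Rightarrow> combination \<Rightarrow> combination" where
  "shift_comb s u C = map (\<lambda>c. (if s = 0 then (if fst c = 0 then 1 else 0) else fst c, fst (snd c), u @ snd (snd c))) C"

lemma comb_row_shift: "comb_row (shift_comb s u C) i = letter_sign s * (monomial gen_x gen_y u * comb_row C i)"
  by (induction C) (simp_all add: shift_comb_def comb_row_def comb_val_def letter_sign_def algebra_simps)

text \<open>
  The number of positive minus the number of negative terms is a coefficient of a Laurent polynomial.
\<close>

lemma lookup_comb_row:
  "Poly_Mapping.lookup (comb_row C i) (exp_vec u) =
   of_nat (occurrences True i u (comb_terms C)) - of_nat (occurrences False i u (comb_terms C))"
proof -
  have "Poly_Mapping.lookup (sum_list (map (term_val gen_x gen_y (\<lambda>l. of_bool (l = i))) T)) (exp_vec u) =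
      sum_list (map (\<lambda>t. letter_sign (fst t) :: rat) (filter (\<lambda>t. fst (snd t) = i \<and> same_exp u (snd (snd t))) T))" for T
  proof (induction T)
    case (Cons t T)
    have "Poly_Mapping.lookup (term_val gen_x gen_y (\<lambda>l. of_bool (l = i)) t) (exp_vec u) =
        (if fst (snd t) = i \<and> same_exp u (snd (snd t)) then letter_sign (fst t) else 0)"
      by (auto simp: term_val_def monomial_laurent letter_sign_def lookup_single when_def exp_vec_eq_iff[symmetric])
    then show ?case using Cons by (simp add: lookup_add)
  qed simp
  then show ?thesis by (simp add: comb_row_def comb_val_eq_terms sign_sum_occurrences)
qed

lemma multiple_of_unitI:
  assumes "\<And>l. of_nat k * of_bool (l = i) = comb_row C l"
  shows "is_multiple_of_unit i k C"
proof -
  have "(of_nat (occurrences True l u (comb_terms C)) :: rat) =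
      of_nat (occurrences False l u (comb_terms C)) + of_nat (k * of_bool (l = i \<and> same_exp [] u))" for l u
  proof -
    have z: "exp_vec u = 0 \<longleftrightarrow> same_exp [] u"
      using exp_vec_eq_iff[of "[]" u] by (auto simp: exp_vec_def)
    have "Poly_Mapping.lookup (comb_row C l) (exp_vec u) = of_nat (k * of_bool (l = i \<and> same_exp [] u))"
      unfolding assms[symmetric] by (auto simp: lookup_of_nat when_def z)
    then show ?thesis using lookup_comb_row[of C l u] by (simp add: algebra_simps)
  qed
  then have "occurrences True l u (comb_terms C) =
      occurrences False l u (comb_terms C) + k * of_bool (l = i \<and> same_exp [] u)" for l u
    by (metis of_nat_add of_nat_eq_iff)
  moreover have "same_exp [] []" by (simp add: same_exp_def)
  ultimately show ?thesis by (auto simp: is_multiple_of_unit_def)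
qed

text \<open>
  The rows which are combinations of Fox derivatives after multiplication by a positive integer. Combinations
  have coefficients \<open>1\<close> and \<open>- 1\<close> only: integer factors are expressed by repetition, and denominators are cleared by
  the multiple.
\<close>

lemma submodule_certified:
  "submodule_set {x :: nat \<Rightarrow> laurent. \<exists>N>0. \<exists>C. (\<forall>c\<in>set C. fst (snd c) \<in> W) \<and> (\<forall>i. of_nat N * x i = comb_row C i)}"
  (is "submodule_set ?L")
proof -
  have add: "(\<lambda>i. x i + y i) \<in> ?L" if xL: "x \<in> ?L" and yL: "y \<in> ?L" for x y
  proof -
    obtain N C where C: "N > 0" "\<forall>c\<in>set C. fst (snd c) \<in> W" "\<And>i. of_nat N * x i = comb_row C i" using xL by auto
    obtain M D where D: "M > 0" "\<forall>c\<in>set D. fst (snd c) \<in> W" "\<And>i. of_nat M * y i = comb_row D i" using yL by auto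
    have "of_nat (N * M) * (x i + y i) = comb_row (concat (replicate M C) @ concat (replicate N D)) i" for i
      by (simp add: comb_row_append comb_row_replicate algebra_simps flip: C(3) D(3))
    moreover have "\<forall>c\<in>set (concat (replicate M C) @ concat (replicate N D)). fst (snd c) \<in> W"
      using C(2) D(2) by auto
    ultimately show ?thesis using C(1) D(1)
      by (intro CollectI exI[of _ "N * M"] conjI exI[of _ "concat (replicate M C) @ concat (replicate N D)"]) auto
  qed
  have zero: "(\<lambda>_. 0) \<in> ?L"
    by (intro CollectI exI[of _ 1] conjI exI[of _ "[]"]) (auto simp: comb_row_def comb_val_def)
  have monom: "(\<lambda>i. Poly_Mapping.single e q * x i) \<in> ?L" if x: "x \<in> ?L" for e q x
  proof -
    obtain N C where C: "N > 0" "\<forall>c\<in>set C. fst (snd c) \<in> W" "\<And>i. of_nat N * x i = comb_row C i"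
      using x by auto
    obtain u where u: "exp_vec u = e" using ex_exp_vec by blast
    obtain z :: int and D :: nat where zD: "D > 0" "of_nat D * q = of_int z"
    proof -
      obtain z D' where "quotient_of q = (z, D')" by (cases "quotient_of q")
      then have D': "D' > 0" "q = of_int z / of_int D'" using quotient_of_denom_pos quotient_of_div by blast+
      then have "of_nat (nat D') * q = of_int z" by simp
      then show ?thesis using D'(1) by (intro that[of "nat D'"]) auto
    qed
    define s :: nat where "s = (if z < 0 then 0 else 1)"
    have z: "of_int z = letter_sign s * (of_nat (nat \<bar>z\<bar>) :: laurent)" by (simp add: s_def letter_sign_def)
    have "of_nat D * Poly_Mapping.single e q = Poly_Mapping.single e (of_nat D * q)"
      using mult_single[of 0 "of_nat D" e q] by simp
    also have "\<dots> = of_int z * Poly_Mapping.single e 1"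
      using mult_single[of 0 "of_int z" e "1::rat"] by (simp add: zD(2))
    finally have e: "of_nat D * Poly_Mapping.single e q = of_int z * monomial gen_x gen_y u"
      by (simp add: monomial_laurent u)
    have "of_nat (D * N) * (Poly_Mapping.single e q * x i) =
        comb_row (concat (replicate (nat \<bar>z\<bar>) (shift_comb s u C))) i" for i
    proof -
      have "of_nat (D * N) * (Poly_Mapping.single e q * x i) = (of_nat D * Poly_Mapping.single e q) * (of_nat N * x i)"
        by (simp add: algebra_simps)
      also have "\<dots> = of_nat (nat \<bar>z\<bar>) * (letter_sign s * (monomial gen_x gen_y u * comb_row C i))"
        unfolding e C(3) z by (simp only: ac_simps)
      also have "\<dots> = comb_row (concat (replicate (nat \<bar>z\<bar>) (shift_comb s u C))) i"
        by (simp only: comb_row_replicate comb_row_shift)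
      finally show ?thesis .
    qed
    moreover have "\<forall>c\<in>set (concat (replicate (nat \<bar>z\<bar>) (shift_comb s u C))). fst (snd c) \<in> W"
      using C(2) by (auto simp: shift_comb_def)
    ultimately show ?thesis using C(1) zD(1)
      by (intro CollectI exI[of _ "D * N"] conjI exI[of _ "concat (replicate (nat \<bar>z\<bar>) (shift_comb s u C))"]) auto
  qed
  have scale: "(\<lambda>i. r * x i) \<in> ?L" if x: "x \<in> ?L" for r x
  proof (induction r rule: Poly_Mapping.update_induct)
    case const
    show ?case using zero by simp
  next
    case (update f e q)
    have "Poly_Mapping.update e q f = f + Poly_Mapping.single e q"
      by (rule poly_mapping_eqI)
         (use update(1) in \<open>auto simp: lookup_update lookup_add lookup_single when_def not_in_keys_iff_lookup_eq_zero\<close>)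
    then show ?case using add[OF update(3) monom[OF x, of e q]] by (simp add: distrib_right)
  qed
  show ?thesis unfolding submodule_set_def by (intro conjI ballI allI zero add scale)
qed

text \<open>
  If some unit vector were missing in the submodule of rows with certified multiples, the Fox derivatives would lie in a proper
  submodule and give an obstruction at some prime. The sum of the certified multiples bounds each of them.
\<close>

lemma ex_certificate:
  assumes letters: "\<And>w. w \<in> set ws \<Longrightarrow> fst ` set w \<subseteq> {..<n}"
    and not_obs: "\<And>p. \<not> obstructed p n (map word_of ws)"
  shows "\<exists>N Cs. certificate n ws N Cs"
proof -
  define L where "L = {x :: nat \<Rightarrow> laurent. \<exists>N>0. \<exists>C. (\<forall>c\<in>set C. fst (snd c) \<in> set ws) \<and> (\<forall>i. of_nat N * x i = comb_row C i)}"
  have L: "submodule_set L" unfolding L_def by (rule submodule_certified)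
  have fox: "fox gen_x gen_y w \<in> L" if w: "w \<in> set (map word_of ws)" for w
  proof -
    obtain w' where w': "w' \<in> set ws" "w = word_of w'" using w by auto
    then show ?thesis unfolding L_def
      by (intro CollectI exI[of _ 1] conjI exI[of _ "[(1, w', [])]"])
         (auto simp: comb_row_def comb_val_def fox_def letter_sign_def)
  qed
  have unit: "\<exists>r. r * of_int k = (1 :: laurent)" if "k \<noteq> 0" for k
  proof
    show "Poly_Mapping.single 0 (1 / of_int k) * of_int k = (1 :: laurent)"
      using that by (simp add: mult_single flip: single_of_int)
  qed
  have "\<forall>i<n. unit_vec i \<in> L"
  proof (rule ccontr)
    assume "\<not> ?thesis"
    then have "\<exists>i<n. unit_vec i \<notin> L" by blast
    then have "\<exists>p. obstructed p n (map word_of ws)"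
      by (rule ex_obstruction[OF gen_x_y L _ _ fox unit]) (use letters in \<open>force simp: word_of_def\<close>)+
    then show False using not_obs by blast
  qed
  then have "\<forall>i<n. \<exists>c. 0 < fst c \<and> (\<forall>e\<in>set (snd c). fst (snd e) \<in> set ws) \<and> is_multiple_of_unit i (fst c) (snd c)"
  proof (intro allI impI)
    fix i assume *: "\<forall>i<n. unit_vec i \<in> L" "i < n"
    then obtain N C where "N > 0" "\<forall>c\<in>set C. fst (snd c) \<in> set ws" "\<And>l. of_nat N * unit_vec i l = comb_row C l"
      unfolding L_def by blast
    then show "\<exists>c. 0 < fst c \<and> (\<forall>e\<in>set (snd c). fst (snd e) \<in> set ws) \<and> is_multiple_of_unit i (fst c) (snd c)"
      by (intro exI[of _ "(N, C)"]) (auto simp: unit_vec_def intro: multiple_of_unitI)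
  qed
  then obtain cs where c: "\<And>i. i < n \<Longrightarrow> 0 < fst (cs i) \<and> (\<forall>e\<in>set (snd (cs i)). fst (snd e) \<in> set ws) \<and>
      is_multiple_of_unit i (fst (cs i)) (snd (cs i))" by metis
  have "certificate n ws (\<Sum>i<n. fst (cs i)) (map cs [0..<n])" unfolding certificate_def
  proof (intro allI impI)
    fix i assume i: "i < n"
    then have "fst (cs i) \<le> (\<Sum>i<n. fst (cs i))" by (intro member_le_sum) auto
    then show "\<exists>c\<in>set (map cs [0..<n]). 0 < fst c \<and> fst c \<le> (\<Sum>i<n. fst (cs i)) \<and>
        (\<forall>e\<in>set (snd c). \<exists>w\<in>set ws. fst (snd e) = w) \<and> is_multiple_of_unit i (fst c) (snd c)"
      using c[OF i] i by (intro bexI[of _ "cs i"]) auto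
  qed
  then show ?thesis by blast
qed

section \<open>The decision procedure\<close>

text \<open>
  Backward chaining needs the projections here: its goals are abstractions over a single variable, which a
  pattern over pairs does not match.
\<close>

lemma computable_binders:
  shows computable_map_intro: "computable (\<lambda>z. g (fst z) (snd z)) \<Longrightarrow> computable l \<Longrightarrow> computable (\<lambda>x. map (\<lambda>y. g y x) (l x))"
    and computable_filter_intro: "decides (\<lambda>z. P (fst z) (snd z)) \<Longrightarrow> computable l \<Longrightarrow> computable (\<lambda>x. filter (\<lambda>y. P y x) (l x))"
    and decides_Ball_list_intro: "decides (\<lambda>z. P (fst z) (snd z)) \<Longrightarrow> computable l \<Longrightarrow> decides (\<lambda>x. \<forall>y\<in>set (l x). P y x)"
    and decides_Bex_list_intro: "decides (\<lambda>z. P (fst z) (snd z)) \<Longrightarrow> computable l \<Longrightarrow> decides (\<lambda>x. \<exists>y\<in>set (l x). P y x)"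
    and decides_All_less_intro: "decides (\<lambda>z. R (fst z) (snd z)) \<Longrightarrow> computable n \<Longrightarrow> decides (\<lambda>x. \<forall>k::nat<n x. R k x)"
    and decides_Ex_less_intro: "decides (\<lambda>z. R (fst z) (snd z)) \<Longrightarrow> computable n \<Longrightarrow> decides (\<lambda>x. \<exists>k::nat<n x. R k x)"
  by (intro computable_map computable_filter decides_Ball_list decides_Bex_list decides_All_less decides_Ex_less;
      simp add: case_prod_beta')+

lemma computable_foldr_intro:
  "computable (\<lambda>z. g (fst z) (fst (snd z)) (snd (snd z))) \<Longrightarrow> computable s \<Longrightarrow> computable l \<Longrightarrow>
   computable (\<lambda>x. foldr (\<lambda>y s. g y s x) (l x) (s x))"
  by (intro computable_foldr) (simp_all add: case_prod_beta')

lemmas computable_intros = computable_basic computable_append computable_concat computable_length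
  computable_upt computable_mod computable_n_lists computable_entry
  computable_binders computable_foldr_intro

lemma computable_fox_terms0: "computable fox_terms"
  unfolding fox_terms_def by (intro computable_intros)

lemmas computable_fox_terms = computable_comp[OF computable_fox_terms0]

lemma computable_comb_terms0: "computable comb_terms"
  unfolding comb_terms_def by (intro computable_intros computable_fox_terms)

lemmas computable_comb_terms = computable_comp[OF computable_comb_terms0]

lemma decides_same_exp:
  "computable u \<Longrightarrow> computable v \<Longrightarrow> decides (\<lambda>x. same_exp (u x) (v x))"
proof -
  have *: "decides (\<lambda>z. same_exp (fst z) (snd z))"
    unfolding same_exp_def pos_count_def neg_count_def by (intro computable_intros)
  show "computable u \<Longrightarrow> computable v \<Longrightarrow> decides (\<lambda>x. same_exp (u x) (v x))"
    using decides_comp[OF * computable_Pair[of u v]] by simp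
qed

lemma decides_iff_const: "decides P \<Longrightarrow> decides (\<lambda>x. P x = c)"
  by (cases c) (simp_all add: decides_not)

lemma computable_occurrences:
  assumes "computable i" "computable u" "computable T"
  shows "computable (\<lambda>x. occurrences pos (i x) (u x) (T x))"
proof -
  have "computable (\<lambda>z :: nat \<times> nword \<times> (nat \<times> nat \<times> nword) list. occurrences pos (fst z) (fst (snd z)) (snd (snd z)))"
    unfolding occurrences_def by (intro computable_intros decides_same_exp decides_iff_const)
  from computable_comp[OF this computable_Pair[OF assms(1) computable_Pair[OF assms(2,3)]]] show ?thesis by simp
qed

lemma decides_is_multiple_of_unit:
  assumes "computable i" "computable k" "computable C"
  shows "decides (\<lambda>x. is_multiple_of_unit (i x) (k x) (C x))"
proof -
  have "decides (\<lambda>z :: nat \<times> nat \<times> combination. is_multiple_of_unit (fst z) (fst (snd z)) (snd (snd z)))"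
    unfolding is_multiple_of_unit_def
    by (intro computable_intros decides_same_exp computable_occurrences computable_comb_terms)
  from decides_comp[OF this computable_Pair[OF assms(1) computable_Pair[OF assms(2,3)]]] show ?thesis by simp
qed

lemma decides_certificate:
  assumes "computable n" "computable ws" "computable N" "computable Cs"
  shows "decides (\<lambda>x. certificate (n x) (ws x) (N x) (Cs x))"
proof -
  have "decides (\<lambda>z :: nat \<times> nword list \<times> nat \<times> (nat \<times> combination) list.
      certificate (fst z) (fst (snd z)) (fst (snd (snd z))) (snd (snd (snd z))))"
    unfolding certificate_def by (intro computable_intros decides_is_multiple_of_unit)
  from decides_comp[OF this computable_Pair[OF assms(1) computable_Pair[OF assms(2) computable_Pair[OF assms(3,4)]]]]
  show ?thesis by simp
qed

text \<open>
  All computations are done with natural numbers below \<open>p\<close>, hence the detour by \<open>p\<close> in the subtraction of a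
  translation part.
\<close>

definition act_mod :: "nat \<Rightarrow> nat list \<Rightarrow> nat list \<Rightarrow> nat list \<Rightarrow> nword \<Rightarrow> nat" where
  "act_mod p as bs ds w = foldr (\<lambda>l x. (if snd l \<noteq> 0 then entry as (fst l) * x + entry ds (fst l)
     else entry bs (fst l) * (x + (p - entry ds (fst l)))) mod p) w 0"

definition obstructed_check :: "nat \<Rightarrow> nat \<Rightarrow> nword list \<Rightarrow> bool" where
  "obstructed_check p n ws \<longleftrightarrow> (1 < p \<and> (\<forall>q<p. \<forall>r<p. q * r \<noteq> p)) \<and>
     (\<exists>as\<in>set (List.n_lists n [0..<p]). \<exists>bs\<in>set (List.n_lists n [0..<p]). \<exists>ds\<in>set (List.n_lists n [0..<p]).
        (\<forall>i<n. entry as i * entry bs i mod p = 1) \<and> (\<exists>i<n. entry ds i \<noteq> 0) \<and>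
        (\<forall>w\<in>set ws. act_mod p as bs ds w = 0))"

lemma prime_iff_no_factors: "prime (p::nat) \<longleftrightarrow> 1 < p \<and> (\<forall>q<p. \<forall>r<p. q * r \<noteq> p)"
proof (intro iffI conjI allI impI)
  show "1 < p" if "prime p" using that by (rule prime_gt_1_nat)
  fix q r assume *: "prime p" "q < p" "r < p"
  show "q * r \<noteq> p"
  proof
    assume "q * r = p"
    then have "q = 1 \<or> r = 1" using *(1) by (metis prime_product)
    then show False using * \<open>q * r = p\<close> by auto
  qed
next
  assume *: "1 < p \<and> (\<forall>q<p. \<forall>r<p. q * r \<noteq> p)"
  show "prime p" unfolding prime_nat_iff
  proof (intro conjI allI impI)
    fix m assume "m dvd p"
    then obtain k where k: "p = m * k" ..
    show "m = 1 \<or> m = p"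
    proof (rule ccontr)
      assume "\<not> ?thesis"
      moreover have "m \<le> p" "k \<le> p" using k * by (cases m; cases k; simp)+
      moreover have "k \<noteq> p"
      proof
        assume "k = p"
        then have "m * p = 1 * p" using k by (metis mult_1)
        moreover have "p \<noteq> 0" using * by simp
        ultimately have "m = 1" by (metis mult_right_cancel)
        then show False using \<open>\<not> (m = 1 \<or> m = p)\<close> by simp
      qed
      ultimately have "m < p" "k < p" by simp_all
      then show False using * k by blast
    qed
  qed (use * in simp)
qed

lemma act_mod_cong:
  assumes "\<And>i. i \<in> fst ` set w \<Longrightarrow> [a i = int (entry as i)] (mod int p) \<and> [b i = int (entry bs i)] (mod int p) \<and>
      [d i = int (entry ds i)] (mod int p) \<and> entry ds i \<le> p"
  shows "[act a b d (word_of w) 0 = int (act_mod p as bs ds w)] (mod int p)"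
  using assms
proof (induction w)
  case (Cons l w)
  define t where "t = act_mod p as bs ds w"
  define i where "i = fst l"
  have IH: "[act a b d (word_of w) 0 = int t] (mod int p)" unfolding t_def using Cons by auto
  have e: "[a i = int (entry as i)] (mod int p)" "[b i = int (entry bs i)] (mod int p)"
      "[d i = int (entry ds i)] (mod int p)" "entry ds i \<le> p" using Cons.prems[of i] by (auto simp: i_def)
  have am: "act_mod p as bs ds (l # w) = (if snd l \<noteq> 0 then entry as i * t + entry ds i
     else entry bs i * (t + (p - entry ds i))) mod p" by (simp add: act_mod_def t_def i_def)
  have md: "[int (k mod p) = int k] (mod int p)" for k by (simp add: cong_def zmod_int)
  show ?case
  proof (cases "snd l = 0")
    case True
    then have "act a b d (word_of (l # w)) 0 = b i * (act a b d (word_of w) 0 - d i)" by (simp add: word_of_def i_def)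
    also have "[\<dots> = int (entry bs i) * (int t - int (entry ds i))] (mod int p)"
      by (intro cong_mult cong_diff IH e)
    also have "[int (entry bs i) * (int t - int (entry ds i)) = int (entry bs i) * (int t + (int p - int (entry ds i)))] (mod int p)"
      by (intro cong_scalar_left) (simp add: cong_iff_dvd_diff)
    also have "int (entry bs i) * (int t + (int p - int (entry ds i))) = int (entry bs i * (t + (p - entry ds i)))"
      using e(4) by (simp add: of_nat_diff)
    also have "[\<dots> = int (act_mod p as bs ds (l # w))] (mod int p)"
      using True unfolding am by (simp only: simp_thms if_False if_True) (rule cong_sym[OF md])
    finally show ?thesis .
  next
    case False
    then have "act a b d (word_of (l # w)) 0 = a i * act a b d (word_of w) 0 + d i" by (simp add: word_of_def i_def)
    also have "[\<dots> = int (entry as i) * int t + int (entry ds i)] (mod int p)"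
      by (intro cong_mult cong_add IH e)
    also have "int (entry as i) * int t + int (entry ds i) = int (entry as i * t + entry ds i)" by simp
    also have "[\<dots> = int (act_mod p as bs ds (l # w))] (mod int p)"
      using False unfolding am by (simp only: simp_thms if_False if_True) (rule cong_sym[OF md])
    finally show ?thesis .
  qed
qed (simp add: word_of_def act_mod_def)

lemma obstructed_check_iff:
  assumes letters: "\<And>w. w \<in> set ws \<Longrightarrow> fst ` set w \<subseteq> {..<n}"
  shows "obstructed_check p n ws \<longleftrightarrow> obstructed p n (map word_of ws)"
proof
  assume *: "obstructed_check p n ws"
  then have p: "prime p" by (simp add: obstructed_check_def prime_iff_no_factors)
  obtain as bs ds where ds: "ds \<in> set (List.n_lists n [0..<p])"
    and ab: "\<forall>i<n. entry as i * entry bs i mod p = 1" and d: "\<exists>i<n. entry ds i \<noteq> 0"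
    and w0: "\<forall>w\<in>set ws. act_mod p as bs ds w = 0"
    using * unfolding obstructed_check_def by blast
  have len: "length ds = n" "set ds \<subseteq> {..<p}" using ds by (auto simp: set_n_lists)
  have dp: "entry ds i < p" for i
    using len prime_gt_0_nat[OF p] by (auto simp: entry_def dest: nth_mem)
  have "fixed_point p n (map word_of ws) (\<lambda>i. int (entry as i)) (\<lambda>i. int (entry bs i)) (\<lambda>i. int (entry ds i))"
    unfolding fixed_point_def
  proof (intro conjI allI impI ballI)
    fix i assume "i < n"
    then have "[entry as i * entry bs i = 1] (mod p)"
      using ab mod_less[OF prime_gt_1_nat[OF p]] unfolding cong_def by metis
    then show "[int (entry as i) * int (entry bs i) = 1] (mod int p)"
      by (metis cong_int_iff of_nat_1 of_nat_mult)
  next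
    obtain i where i: "i < n" "entry ds i \<noteq> 0" using d by blast
    then have "\<not> p dvd entry ds i" using dp[of i] by (auto dest: dvd_imp_le)
    then show "\<exists>i<n. \<not> int p dvd int (entry ds i)" using i(1) by auto
  next
    fix w assume "w \<in> set (map word_of ws)"
    then obtain w' where w': "w' \<in> set ws" "w = word_of w'" by auto
    have "[act (\<lambda>i. int (entry as i)) (\<lambda>i. int (entry bs i)) (\<lambda>i. int (entry ds i)) (word_of w') 0 =
        int (act_mod p as bs ds w')] (mod int p)"
      using dp by (intro act_mod_cong) (auto simp: less_imp_le)
    then show "int p dvd act (\<lambda>i. int (entry as i)) (\<lambda>i. int (entry bs i)) (\<lambda>i. int (entry ds i)) w 0"
      using w0 w' by (simp add: cong_0_iff)
  qed
  then show "obstructed p n (map word_of ws)" using p unfolding obstructed_def by blast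
next
  assume "obstructed p n (map word_of ws)"
  then obtain a b d where p: "prime p" and fp: "fixed_point p n (map word_of ws) a b d"
    by (auto simp: obstructed_def)
  have p0: "0 < p" using prime_gt_0_nat[OF p] .
  define ls where "ls f = map (\<lambda>i. nat (f i mod int p)) [0..<n]" for f :: "nat \<Rightarrow> int"
  have ls: "ls f \<in> set (List.n_lists n [0..<p])" for f
    using p0 by (auto simp: set_n_lists ls_def nat_less_iff)
  have ent: "int (entry (ls f) i) = f i mod int p" if "i < n" for f i
    using that p0 by (simp add: entry_def ls_def)
  have cong: "[f i = int (entry (ls f) i)] (mod int p)" if "i < n" for f i
    using ent[OF that, of f] by (simp add: cong_def)
  have "entry (ls a) i * entry (ls b) i mod p = 1" if i: "i < n" for i
  proof -
    have "[int (entry (ls a) i) * int (entry (ls b) i) = a i * b i] (mod int p)"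
      by (intro cong_mult cong_sym[OF cong[OF i]])
    also have "[a i * b i = 1] (mod int p)" using fp i by (simp add: fixed_point_def)
    finally have "[entry (ls a) i * entry (ls b) i = 1] (mod p)"
      by (metis cong_int_iff of_nat_1 of_nat_mult)
    then show ?thesis using prime_gt_1_nat[OF p] by (simp add: cong_def)
  qed
  moreover have "\<exists>i<n. entry (ls d) i \<noteq> 0"
  proof -
    obtain i where i: "i < n" "\<not> int p dvd d i" using fp by (auto simp: fixed_point_def)
    then have "int (entry (ls d) i) \<noteq> 0" using ent[OF i(1), of d] by (simp add: dvd_eq_mod_eq_0)
    then show ?thesis using i(1) by auto
  qed
  moreover have "act_mod p (ls a) (ls b) (ls d) w = 0" if w: "w \<in> set ws" for w
  proof -
    have "[act a b d (word_of w) 0 = int (act_mod p (ls a) (ls b) (ls d) w)] (mod int p)"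
    proof (intro act_mod_cong conjI)
      fix i assume "i \<in> fst ` set w"
      then have i: "i < n" using letters[OF w] by auto
      show "[a i = int (entry (ls a) i)] (mod int p)" "[b i = int (entry (ls b) i)] (mod int p)"
        "[d i = int (entry (ls d) i)] (mod int p)" by (rule cong[OF i])+
      have "int (entry (ls d) i) \<le> int p" using ent[OF i, of d] p0 by (simp add: less_imp_le)
      then show "entry (ls d) i \<le> p" by simp
    qed
    moreover have "int p dvd act a b d (word_of w) 0" using fp w by (simp add: fixed_point_def)
    ultimately have "p dvd act_mod p (ls a) (ls b) (ls d) w"
      by (metis cong_dvd_iff int_dvd_int_iff)
    moreover have "act_mod p (ls a) (ls b) (ls d) w < p"
      using p0 by (cases w) (simp_all add: act_mod_def)
    ultimately show ?thesis by (auto dest: dvd_imp_le)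
  qed
  ultimately show "obstructed_check p n ws"
    using p ls unfolding obstructed_check_def prime_iff_no_factors by blast
qed

lemma computable_act_mod:
  assumes "computable p" "computable as" "computable bs" "computable ds" "computable w"
  shows "computable (\<lambda>x. act_mod (p x) (as x) (bs x) (ds x) (w x))"
  unfolding act_mod_def by (intro computable_intros assms[THEN computable_comp])

lemma decides_obstructed_check:
  assumes "computable p" "computable n" "computable ws"
  shows "decides (\<lambda>x. obstructed_check (p x) (n x) (ws x))"
proof -
  have "decides (\<lambda>z :: nat \<times> nat \<times> nword list. obstructed_check (fst z) (fst (snd z)) (snd (snd z)))"
    unfolding obstructed_check_def by (intro computable_intros computable_act_mod)
  from decides_comp[OF this computable_Pair[OF assms(1) computable_Pair[OF assms(2,3)]]] show ?thesis by simp
qed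

text \<open>
  The search for a prime with a fixed point or a certificate. The second component of a solution is
  the list of combinations of a certificate. An instance with letters outside the alphabet, for which
  neither need exist, ends the search at once.
\<close>

definition solution :: "nat \<times> (nat \<times> combination) list \<Rightarrow> nat \<times> nword list \<Rightarrow> bool" where
  "solution s x \<longleftrightarrow> obstructed_check (fst s) (fst x) (snd x) \<or> certificate (fst x) (snd x) (fst s) (snd s) \<or>
     \<not> (\<forall>w\<in>set (snd x). \<forall>l\<in>set w. fst l < fst x)"

definition decode :: "nat \<Rightarrow> 'a::coded" where
  "decode = inv_into UNIV code"

lemma code_decode: "code (decode n) = n"
  unfolding decode_def using bij_code by (metis bij_is_surj surj_f_inv_f)

lemma decode_code: "decode (code x) = x"
  by (rule injD[OF bij_is_inj[OF bij_code]]) (rule code_decode)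

lemma computable_decode: "computable f \<Longrightarrow> computable (\<lambda>x. decode (f x) :: 'a::coded)"
proof -
  have "computable (decode :: nat \<Rightarrow> 'a)"
    by (rule computableI[OF rec_ext_nth[of 0]]) (simp_all add: code_decode)
  then show "computable f \<Longrightarrow> computable (\<lambda>x. decode (f x) :: 'a::coded)" by (rule computable_comp)
qed

text \<open>
  The form in which the minimisation operator expects a search: for a zero of a total function of numbers.
\<close>

definition search :: "nat \<times> nword list \<Rightarrow> nat" where
  "search x = (LEAST m. of_bool (\<not> solution (decode m) x) = (0::nat))"

definition bound :: "nat \<times> nword list \<Rightarrow> nat" where
  "bound x = fst (decode (search x) :: nat \<times> (nat \<times> combination) list)"

definition dense_check :: "nat \<times> nword list \<Rightarrow> bool" where
  "dense_check x \<longleftrightarrow> (\<forall>p<Suc (bound x). \<not> obstructed_check p (fst x) (snd x))"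

lemma ex_solution: "\<exists>s. solution s x"
proof (cases "\<forall>w\<in>set (snd x). \<forall>l\<in>set w. fst l < fst x")
  case True
  then have letters: "\<And>w. w \<in> set (snd x) \<Longrightarrow> fst ` set w \<subseteq> {..<fst x}" by auto
  show ?thesis
  proof (cases "\<exists>p. obstructed p (fst x) (map word_of (snd x))")
    case True
    then obtain p where "obstructed_check p (fst x) (snd x)" using obstructed_check_iff[OF letters] by blast
    then have "solution (p, []) x" by (simp add: solution_def)
    then show ?thesis ..
  next
    case False
    then obtain N Cs where "certificate (fst x) (snd x) N Cs" using ex_certificate[OF letters] by blast
    then have "solution (N, Cs) x" by (simp add: solution_def)
    then show ?thesis ..
  qed
next
  case False
  then show ?thesis unfolding solution_def by blast
qed

lemma ex_search: "\<exists>m. of_bool (\<not> solution (decode m) x) = (0::nat)"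
proof -
  obtain s where "solution s x" using ex_solution by blast
  then have "of_bool (\<not> solution (decode (code s)) x) = (0::nat)" by (simp add: decode_code)
  then show ?thesis by blast
qed

lemma solution_search: "solution (decode (search x)) x"
proof -
  have "of_bool (\<not> solution (decode (search x)) x) = (0::nat)"
    unfolding search_def by (rule LeastI_ex[OF ex_search])
  then show ?thesis by (simp only: of_bool_eq_0_iff not_not)
qed

text \<open>
  If no prime up to the bound has a fixed point, then the search has not stopped at a prime, so it
  has found a certificate, and the bound is the one of the certificate.
\<close>

lemma dense_check_iff:
  assumes letters: "\<And>w. w \<in> set ws \<Longrightarrow> fst ` set w \<subseteq> {..<n}"
  shows "dense_check (n, ws) \<longleftrightarrow> (\<forall>p. \<not> obstructed p n (map word_of ws))"
proof
  assume *: "dense_check (n, ws)"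
  define N where "N = bound (n, ws)"
  have small: "\<not> obstructed_check p n ws" if "p \<le> N" for p using * that by (simp add: dense_check_def N_def)
  have "\<forall>w\<in>set ws. \<forall>l\<in>set w. fst l < n" using letters by fastforce
  then obtain Cs where cert: "certificate n ws N Cs"
    using solution_search[of "(n, ws)"] small[of N] by (auto simp: solution_def N_def bound_def)
  show "\<forall>p. \<not> obstructed p n (map word_of ws)"
  proof (intro allI notI)
    fix p assume obs: "obstructed p n (map word_of ws)"
    then have "p \<le> N" by (rule certificate_sound[OF cert _ letters])
    then show False using small obs obstructed_check_iff[OF letters] by blast
  qed
next
  assume "\<forall>p. \<not> obstructed p n (map word_of ws)"
  then show "dense_check (n, ws)" by (simp add: dense_check_def obstructed_check_iff[OF letters])
qed

lemma computable_search0: "computable search"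
proof -
  have "decides (\<lambda>z :: nat \<times> nat \<times> nword list. \<not> solution (decode (fst z)) (snd z))"
    unfolding solution_def
    by (intro computable_intros decides_obstructed_check decides_certificate computable_decode)
  then have "computable (\<lambda>(m, x). of_bool (\<not> solution (decode m) x) :: nat)"
    by (simp add: decides_def case_prod_beta')
  from computable_Least[OF this ex_search] show ?thesis unfolding search_def[abs_def] .
qed

lemma decides_dense_check: "decides dense_check"
  unfolding dense_check_def[abs_def] bound_def
  by (intro computable_intros decides_obstructed_check computable_decode computable_comp[OF computable_search0])

text \<open>
  Under this change of representation, the given encoding of instances is the code of a pair.
\<close>

definition nat_word :: "word \<Rightarrow> nword" where
  "nat_word w = map (\<lambda>l. (fst l, of_bool (snd l))) w"

lemma word_of_nat_word: "word_of (nat_word w) = w"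
  by (simp add: word_of_def nat_word_def o_def)

lemma code_nat_instance: "code (n, map nat_word ws) = instance_code (n, ws)"
proof -
  have "code (nat_word w) = word_code w" for w
    by (auto simp: nat_word_def word_code_def code_list_def letter_code_def[abs_def] o_def)
  then show ?thesis by (simp add: instance_code_def code_list_def o_def)
qed

theorem corollary7p8:
  shows "decidable instance_code
           {(n :: nat, ws :: word list). set ws \<subseteq> carrier (free_group n)}
           (\<lambda>(n, ws). pro_dense U_pv (free_group n) (generate (free_group n) (set ws)))"
proof -
  obtain g where g: "rec_ext 1 g" "\<And>x. g [code x] = of_bool (dense_check x)"
    using decides_dense_check unfolding decides_def computable_def by auto
  then obtain f where f: "recursive 1 f" "\<And>x. f [code x] = of_bool (dense_check x)"
    unfolding rec_ext_def by auto
  have "f [instance_code (n, ws)] =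
      (if pro_dense U_pv (free_group n) (generate (free_group n) (set ws)) then 1 else 0)"
    if ws: "set ws \<subseteq> carrier (free_group n)" for n ws
  proof -
    have letters: "fst ` set w \<subseteq> {..<n}" if "w \<in> set (map nat_word ws)" for w
      using that ws by (fastforce simp: free_group_simps nat_word_def)
    have "dense_check (n, map nat_word ws) \<longleftrightarrow> (\<forall>p. \<not> obstructed p n ws)"
      using dense_check_iff[of "map nat_word ws", OF letters] by (simp add: o_def word_of_nat_word)
    then show ?thesis
      using f(2)[of "(n, map nat_word ws)"] dense_iff_not_obstructed[OF ws]
      by (simp only: code_nat_instance of_bool_def)
  qed
  then show ?thesis unfolding decidable_def using f(1) by auto
qed

end
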